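(* Let $\mathbb{K}$ be an infinite field, let $d \ge 2$ and $n_1,\dots,n_d,m$ be positive integers, and let $F:\mathbb{K}^{n_1}\times\cdots\times\mathbb{K}^{n_d}\to\mathbb{K}^m$ be a multilinear map. For $0\le r\le \min\{n_d,m\}$ let \[ W_{r,F}(\mathbb{K}) \coloneqq \{(\mathsf{v}_1,\dots,\mathsf{v}_{d-1})\in \mathbb{K}^{n_1}\times\cdots\times\mathbb{K}^{n_{d-1}} : \operatorname{rank} F(\mathsf{v}_1,\dots,\mathsf{v}_{d-1},\cdot) = r\}, \] where $F(\mathsf{v}_1,\dots,\mathsf{v}_{d-1},\cdot)\in\operatorname{Hom}(\mathbb{K}^{n_d},\mathbb{K}^m)$ is the induced linear map. Then \[ \operatorname{codim} \overline{Z_F(\mathbb{K})} = \min_{0\le r\le \min\{n_d,m\}} \big\{ r + \operatorname{codim}\overline{W_{r,F}(\mathbb{K})}\big\}, \] where $\overline{Z_F(\mathbb{K})}$ has codimension taken in $\overline{\mathbb{K}}^{n_1+\cdots+n_d}$ and $\overline{W_{r,F}(\mathbb{K})}$ has codimension taken in $\overline{\mathbb{K}}^{n_1+\cdots+n_{d-1}}$.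
   Context: For an infinite field $\mathbb{K}$ and a subset $S\subseteq\mathbb{K}^n$, $\overline{S}\subseteq\overline{\mathbb{K}}^n$ denotes the set of common zeros in $\overline{\mathbb{K}}^n$ ($\overline{\mathbb{K}}$ an algebraic closure) of all polynomials in $\mathbb{K}[x_1,\dots,x_n]$ that vanish on $S$; it is a Zariski closed subset of $\overline{\mathbb{K}}^n$. Dimension is that of algebraic sets, $\operatorname{codim}\overline{S} = n-\dim\overline{S}$, with the convention $\operatorname{codim}\varnothing=+\infty$. For a multilinear map $F$, the multilinear variety is $Z_F(\mathbb{K}) \coloneqq \{\mathsf{v}\in\mathbb{K}^{n_1}\times\cdots\times\mathbb{K}^{n_d}: F(\mathsf{v})=0\}$. *)

theory Defs
  imports "HOL-Library.Poly_Mapping" "HOL-Library.Function_Algebras"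
    "HOL-Library.Extended_Nat" "HOL-Algebra.Algebraic_Closure_Type"
begin

type_synonym ('v, 'a) mpoly = "('v \<Rightarrow>\<^sub>0 nat) \<Rightarrow>\<^sub>0 'a"

definition mpoly_vars :: "('v, 'a::zero) mpoly \<Rightarrow> 'v set" where
  "mpoly_vars p = \<Union> (Poly_Mapping.keys ` Poly_Mapping.keys p)"

definition meval_with :: "('a::zero \<Rightarrow> 'b::comm_semiring_1) \<Rightarrow> ('v, 'a) mpoly \<Rightarrow> ('v \<Rightarrow> 'b) \<Rightarrow> 'b" where
  "meval_with phi p x = (\<Sum>mon\<in>Poly_Mapping.keys p. phi (Poly_Mapping.lookup p mon) * (\<Prod>v\<in>Poly_Mapping.keys mon. x v ^ Poly_Mapping.lookup mon v))"

abbreviation meval :: "('v, 'a::comm_semiring_1) mpoly \<Rightarrow> ('v \<Rightarrow> 'a) \<Rightarrow> 'a" where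
  "meval \<equiv> meval_with id"

definition pts :: "'v set \<Rightarrow> ('v \<Rightarrow> 'a::zero) set" where
  "pts V = {x. \<forall>v. v \<notin> V \<longrightarrow> x v = 0}"

definition zar_closure :: "'v set \<Rightarrow> ('v \<Rightarrow> 'a::field) set \<Rightarrow> ('v \<Rightarrow> 'a alg_closure) set" where
  "zar_closure V S = {p \<in> pts V. \<forall>f :: ('v, 'a) mpoly. mpoly_vars f \<subseteq> V \<longrightarrow>
      (\<forall>s\<in>S. meval f s = 0) \<longrightarrow> meval_with to_ac f p = 0}"

definition zar_closed :: "'v set \<Rightarrow> ('v \<Rightarrow> 'b::field) set \<Rightarrow> bool" where
  "zar_closed V Y \<longleftrightarrow> (\<exists>Ps :: ('v, 'b) mpoly set. (\<forall>f\<in>Ps. mpoly_vars f \<subseteq> V) \<and>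
      Y = {p \<in> pts V. \<forall>f\<in>Ps. meval f p = 0})"

definition zar_irreducible :: "'v set \<Rightarrow> ('v \<Rightarrow> 'b::field) set \<Rightarrow> bool" where
  "zar_irreducible V Y \<longleftrightarrow> zar_closed V Y \<and> Y \<noteq> {} \<and>
     (\<forall>A B. zar_closed V A \<and> zar_closed V B \<and> Y = A \<union> B \<longrightarrow> Y = A \<or> Y = B)"

definition alg_dim :: "'v set \<Rightarrow> ('v \<Rightarrow> 'b::field) set \<Rightarrow> enat" where
  "alg_dim V Y = Sup {enat k | k. \<exists>C :: nat \<Rightarrow> ('v \<Rightarrow> 'b) set.
      (\<forall>i\<le>k. zar_irreducible V (C i) \<and> C i \<subseteq> Y) \<and> (\<forall>i<k. C i \<subset> C (Suc i))}"

definition alg_codim :: "'v set \<Rightarrow> ('v \<Rightarrow> 'b::field) set \<Rightarrow> enat" where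
  "alg_codim V Y = (if Y = {} then \<infinity> else enat (card V) - alg_dim V Y)"

definition vecs :: "nat \<Rightarrow> (nat \<Rightarrow> 'a::zero) set" where
  "vecs n = {x. \<forall>j\<ge>n. x j = 0}"

definition blocks :: "nat \<Rightarrow> (nat \<Rightarrow> nat) \<Rightarrow> (nat \<Rightarrow> nat \<Rightarrow> 'a::zero) set" where
  "blocks d n = {v. \<forall>i j. (d \<le> i \<or> n i \<le> j) \<longrightarrow> v i j = 0}"

definition multilinear :: "nat \<Rightarrow> (nat \<Rightarrow> nat) \<Rightarrow> nat \<Rightarrow> ((nat \<Rightarrow> nat \<Rightarrow> 'a::field) \<Rightarrow> nat \<Rightarrow> 'a) \<Rightarrow> bool" where
  "multilinear d n m F \<longleftrightarrow> (\<forall>v\<in>blocks d n. F v \<in> vecs m) \<and>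
     (\<forall>i<d. \<forall>v\<in>blocks d n. \<forall>x\<in>vecs (n i). \<forall>y\<in>vecs (n i). \<forall>c.
        F (v(i := (\<lambda>j. c * x j + y j))) = (\<lambda>k. c * F (v(i := x)) k + F (v(i := y)) k))"

definition coords :: "nat \<Rightarrow> (nat \<Rightarrow> nat) \<Rightarrow> (nat \<times> nat) set" where
  "coords d n = {(i, j). i < d \<and> j < n i}"

definition mult_variety :: "nat \<Rightarrow> (nat \<Rightarrow> nat) \<Rightarrow> ((nat \<Rightarrow> nat \<Rightarrow> 'a::field) \<Rightarrow> nat \<Rightarrow> 'a)
    \<Rightarrow> (nat \<times> nat \<Rightarrow> 'a) set" where
  "mult_variety d n F = {case_prod v | v. v \<in> blocks d n \<and> F v = (\<lambda>_. 0)}"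

definition lin_rank :: "nat \<Rightarrow> ((nat \<Rightarrow> 'a::field) \<Rightarrow> (nat \<Rightarrow> 'a)) \<Rightarrow> nat" where
  "lin_rank n G = vector_space.dim (\<lambda>c (x :: nat \<Rightarrow> 'a). (\<lambda>j. c * x j)) (G ` vecs n)"

definition rank_locus :: "nat \<Rightarrow> (nat \<Rightarrow> nat) \<Rightarrow> ((nat \<Rightarrow> nat \<Rightarrow> 'a::field) \<Rightarrow> nat \<Rightarrow> 'a)
    \<Rightarrow> nat \<Rightarrow> (nat \<times> nat \<Rightarrow> 'a) set" where
  "rank_locus d n F r = {case_prod v | v. v \<in> blocks (d - 1) n \<and>
      lin_rank (n (d - 1)) (\<lambda>x. F (v(d - 1 := x))) = r}"

end

theory Submission
  imports Defs
begin

text \<open>All fields involved are infinite, so polynomials are treated as polynomial functions. Call a set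
  \<open>J\<close> of coordinates independent on a set \<open>S\<close> of points if no nonzero polynomial in these coordinates
  vanishes on \<open>S\<close>. The dimension of the closure of \<open>S \<subseteq> K\<^sup>n\<close> is the largest size of a set independent
  on \<open>S\<close>: along a chain of irreducible closed sets the size grows by counting standard monomials,
  and conversely a chain of the right length arises by cutting with general hyperplanes, which needs
  the extension of points along a projection over an algebraically closed field. Independence over
  \<open>K\<close> on \<open>S\<close> is the same as independence over the algebraic closure on the closure of \<open>S\<close>.

  Over the rank-\<open>r\<close> locus, \<open>Z\<close> is a family of kernels. On finitely many pieces the kernel is
  parametrised by a fixed set \<open>T\<close> of \<open>n\<^sub>d - r\<close> of its coordinates. A set independent on the base
  together with \<open>T\<close> is independent on \<open>Z\<close>; conversely, since the other kernel coordinates are rational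
  functions of the base and of \<open>T\<close> (Gaussian elimination), every set independent on \<open>Z\<close> can be
  moved to a set of the same size inside the base coordinates and \<open>T\<close>.\<close>

section \<open>Polynomial functions and independence\<close>

text \<open>The loci need not be irreducible and K need not be algebraically closed, so there is no
  function field at hand and independent sets form no matroid: on the union of the plane x = 0 and
  the x-axis in 3-space both {x} and {y, z} are maximal. Two substitutes carry the proof. A set
  independent on a finite union is independent on one of its pieces, which replaces decomposition
  into components. And if all sets of k + 1 coordinates are dependent on S, then any k + 1
  polynomial functions satisfy a relation on S, which replaces exchange; the relation comes from
  counting, since the restrictions to S of functions of weight at most t span a space of dimension
  O(t^k). Because n_1 + ... + n_d - (dim W_r + n_d - r) = r + codim W_r, the theorem amounts to dim
  Z = max (dim W_r + n_d - r) over the nonempty loci.\<close>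

inductive_set polyfun :: "'v set \<Rightarrow> (('v \<Rightarrow> 'a::field) \<Rightarrow> 'a) set" for W :: "'v set" where
  const: "(\<lambda>p. c) \<in> polyfun W"
| coord: "v \<in> W \<Longrightarrow> (\<lambda>p. p v) \<in> polyfun W"
| add: "f \<in> polyfun W \<Longrightarrow> g \<in> polyfun W \<Longrightarrow> (\<lambda>p. f p + g p) \<in> polyfun W"
| mult: "f \<in> polyfun W \<Longrightarrow> g \<in> polyfun W \<Longrightarrow> (\<lambda>p. f p * g p) \<in> polyfun W"

lemma polyfun_mono: "f \<in> polyfun W \<Longrightarrow> W \<subseteq> W' \<Longrightarrow> f \<in> polyfun W'"
  by (induction rule: polyfun.induct) (auto intro: polyfun.intros)

lemma polyfun_uminus: "f \<in> polyfun W \<Longrightarrow> (\<lambda>p. - f p) \<in> polyfun W"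
  using polyfun.mult[OF polyfun.const[of "-1"]] by fastforce

lemma polyfun_diff: "f \<in> polyfun W \<Longrightarrow> g \<in> polyfun W \<Longrightarrow> (\<lambda>p. f p - g p) \<in> polyfun W"
  using polyfun.add[OF _ polyfun_uminus] by fastforce

lemma polyfun_power: "f \<in> polyfun W \<Longrightarrow> (\<lambda>p. f p ^ k) \<in> polyfun W"
  by (induction k) (auto intro: polyfun.intros)

lemma polyfun_sum: "(\<And>i. i \<in> A \<Longrightarrow> f i \<in> polyfun W) \<Longrightarrow> (\<lambda>p. \<Sum>i\<in>A. f i p) \<in> polyfun W"
  by (induction A rule: infinite_finite_induct) (auto intro: polyfun.intros)

lemma polyfun_prod: "(\<And>i. i \<in> A \<Longrightarrow> f i \<in> polyfun W) \<Longrightarrow> (\<lambda>p. \<Prod>i\<in>A. f i p) \<in> polyfun W"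
  by (induction A rule: infinite_finite_induct) (auto intro: polyfun.intros)

lemma polyfun_cong: "f \<in> polyfun W \<Longrightarrow> (\<And>v. v \<in> W \<Longrightarrow> p v = q v) \<Longrightarrow> f p = f q"
  by (induction rule: polyfun.induct) auto

lemma polyfun_compose:
  assumes "f \<in> polyfun W" "\<And>v. v \<in> W \<Longrightarrow> (\<lambda>p. s p v) \<in> polyfun W'"
  shows "(\<lambda>p. f (s p)) \<in> polyfun W'"
  using assms by (induction rule: polyfun.induct) (auto intro: polyfun.intros)

lemma polyfun_line:
  assumes "f \<in> polyfun W"
  shows "\<exists>P. \<forall>t. f (\<lambda>v. p v + t * q v) = poly P t"
  using assms
proof (induction rule: polyfun.induct)
  case (const c) show ?case by (rule exI[of _ "[:c:]"]) simp
next
  case (coord v) show ?case by (rule exI[of _ "[:p v, q v:]"]) simp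
next
  case (add f g) thus ?case by (metis poly_add)
next
  case (mult f g) thus ?case by (metis poly_mult)
qed

text \<open>A line through a point where \<open>f\<close> is nonzero and one where \<open>g\<close>
  is nonzero reduces this to univariate polynomials, whose nonzero product has only finitely many
  roots.\<close>

lemma polyfun_mult_eq_0:
  fixes f g :: "('v \<Rightarrow> 'a::field) \<Rightarrow> 'a"
  assumes "infinite (UNIV :: 'a set)" "f \<in> polyfun W" "g \<in> polyfun W" "\<And>p. f p * g p = 0"
  shows "(\<forall>p. f p = 0) \<or> (\<forall>p. g p = 0)"
proof (rule ccontr)
  assume "\<not> ?thesis"
  then obtain p q where p: "f p \<noteq> 0" and q: "g q \<noteq> 0" by auto
  obtain P where P: "\<And>t. f (\<lambda>v. p v + t * (q v - p v)) = poly P t"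
    using polyfun_line[OF assms(2), of p "\<lambda>v. q v - p v"] by auto
  obtain Q where Q: "\<And>t. g (\<lambda>v. p v + t * (q v - p v)) = poly Q t"
    using polyfun_line[OF assms(3), of p "\<lambda>v. q v - p v"] by auto
  have "poly P 0 \<noteq> 0" "poly Q 1 \<noteq> 0" using P[of 0] Q[of 1] p q by auto
  hence "P * Q \<noteq> 0" by auto
  hence fin: "finite {t. poly (P * Q) t = 0}" by (rule poly_roots_finite)
  have "{t. poly (P * Q) t = 0} = UNIV"
    using assms(4) by (auto simp flip: P Q)
  with fin show False using assms(1) by metis
qed

text \<open>Over an infinite field this says that the projection of \<open>S\<close> to the
  coordinates \<open>J\<close> is Zariski dense. On an empty \<open>S\<close> even
  \<open>J = {}\<close> fails, so independence also records nonemptiness.\<close>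

definition indep :: "'v set \<Rightarrow> ('v \<Rightarrow> 'a::field) set \<Rightarrow> bool" where
  "indep J S \<longleftrightarrow> (\<forall>f\<in>polyfun J. (\<forall>p\<in>S. f p = 0) \<longrightarrow> (\<forall>p. f p = 0))"

lemma indepD: "indep J S \<Longrightarrow> f \<in> polyfun J \<Longrightarrow> (\<And>p. p \<in> S \<Longrightarrow> f p = 0) \<Longrightarrow> f p = 0"
  unfolding indep_def by blast

lemma indep_mono: "indep J S \<Longrightarrow> I \<subseteq> J \<Longrightarrow> S \<subseteq> S' \<Longrightarrow> indep I S'"
  unfolding indep_def by (meson polyfun_mono subsetD)

lemma indep_empty_iff: "indep {} (S :: ('v \<Rightarrow> 'a::field) set) \<longleftrightarrow> S \<noteq> {}"
proof
  assume "indep {} S"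
  thus "S \<noteq> {}" using indepD[OF _ polyfun.const[of 1]] by fastforce
next
  assume "S \<noteq> {}"
  thus "indep {} S" unfolding indep_def using polyfun_cong[of _ "{}"] by (metis all_not_in_conv)
qed

lemma not_indep_no_points: "\<not> indep J {}"
  using indepD[OF _ polyfun.const[of 1]] by fastforce

text \<open>If \<open>f\<close> and \<open>g\<close> were relations on the two parts,
  \<open>f * g\<close> would be one on the union, and polynomial functions over an infinite field
  form a domain.\<close>

lemma indep_Un:
  fixes A B :: "('v \<Rightarrow> 'a::field) set"
  assumes "infinite (UNIV :: 'a set)" "indep J (A \<union> B)"
  shows "indep J A \<or> indep J B"
proof (rule ccontr)
  assume "\<not> ?thesis"
  then obtain f g p q where fg: "f \<in> polyfun J" "g \<in> polyfun J"
     "\<forall>p\<in>A. f p = 0" "\<forall>p\<in>B. g p = 0" "f p \<noteq> 0" "g q \<noteq> 0"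
    unfolding indep_def by auto
  have "f p * g p = 0" for p
    using indepD[OF assms(2) polyfun.mult[OF fg(1,2)]] fg by auto
  thus False using polyfun_mult_eq_0[OF assms(1) fg(1,2)] fg by auto
qed

text \<open>Every case distinction on points (which pivot is nonzero, what the rank is, which kernel
  coordinates are free) passes through this lemma; the pieces need not be closed.\<close>

lemma indep_Union:
  fixes A :: "'i \<Rightarrow> ('v \<Rightarrow> 'a::field) set"
  assumes "infinite (UNIV :: 'a set)" "finite E" "indep J S" "S \<subseteq> (\<Union>e\<in>E. A e)"
  shows "\<exists>e\<in>E. indep J (A e)"
proof -
  have "indep J (\<Union>e\<in>E. A e)" using indep_mono[OF assms(3) order_refl assms(4)] .
  with assms(2) show ?thesis
    by (induction E rule: finite_induct) (use indep_Un[OF assms(1)] not_indep_no_points in auto)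
qed

section \<open>Monomials and algebraic relations\<close>

definition monomial :: "'v set \<Rightarrow> ('v \<Rightarrow> nat) \<Rightarrow> ('v \<Rightarrow> 'a::field) \<Rightarrow> 'a" where
  "monomial W \<alpha> p = (\<Prod>v\<in>W. p v ^ \<alpha> v)"

definition wt :: "'v set \<Rightarrow> ('v \<Rightarrow> nat) \<Rightarrow> ('v \<Rightarrow> nat) \<Rightarrow> nat" where
  "wt W w \<alpha> = (\<Sum>v\<in>W. w v * \<alpha> v)"

definition supp_in :: "'v set \<Rightarrow> ('v \<Rightarrow> nat) set" where
  "supp_in W = {\<alpha>. \<forall>v. v \<notin> W \<longrightarrow> \<alpha> v = 0}"

definition box :: "'v set \<Rightarrow> ('v \<Rightarrow> nat) \<Rightarrow> ('v \<Rightarrow> nat) set" where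
  "box W b = {\<alpha> \<in> supp_in W. \<forall>v\<in>W. \<alpha> v < b v}"

lemma box_eq_image: "box W b = (\<lambda>\<beta> v. if v \<in> W then \<beta> v else 0) ` (PiE W (\<lambda>v. {..<b v}))"
proof -
  have "\<alpha> \<in> (\<lambda>\<beta> v. if v \<in> W then \<beta> v else 0) ` (PiE W (\<lambda>v. {..<b v}))" if "\<alpha> \<in> box W b" for \<alpha>
    by (rule image_eqI[of _ _ "restrict \<alpha> W"]) (use that in \<open>auto simp: box_def supp_in_def\<close>)
  thus ?thesis by (auto simp: box_def supp_in_def PiE_iff)
qed

lemma finite_box: "finite W \<Longrightarrow> finite (box W b)"
  unfolding box_eq_image by (intro finite_imageI finite_PiE) auto

lemma card_box: "finite W \<Longrightarrow> card (box W b) = (\<Prod>v\<in>W. b v)"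
  unfolding box_eq_image
  by (subst card_image)
     (auto simp: card_PiE inj_on_def PiE_iff extensional_def fun_eq_iff split: if_splits)

lemma monomial_polyfun: "W \<subseteq> W' \<Longrightarrow> monomial W \<alpha> \<in> polyfun W'"
  unfolding monomial_def[abs_def] by (intro polyfun_prod polyfun_power polyfun.coord) auto

lemma monomial_add: "monomial W (\<lambda>v. \<alpha> v + \<beta> v) p = monomial W \<alpha> p * monomial W \<beta> p"
  by (simp add: monomial_def power_add prod.distrib)

lemma monomial_supp_cong:
  assumes "finite V" "W \<subseteq> V" "\<alpha> \<in> supp_in W" shows "monomial V \<alpha> p = monomial W \<alpha> p"
  unfolding monomial_def by (rule prod.mono_neutral_right) (use assms in \<open>auto simp: supp_in_def\<close>)

lemma wt_add: "wt W w (\<lambda>v. \<alpha> v + \<beta> v) = wt W w \<alpha> + wt W w \<beta>"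
  by (simp add: wt_def algebra_simps sum.distrib)

text \<open>Base-\<open>M\<close> expansion: the weights are powers of \<open>M\<close>.\<close>

lemma weights_exist:
  assumes "finite W" "M > 0"
  shows "\<exists>w. (\<forall>v\<in>W. w v > 0) \<and> inj_on (wt W w) (box W (\<lambda>_. M))"
  using assms(1)
proof (induction rule: finite_induct)
  case empty
  have b: "box {} (\<lambda>_. M) = {\<lambda>_. 0}" by (auto simp: box_def supp_in_def)
  have "inj_on (wt {} (\<lambda>_. 1)) (box {} (\<lambda>_. M))" unfolding b by (rule inj_onI) blast
  thus ?case by blast
next
  case (insert x W)
  then obtain w where w: "\<forall>v\<in>W. w v > 0" "inj_on (wt W w) (box W (\<lambda>_. M))" by auto
  \<comment> \<open>\<open>x\<close> becomes the lowest digit in base \<open>M\<close>; the earlier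
    digits move up by one place.\<close>
  define w' where "w' v = (if v = x then 1 else M * w v)" for v
  have wt': "wt (insert x W) w' \<alpha> = \<alpha> x + M * wt W w \<alpha>" for \<alpha>
  proof -
    have "wt W w' \<alpha> = M * wt W w \<alpha>"
      unfolding wt_def sum_distrib_left
      by (rule sum.cong) (use insert.hyps in \<open>auto simp: w'_def\<close>)
    thus ?thesis using insert.hyps by (simp add: wt_def w'_def)
  qed
  have "inj_on (wt (insert x W) w') (box (insert x W) (\<lambda>_. M))"
  proof (rule inj_onI)
    fix \<alpha> \<beta> assume a: "\<alpha> \<in> box (insert x W) (\<lambda>_. M)" and b: "\<beta> \<in> box (insert x W) (\<lambda>_. M)"
      and eq: "wt (insert x W) w' \<alpha> = wt (insert x W) w' \<beta>"
    have eq': "\<alpha> x + M * wt W w \<alpha> = \<beta> x + M * wt W w \<beta>" using eq by (simp add: wt')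
    have lt: "\<alpha> x < M" "\<beta> x < M" using a b by (auto simp: box_def)
    have x: "\<alpha> x = \<beta> x" using arg_cong[OF eq', of "\<lambda>n. n mod M"] lt by simp
    hence W: "wt W w \<alpha> = wt W w \<beta>" using eq' assms(2) by simp
    let ?r = "\<lambda>\<alpha> v. if v = x then 0 else \<alpha> v"
    have r: "wt W w (?r \<alpha>) = wt W w \<alpha>" for \<alpha>
      unfolding wt_def by (rule sum.cong) (use insert.hyps in auto)
    have "?r \<alpha> \<in> box W (\<lambda>_. M)" "?r \<beta> \<in> box W (\<lambda>_. M)"
      using a b insert.hyps by (auto simp: box_def supp_in_def)
    hence "?r \<alpha> = ?r \<beta>" using inj_onD[OF w(2)] W by (simp add: r)
    hence eq: "?r \<alpha> v = ?r \<beta> v" for v by (rule fun_cong)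
    show "\<alpha> = \<beta>"
    proof
      fix v show "\<alpha> v = \<beta> v" using eq[of v] x by (cases "v = x") simp_all
    qed
  qed
  moreover have "\<forall>v\<in>insert x W. w' v > 0" using w(1) assms(2) by (auto simp: w'_def)
  ultimately show ?case by blast
qed

lemma monomial_power_subst: "monomial W \<alpha> (\<lambda>v. y ^ w v) = y ^ wt W w \<alpha>"
  by (cases "finite W") (simp_all add: monomial_def wt_def power_sum power_mult)

lemma finite_subset_box:
  assumes "finite W" "finite A" "A \<subseteq> supp_in W"
  shows "\<exists>M>0. A \<subseteq> box W (\<lambda>_. M)"
proof -
  define M where "M = Suc (\<Sum>\<alpha>\<in>A. \<Sum>v\<in>W. \<alpha> v)"
  have "\<alpha> v < M" if "\<alpha> \<in> A" "v \<in> W" for \<alpha> v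
  proof -
    have "\<alpha> v \<le> (\<Sum>v\<in>W. \<alpha> v)" using that assms by (intro member_le_sum) auto
    also have "\<dots> \<le> (\<Sum>\<alpha>\<in>A. \<Sum>v\<in>W. \<alpha> v)"
      using that assms by (intro member_le_sum[of \<alpha> A "\<lambda>\<alpha>. \<Sum>v\<in>W. \<alpha> v"]) auto
    finally show ?thesis by (simp add: M_def)
  qed
  thus ?thesis using assms(3) by (intro exI[of _ M]) (auto simp: box_def M_def)
qed

text \<open>Kronecker substitution reduces this to univariate polynomials.\<close>

lemma monomial_independent:
  fixes c :: "('v \<Rightarrow> nat) \<Rightarrow> 'a::field"
  assumes "infinite (UNIV :: 'a set)" "finite W" "finite A" "A \<subseteq> supp_in W"
    and "\<And>p. (\<Sum>\<alpha>\<in>A. c \<alpha> * monomial W \<alpha> p) = 0" and "\<beta> \<in> A"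
  shows "c \<beta> = 0"
proof -
  obtain M where M: "M > 0" "A \<subseteq> box W (\<lambda>_. M)" using finite_subset_box[OF assms(2-4)] by auto
  obtain w where w: "inj_on (wt W w) (box W (\<lambda>_. M))" using weights_exist[OF assms(2) M(1)] by auto
  define P where "P = (\<Sum>\<alpha>\<in>A. Polynomial.monom (c \<alpha>) (wt W w \<alpha>))"
  have "poly P y = 0" for y
    using assms(5)[of "\<lambda>v. y ^ w v"] by (simp add: P_def poly_sum poly_monom monomial_power_subst)
  hence "P = 0" using assms(1) poly_roots_finite[of P] by auto
  hence "0 = Polynomial.coeff P (wt W w \<beta>)" by simp
  also have "\<dots> = (\<Sum>\<alpha>\<in>A. if \<alpha> = \<beta> then c \<alpha> else 0)"
    unfolding P_def coeff_sum
    by (rule sum.cong) (use inj_onD[OF w] M(2) assms(6) in auto)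
  also have "\<dots> = c \<beta>" using assms(3,6) by simp
  finally show ?thesis by simp
qed

section \<open>Linear algebra in spaces of functions\<close>

interpretation fs: vector_space "\<lambda>(c :: 'a::field) (f :: 'p \<Rightarrow> 'a) p. c * f p"
  by standard (auto simp: fun_eq_iff algebra_simps)

lemma fs_sum_apply: "(\<Sum>i\<in>A. F i) p = (\<Sum>i\<in>A. F i p)" for F :: "'i \<Rightarrow> 'p \<Rightarrow> 'a::field"
  by (induction A rule: infinite_finite_induct) auto

text \<open>Stated for indexed families so that two indices carrying the same function count twice;
  in that case the coefficients 1 and -1 give the relation.\<close>

lemma family_dependent:
  fixes g :: "'i \<Rightarrow> 'p \<Rightarrow> 'a::field"
  assumes "finite I" "finite B" "card B < card I" "\<And>i. i \<in> I \<Longrightarrow> g i \<in> fs.span B"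
  shows "\<exists>c. (\<exists>i\<in>I. c i \<noteq> 0) \<and> (\<forall>p. (\<Sum>i\<in>I. c i * g i p) = 0)"
proof (cases "inj_on g I")
  case True
  have "fs.dependent (g ` I)"
  proof (rule ccontr)
    assume "fs.independent (g ` I)"
    from fs.independent_span_bound[OF assms(2) this] assms(4)
    have "card (g ` I) \<le> card B" by auto
    thus False using assms(3) True by (simp add: card_image)
  qed
  then obtain u where u: "\<exists>v\<in>g ` I. u v \<noteq> 0" "(\<Sum>v\<in>g ` I. (\<lambda>p. u v * v p)) = 0"
    using fs.dependent_finite[OF finite_imageI[OF assms(1)], of g] by blast
  from u(2) have "(\<Sum>i\<in>I. (\<lambda>p. u (g i) * g i p)) = 0"
    unfolding sum.reindex[OF True] o_def .
  hence "(\<Sum>i\<in>I. u (g i) * g i p) = 0" for p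
    using fs_sum_apply[of "\<lambda>i p. u (g i) * g i p" I p] by simp
  with u(1) show ?thesis by (intro exI[of _ "\<lambda>i. u (g i)"]) blast
next
  case False
  then obtain i j where ij: "i \<in> I" "j \<in> I" "i \<noteq> j" "g i = g j" by (auto simp: inj_on_def)
  let ?c = "\<lambda>k. if k = i then 1 else if k = j then - 1 else (0 :: 'a)"
  have "(\<Sum>k\<in>I. ?c k * g k p) = 0" for p
  proof -
    have "(\<Sum>k\<in>I. ?c k * g k p) = (\<Sum>k\<in>{i, j}. ?c k * g k p)"
      by (rule sum.mono_neutral_right) (use ij assms(1) in auto)
    thus ?thesis using ij by simp
  qed
  thus ?thesis using ij(1) by (intro exI[of _ ?c]) auto
qed

lemma fs_span_mult:
  assumes "f \<in> fs.span A" "g \<in> fs.span B"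
    and "\<And>a b. a \<in> A \<Longrightarrow> b \<in> B \<Longrightarrow> (\<lambda>p. a p * b p) \<in> fs.span C"
  shows "(\<lambda>p. f p * g p) \<in> fs.span C"
proof -
  have 1: "(\<lambda>p. a p * g p) \<in> fs.span C" if a: "a \<in> A" for a
    using assms(2)
  proof (induction rule: fs.span_induct_alt)
    case base
    show ?case using fs.span_zero[of C] by (simp add: zero_fun_def)
  next
    case (step c b y)
    have "(\<lambda>p. c * (a p * b p)) + (\<lambda>p. a p * y p) \<in> fs.span C"
      using step assms(3)[OF a step(1)] by (intro fs.span_add fs.span_scale) auto
    thus ?case by (simp add: plus_fun_def algebra_simps)
  qed
  show ?thesis using assms(1)
  proof (induction rule: fs.span_induct_alt)
    case base
    show ?case using fs.span_zero[of C] by (simp add: zero_fun_def)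
  next
    case (step c b y)
    have "(\<lambda>p. c * (b p * g p)) + (\<lambda>p. y p * g p) \<in> fs.span C"
      using step 1[OF step(1)] by (intro fs.span_add fs.span_scale) auto
    thus ?case by (simp add: plus_fun_def algebra_simps)
  qed
qed

lemma polyfun_span_monomial:
  fixes f :: "('a \<Rightarrow> 'b::field) \<Rightarrow> 'b"
  assumes "finite W" "f \<in> polyfun W"
  shows "f \<in> fs.span (monomial W ` supp_in W)"
  using assms(2)
proof (induction rule: polyfun.induct)
  case (const c)
  have "(\<lambda>p. c * monomial W (\<lambda>_. 0) p) \<in> fs.span (monomial W ` supp_in W)"
    by (intro fs.span_scale fs.span_base) (auto simp: supp_in_def)
  moreover have "(\<lambda>p. c * monomial W (\<lambda>_. 0) p) = (\<lambda>p. c)" by (simp add: monomial_def)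
  ultimately show ?case by simp
next
  case (coord v)
  have "monomial W (\<lambda>u. if u = v then 1 else 0) p = p v" for p :: "'a \<Rightarrow> 'b"
    unfolding monomial_def using coord assms(1)
    by (subst prod.remove[of _ v]) auto
  hence "(\<lambda>p. p v) = (monomial W (\<lambda>u. if u = v then 1 else 0) :: _ \<Rightarrow> 'b)"
    by (simp add: fun_eq_iff)
  thus ?case using coord by (auto simp: supp_in_def intro!: fs.span_base)
next
  case (add f g)
  thus ?case using fs.span_add by (fastforce simp: plus_fun_def)
next
  case (mult f g)
  show ?case
  proof (rule fs_span_mult[OF mult.IH])
    fix a b :: "('a \<Rightarrow> 'b) \<Rightarrow> 'b" assume "a \<in> monomial W ` supp_in W" "b \<in> monomial W ` supp_in W"
    then obtain \<alpha> \<beta> where "\<alpha> \<in> supp_in W" "\<beta> \<in> supp_in W" "a = monomial W \<alpha>" "b = monomial W \<beta>" by auto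
    hence "(\<lambda>p. a p * b p) = monomial W (\<lambda>v. \<alpha> v + \<beta> v)" "(\<lambda>v. \<alpha> v + \<beta> v) \<in> supp_in W"
      by (auto simp: monomial_add supp_in_def)
    thus "(\<lambda>p. a p * b p) \<in> fs.span (monomial W ` supp_in W)" by (auto intro: fs.span_base)
  qed
qed

lemma fs_span_image:
  fixes g :: "'i \<Rightarrow> 'p \<Rightarrow> 'a::field"
  assumes "f \<in> fs.span (g ` T)"
  shows "\<exists>A c. finite A \<and> A \<subseteq> T \<and> f = (\<lambda>p. \<Sum>i\<in>A. c i * g i p)"
proof -
  obtain t r where t: "finite t" "t \<subseteq> g ` T" "f = (\<Sum>a\<in>t. (\<lambda>p. r a * a p))"
    using assms unfolding fs.span_explicit by auto
  obtain A where A: "A \<subseteq> T" "inj_on g A" "t = g ` A"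
    using t(2) by (auto simp: subset_image_inj)
  have "f = (\<lambda>p. \<Sum>i\<in>A. r (g i) * g i p)"
    using t(3) unfolding A(3) by (subst (asm) sum.reindex[OF A(2)]) (auto simp: fs_sum_apply)
  thus ?thesis using A t(1) finite_image_iff[OF A(2)] by (intro exI[of _ A] exI[of _ "\<lambda>i. r (g i)"]) auto
qed

lemma polyfun_expansion:
  assumes "finite W" "f \<in> polyfun W"
  shows "\<exists>A c. finite A \<and> A \<subseteq> supp_in W \<and> f = (\<lambda>p. \<Sum>\<alpha>\<in>A. c \<alpha> * monomial W \<alpha> p)"
  using fs_span_image[OF polyfun_span_monomial[OF assms]] .

section \<open>Standard monomials and the growth of functions on a set\<close>

text \<open>Extending by zero off \<open>S\<close> turns equality on \<open>S\<close> into equality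
  of functions, so spans modulo the vanishing ideal of \<open>S\<close> can be formed in the
  ordinary function space.\<close>

definition res :: "'p set \<Rightarrow> ('p \<Rightarrow> 'a::zero) \<Rightarrow> 'p \<Rightarrow> 'a" where
  "res S f p = (if p \<in> S then f p else 0)"

text \<open>A relation among the coordinates \<open>I\<close> is read as a rewriting rule on
  \<open>S\<close>: its heaviest monomial is a combination of lighter ones. Injective weights make
  the heaviest monomial unique. \<open>M0\<close> is chosen before \<open>M\<close> and
  \<open>w\<close>, so that later one \<open>M\<close> and one weight can serve all \<open>I\<close>
  at once.\<close>

lemma leading_monomial:
  fixes f :: "('v \<Rightarrow> 'a::field) \<Rightarrow> 'a"
  assumes V: "finite V" and I: "I \<subseteq> V" and f: "f \<in> polyfun I" "\<And>p. p \<in> S \<Longrightarrow> f p = 0" "f p0 \<noteq> 0"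
  shows "\<exists>M0>0. \<forall>M\<ge>M0. \<forall>w. inj_on (wt V w) (box V (\<lambda>_. M)) \<longrightarrow>
    (\<exists>\<alpha>\<in>box I (\<lambda>_. M). res S (monomial V \<alpha>) \<in>
        fs.span ((\<lambda>\<beta>. res S (monomial V \<beta>)) ` {\<beta> \<in> supp_in V. wt V w \<beta> < wt V w \<alpha>}))"
proof -
  have finI: "finite I" using V I finite_subset by auto
  obtain A c where A: "finite A" "A \<subseteq> supp_in I" "f = (\<lambda>p. \<Sum>\<alpha>\<in>A. c \<alpha> * monomial I \<alpha> p)"
    using polyfun_expansion[OF finI f(1)] by auto
  obtain M0 where M0: "M0 > 0" "A \<subseteq> box I (\<lambda>_. M0)" using finite_subset_box[OF finI A(1,2)] by auto
  define B where "B = {\<alpha>\<in>A. c \<alpha> \<noteq> 0}"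
  have f_eq: "f p = (\<Sum>\<alpha>\<in>B. c \<alpha> * monomial V \<alpha> p)" for p
  proof -
    have "f p = (\<Sum>\<alpha>\<in>B. c \<alpha> * monomial I \<alpha> p)" unfolding A(3) B_def
      by (rule sum.mono_neutral_right) (use A in auto)
    also have "\<dots> = (\<Sum>\<alpha>\<in>B. c \<alpha> * monomial V \<alpha> p)"
      by (rule sum.cong) (use A(2) in \<open>auto simp: B_def subset_iff monomial_supp_cong[OF V I]\<close>)
    finally show ?thesis .
  qed
  have B: "finite B" using A(1) by (simp add: B_def)
  have ne: "B \<noteq> {}" using f(3) f_eq[of p0] by auto
  have supp: "B \<subseteq> supp_in V" using A(2) I by (auto simp: supp_in_def B_def)
  show ?thesis
  proof (intro exI[of _ M0] conjI M0(1) allI impI)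
    fix M w assume M: "M0 \<le> M" and w: "inj_on (wt V w) (box V (\<lambda>_. M))"
    have BI: "B \<subseteq> box I (\<lambda>_. M)" using M0 M by (force simp: box_def B_def)
    have BV: "B \<subseteq> box V (\<lambda>_. M)"
    proof
      fix \<alpha> assume \<alpha>: "\<alpha> \<in> B"
      have "\<alpha> v < M" if "v \<in> V" for v
        using \<alpha> BI M M0(1) by (cases "v \<in> I") (auto simp: box_def supp_in_def)
      thus "\<alpha> \<in> box V (\<lambda>_. M)" using \<alpha> supp by (auto simp: box_def)
    qed
    obtain \<alpha> where \<alpha>: "\<alpha> \<in> B" "\<And>\<beta>. \<beta> \<in> B \<Longrightarrow> wt V w \<beta> \<le> wt V w \<alpha>"
    proof -
      from B ne have "Max (wt V w ` B) \<in> wt V w ` B" by simp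
      then obtain \<alpha> where "\<alpha> \<in> B" "wt V w \<alpha> = Max (wt V w ` B)" by auto
      thus ?thesis using that[of \<alpha>] B by simp
    qed
    have less: "wt V w \<beta> < wt V w \<alpha>" if "\<beta> \<in> B - {\<alpha>}" for \<beta>
    proof -
      have "wt V w \<beta> \<noteq> wt V w \<alpha>" using inj_onD[OF w, of \<beta> \<alpha>] BV that \<alpha>(1) by auto
      thus ?thesis using \<alpha>(2)[of \<beta>] that by auto
    qed
    let ?G = "(\<lambda>\<beta>. res S (monomial V \<beta> :: _ \<Rightarrow> 'a)) ` {\<beta> \<in> supp_in V. wt V w \<beta> < wt V w \<alpha>}"
    have "(\<Sum>\<beta>\<in>B-{\<alpha>}. (\<lambda>p. (- c \<beta> / c \<alpha>) * res S (monomial V \<beta>) p)) \<in> fs.span ?G"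
      by (intro fs.span_sum fs.span_scale fs.span_base) (use less supp in auto)
    also have "(\<Sum>\<beta>\<in>B-{\<alpha>}. (\<lambda>p. (- c \<beta> / c \<alpha>) * res S (monomial V \<beta>) p)) = res S (monomial V \<alpha>)"
    proof
      fix p
      have c0: "c \<alpha> \<noteq> 0" using \<alpha> by (auto simp: B_def)
      show "(\<Sum>\<beta>\<in>B-{\<alpha>}. (\<lambda>p. (- c \<beta> / c \<alpha>) * res S (monomial V \<beta>) p)) p = res S (monomial V \<alpha>) p"
      proof (cases "p \<in> S")
        case True
        have "0 = c \<alpha> * monomial V \<alpha> p + (\<Sum>\<beta>\<in>B-{\<alpha>}. c \<beta> * monomial V \<beta> p)"
          using f(2)[OF True] f_eq[of p] sum.remove[OF B \<alpha>(1), of "\<lambda>\<beta>. c \<beta> * monomial V \<beta> p"] by simp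
        hence "monomial V \<alpha> p = - (\<Sum>\<beta>\<in>B-{\<alpha>}. c \<beta> * monomial V \<beta> p) / c \<alpha>"
          using c0 by (simp add: field_simps eq_neg_iff_add_eq_0)
        also have "\<dots> = (\<Sum>\<beta>\<in>B-{\<alpha>}. (- c \<beta> / c \<alpha>) * monomial V \<beta> p)"
          by (simp add: sum_divide_distrib sum_negf)
        finally show ?thesis using True by (simp add: fs_sum_apply res_def)
      qed (simp add: fs_sum_apply res_def)
    qed
    finally show "\<exists>\<alpha>\<in>box I (\<lambda>_. M). res S (monomial V \<alpha>) \<in>
        fs.span ((\<lambda>\<beta>. res S (monomial V \<beta>)) ` {\<beta> \<in> supp_in V. wt V w \<beta> < wt V w \<alpha>})"
      using \<alpha>(1) BI by auto
  qed
qed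

text \<open>A superset of the irreducible monomials that is easy to count: an exponent with
  \<open>k + 1\<close> entries at least \<open>M\<close> is divisible by the leading monomial
  belonging to those coordinates, whose exponents are all below \<open>M\<close>.\<close>

definition std :: "'v set \<Rightarrow> nat \<Rightarrow> nat \<Rightarrow> ('v \<Rightarrow> nat) set" where
  "std V M k = {\<beta> \<in> supp_in V. card {v\<in>V. M \<le> \<beta> v} \<le> k}"

text \<open>At most \<open>k\<close> entries reach \<open>M\<close>, and positive weights keep them
  at most \<open>t\<close>. The choice of the large positions costs \<open>2 ^ card V\<close>, the
  small entries \<open>M ^ card V\<close>, the large ones \<open>Suc t ^ k\<close>.\<close>

lemma card_std_le:
  assumes "finite V" "M > 0" "\<forall>v\<in>V. w v > 0"
  shows "finite {\<beta> \<in> std V M k. wt V w \<beta> \<le> t} \<and>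
    card {\<beta> \<in> std V M k. wt V w \<beta> \<le> t} \<le> 2 ^ card V * M ^ card V * Suc t ^ k"
proof -
  let ?b = "\<lambda>I v. if v \<in> I then Suc t else M"
  let ?U = "\<Union>I\<in>{I. I \<subseteq> V \<and> card I \<le> k}. box V (?b I)"
  have sub: "{\<beta> \<in> std V M k. wt V w \<beta> \<le> t} \<subseteq> ?U"
  proof
    fix \<beta> assume b: "\<beta> \<in> {\<beta> \<in> std V M k. wt V w \<beta> \<le> t}"
    have "\<beta> v \<le> t" if "v \<in> V" for v
    proof -
      have "\<beta> v \<le> w v * \<beta> v" using assms(3) that by (simp add: Suc_leI)
      also have "\<dots> \<le> wt V w \<beta>" unfolding wt_def using that assms(1) by (intro member_le_sum) auto
      finally show ?thesis using b by simp
    qed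
    hence "\<beta> \<in> box V (?b {v\<in>V. M \<le> \<beta> v})" using b by (auto simp: box_def std_def less_Suc_eq_le)
    thus "\<beta> \<in> ?U" using b by (intro UN_I[of "{v\<in>V. M \<le> \<beta> v}"]) (auto simp: std_def)
  qed
  have fin: "finite {I. I \<subseteq> V \<and> card I \<le> k}" using assms(1) by simp
  have box: "card (box V (?b I)) \<le> M ^ card V * Suc t ^ k" if "I \<subseteq> V" "card I \<le> k" for I
  proof -
    have "card (box V (?b I)) = (\<Prod>v\<in>V. ?b I v)" by (rule card_box[OF assms(1)])
    also have "\<dots> = Suc t ^ card I * M ^ card (V - I)"
      using that(1) assms(1) by (subst prod.If_cases) (auto simp: Int_absorb1 Diff_eq)
    also have "\<dots> \<le> Suc t ^ k * M ^ card V"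
      by (intro mult_mono power_increasing that card_mono) (use assms in auto)
    finally show ?thesis by (simp add: mult.commute)
  qed
  have "card ?U \<le> (\<Sum>I\<in>{I. I \<subseteq> V \<and> card I \<le> k}. card (box V (?b I)))"
    by (rule card_UN_le[OF fin])
  also have "\<dots> \<le> (\<Sum>I\<in>{I. I \<subseteq> V \<and> card I \<le> k}. M ^ card V * Suc t ^ k)"
    by (rule sum_mono) (use box in auto)
  also have "\<dots> = card {I. I \<subseteq> V \<and> card I \<le> k} * (M ^ card V * Suc t ^ k)" by simp
  also have "\<dots> \<le> card (Pow V) * (M ^ card V * Suc t ^ k)"
    by (intro mult_right_mono card_mono) (use assms(1) in auto)
  finally have "card ?U \<le> 2 ^ card V * M ^ card V * Suc t ^ k"
    by (simp add: card_Pow assms(1) mult.assoc)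
  moreover have finU: "finite ?U" using fin assms(1) finite_box by blast
  ultimately show ?thesis using finite_subset[OF sub finU] card_mono[OF finU sub] by linarith
qed

text \<open>A bound for the Hilbert function of \<open>S\<close> in weighted degree: rewriting
  strictly lowers the weight, so every monomial reduces on \<open>S\<close> to standard ones of no
  larger weight.\<close>

lemma growth_bound:
  fixes S :: "('v \<Rightarrow> 'a::field) set"
  assumes V: "finite V" and dep: "\<And>I. I \<subseteq> V \<Longrightarrow> card I = Suc k \<Longrightarrow> \<not> indep I S"
  shows "\<exists>w C. \<forall>t. \<exists>B. finite B \<and> card B \<le> C * Suc t ^ k \<and>
     (\<forall>\<gamma>\<in>supp_in V. wt V w \<gamma> \<le> t \<longrightarrow> res S (monomial V \<gamma>) \<in> fs.span B)"
proof -
  let ?Is = "{I. I \<subseteq> V \<and> card I = Suc k}"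
  define red where "red I M w \<alpha> \<longleftrightarrow> \<alpha> \<in> box I (\<lambda>_. M) \<and> res S (monomial V \<alpha> :: _ \<Rightarrow> 'a) \<in>
        fs.span ((\<lambda>\<beta>. res S (monomial V \<beta>)) ` {\<beta> \<in> supp_in V. wt V w \<beta> < wt V w \<alpha>})" for I M w \<alpha>
  have "\<exists>M0. \<forall>M\<ge>M0. \<forall>w. inj_on (wt V w) (box V (\<lambda>_. M)) \<longrightarrow> (\<exists>\<alpha>. red I M w \<alpha>)"
    if I: "I \<in> ?Is" for I
  proof -
    have "I \<subseteq> V" "card I = Suc k" using I by auto
    with dep have "\<not> indep I S" by blast
    then obtain f p0 where f: "f \<in> polyfun I" "\<And>p. p \<in> S \<Longrightarrow> f p = 0" "f p0 \<noteq> 0"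
      unfolding indep_def by blast
    have f2: "\<forall>p\<in>S. f p = 0" using f(2) by blast
    note L = leading_monomial[OF V \<open>I \<subseteq> V\<close> f(1) bspec[OF f2] f(3), unfolded Bex_def]
    show ?thesis unfolding red_def by (rule exE[OF L]) (assumption | erule conjE, rule exI, assumption)+
  qed
  hence "\<forall>I\<in>?Is. \<exists>M0. \<forall>M\<ge>M0. \<forall>w. inj_on (wt V w) (box V (\<lambda>_. M)) \<longrightarrow> (\<exists>\<alpha>. red I M w \<alpha>)"
    by blast
  from bchoice[OF this] obtain M0 where
    M0: "\<And>I M w. I \<in> ?Is \<Longrightarrow> M \<ge> M0 I \<Longrightarrow> inj_on (wt V w) (box V (\<lambda>_. M)) \<Longrightarrow> \<exists>\<alpha>. red I M w \<alpha>"
    by blast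
  \<comment> \<open>Above the threshold of each of the finitely many sets of \<open>k + 1\<close>
    coordinates, so that a single weight yields a rewriting rule for all of them.\<close>
  define M where "M = Suc (\<Sum>I\<in>?Is. M0 I)"
  have Mpos: "M > 0" by (simp add: M_def)
  have MI: "M0 I \<le> M" if "I \<in> ?Is" for I
  proof -
    have "M0 I \<le> (\<Sum>I\<in>?Is. M0 I)" by (rule member_le_sum) (use that V in auto)
    thus ?thesis by (simp add: M_def)
  qed
  obtain w where w: "\<forall>v\<in>V. w v > 0" "inj_on (wt V w) (box V (\<lambda>_. M))"
    using weights_exist[OF V, of M] Mpos by blast
  define G where "G t = (\<lambda>\<beta>. res S (monomial V \<beta> :: _ \<Rightarrow> 'a)) ` {\<beta> \<in> std V M k. wt V w \<beta> \<le> t}" for t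
  have G_mono: "fs.span (G s) \<subseteq> fs.span (G t)" if "s \<le> t" for s t
    by (rule fs.span_mono) (use that in \<open>auto simp: G_def\<close>)
  have key: "res S (monomial V \<gamma>) \<in> fs.span (G (wt V w \<gamma>))" if "\<gamma> \<in> supp_in V" for \<gamma>
    using that
  proof (induction "wt V w \<gamma>" arbitrary: \<gamma> rule: less_induct)
    case less
    show ?case
    proof (cases "\<gamma> \<in> std V M k")
      case True
      thus ?thesis by (auto simp: G_def intro!: fs.span_base)
    next
      case False
      \<comment> \<open>Choose \<open>k + 1\<close> of the large exponents; the leading monomial for
        this set of coordinates divides the given one, and \<open>\<delta>\<close> below is the
        quotient.\<close>
      hence "Suc k \<le> card {v\<in>V. M \<le> \<gamma> v}" using less.prems by (auto simp: std_def)
      then obtain I where I: "I \<subseteq> {v\<in>V. M \<le> \<gamma> v}" "card I = Suc k"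
        by (meson obtain_subset_with_card_n)
      hence "I \<in> ?Is" by auto
      from M0[OF this MI[OF this] w(2)] obtain \<alpha> where "red I M w \<alpha>" by blast
      note \<alpha> = this[unfolded red_def]
      define \<delta> where "\<delta> v = \<gamma> v - \<alpha> v" for v
      have le: "\<alpha> v \<le> \<gamma> v" for v
      proof (cases "v \<in> I")
        case True
        hence "\<alpha> v < M" "M \<le> \<gamma> v" using \<alpha> I by (auto simp: box_def)
        thus ?thesis by simp
      next
        case False
        hence "\<alpha> v = 0" using \<alpha> by (auto simp: box_def supp_in_def)
        thus ?thesis by simp
      qed
      have \<gamma>: "\<gamma> = (\<lambda>v. \<delta> v + \<alpha> v)" using le by (auto simp: \<delta>_def)
      have \<delta>: "\<delta> \<in> supp_in V" using less.prems by (auto simp: supp_in_def \<delta>_def)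
      have "(\<lambda>p. monomial V \<delta> p * res S (monomial V \<alpha>) p) \<in> fs.span (G (wt V w \<gamma>))"
      proof (rule fs_span_mult[OF _ \<alpha>[THEN conjunct2]])
        show "monomial V \<delta> \<in> fs.span {monomial V \<delta>}" by (rule fs.span_base) auto
        fix a b :: "('v \<Rightarrow> 'a) \<Rightarrow> 'a"
        assume "a \<in> {monomial V \<delta>}"
          "b \<in> (\<lambda>\<beta>. res S (monomial V \<beta>)) ` {\<beta> \<in> supp_in V. wt V w \<beta> < wt V w \<alpha>}"
        then obtain \<beta> where \<beta>: "\<beta> \<in> supp_in V" "wt V w \<beta> < wt V w \<alpha>"
          and ab: "a = monomial V \<delta>" "b = res S (monomial V \<beta>)" by auto
        have eq: "(\<lambda>p. a p * b p) = res S (monomial V (\<lambda>v. \<delta> v + \<beta> v))"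
          by (auto simp: ab res_def monomial_add fun_eq_iff)
        have wl: "wt V w (\<lambda>v. \<delta> v + \<beta> v) < wt V w \<gamma>" using \<beta>(2) by (subst \<gamma>) (simp add: wt_add)
        have "(\<lambda>v. \<delta> v + \<beta> v) \<in> supp_in V" using \<delta> \<beta>(1) by (auto simp: supp_in_def)
        from less.hyps[OF wl this] G_mono[OF less_imp_le[OF wl]]
        show "(\<lambda>p. a p * b p) \<in> fs.span (G (wt V w \<gamma>))" unfolding eq by auto
      qed
      also have "(\<lambda>p. monomial V \<delta> p * res S (monomial V \<alpha>) p) = res S (monomial V \<gamma>)"
        by (subst \<gamma>) (auto simp: res_def monomial_add fun_eq_iff)
      finally show ?thesis .
    qed
  qed
  show ?thesis
  proof (intro exI[of _ w] exI[of _ "2 ^ card V * M ^ card V"] allI)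
    fix t
    have std: "finite {\<beta> \<in> std V M k. wt V w \<beta> \<le> t}"
      "card {\<beta> \<in> std V M k. wt V w \<beta> \<le> t} \<le> 2 ^ card V * M ^ card V * Suc t ^ k"
      using card_std_le[OF V Mpos w(1)] by blast+
    show "\<exists>B. finite B \<and> card B \<le> 2 ^ card V * M ^ card V * Suc t ^ k \<and>
     (\<forall>\<gamma>\<in>supp_in V. wt V w \<gamma> \<le> t \<longrightarrow> res S (monomial V \<gamma>) \<in> fs.span B)"
    proof (intro exI[of _ "G t"] conjI ballI impI)
      show "finite (G t)" unfolding G_def using std(1) by (rule finite_imageI)
      show "card (G t) \<le> 2 ^ card V * M ^ card V * Suc t ^ k"
        unfolding G_def using card_image_le[OF std(1)] std(2) by (rule order_trans)
      fix \<gamma> assume "\<gamma> \<in> supp_in V" "wt V w \<gamma> \<le> t"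
      with key G_mono show "res S (monomial V \<gamma>) \<in> fs.span (G t)" by blast
    qed
  qed
qed

section \<open>Algebraic relations between polynomial functions, by counting\<close>

definition filt :: "'v set \<Rightarrow> ('v \<Rightarrow> nat) \<Rightarrow> nat \<Rightarrow> (('v \<Rightarrow> 'a::field) \<Rightarrow> 'a) set" where
  "filt V w t = fs.span (monomial V ` {\<gamma> \<in> supp_in V. wt V w \<gamma> \<le> t})"

lemma filt_mono: "s \<le> t \<Longrightarrow> f \<in> filt V w s \<Longrightarrow> f \<in> filt V w t"
  unfolding filt_def by (rule subsetD[OF fs.span_mono]) auto

lemma polyfun_filt:
  fixes f :: "('v \<Rightarrow> 'a::field) \<Rightarrow> 'a"
  assumes "finite V" "f \<in> polyfun V"
  shows "\<exists>t. f \<in> filt V w t"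
proof -
  obtain A c where A: "finite A" "A \<subseteq> supp_in V" "f = (\<lambda>p. \<Sum>\<alpha>\<in>A. c \<alpha> * monomial V \<alpha> p)"
    using polyfun_expansion[OF assms] by blast
  have le: "wt V w \<alpha> \<le> (\<Sum>\<alpha>\<in>A. wt V w \<alpha>)" if "\<alpha> \<in> A" for \<alpha>
    using that A(1) by (intro member_le_sum) auto
  have "(\<Sum>\<alpha>\<in>A. (\<lambda>p. c \<alpha> * monomial V \<alpha> p)) \<in> filt V w (\<Sum>\<alpha>\<in>A. wt V w \<alpha>)"
    unfolding filt_def
    by (intro fs.span_sum fs.span_scale fs.span_base imageI CollectI conjI le) (use A(2) in auto)
  also have "(\<Sum>\<alpha>\<in>A. (\<lambda>p. c \<alpha> * monomial V \<alpha> p)) = f"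
    by (simp add: A(3) fun_eq_iff fs_sum_apply)
  finally show ?thesis by blast
qed

lemma filt_mult:
  fixes f g :: "('v \<Rightarrow> 'a::field) \<Rightarrow> 'a"
  assumes "f \<in> filt V w s" "g \<in> filt V w t"
  shows "(\<lambda>p. f p * g p) \<in> filt V w (s + t)"
  unfolding filt_def
proof (rule fs_span_mult[OF assms[unfolded filt_def]])
  fix a b :: "('v \<Rightarrow> 'a) \<Rightarrow> 'a"
  assume "a \<in> monomial V ` {\<gamma> \<in> supp_in V. wt V w \<gamma> \<le> s}" "b \<in> monomial V ` {\<gamma> \<in> supp_in V. wt V w \<gamma> \<le> t}"
  then obtain \<alpha> \<beta> where ab: "\<alpha> \<in> supp_in V" "\<beta> \<in> supp_in V" "wt V w \<alpha> \<le> s" "wt V w \<beta> \<le> t"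
     and eq: "a = monomial V \<alpha>" "b = monomial V \<beta>" by blast
  have "(\<lambda>p. a p * b p) = monomial V (\<lambda>v. \<alpha> v + \<beta> v)" by (simp add: eq monomial_add fun_eq_iff)
  moreover have "(\<lambda>v. \<alpha> v + \<beta> v) \<in> {\<gamma> \<in> supp_in V. wt V w \<gamma> \<le> s + t}"
    using ab by (simp add: supp_in_def wt_add)
  ultimately show "(\<lambda>p. a p * b p) \<in> fs.span (monomial V ` {\<gamma> \<in> supp_in V. wt V w \<gamma> \<le> s + t})"
    by (simp add: fs.span_base)
qed

lemma filt_one: "(\<lambda>p. 1) \<in> filt V w 0"
proof -
  have "(\<lambda>p. 1) = monomial V (\<lambda>_. 0)" by (simp add: monomial_def fun_eq_iff)
  moreover have "(\<lambda>_. 0) \<in> {\<gamma> \<in> supp_in V. wt V w \<gamma> \<le> 0}" by (simp add: supp_in_def wt_def)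
  ultimately show ?thesis unfolding filt_def by (rule fs.span_base[OF image_eqI])
qed

lemma filt_power: "f \<in> filt V w t \<Longrightarrow> (\<lambda>p. f p ^ e) \<in> filt V w (e * t)"
proof (induction e)
  case 0
  show ?case using filt_one by simp
next
  case (Suc e)
  thus ?case using filt_mult[OF Suc.prems Suc.IH[OF Suc.prems]] by simp
qed

lemma filt_prod:
  "(\<And>i. i \<in> A \<Longrightarrow> f i \<in> filt V w (t i)) \<Longrightarrow> (\<lambda>p. \<Prod>i\<in>A. f i p) \<in> filt V w (\<Sum>i\<in>A. t i)"
proof (induction A rule: infinite_finite_induct)
  case (insert x A)
  have "(\<lambda>p. f x p * (\<Prod>i\<in>A. f i p)) \<in> filt V w (t x + (\<Sum>i\<in>A. t i))"
    by (rule filt_mult) (use insert in auto)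
  thus ?case using insert.hyps by simp
qed (use filt_one in simp_all)

text \<open>The \<open>Suc N ^ Suc k\<close> products outnumber the dimension of the space on
  \<open>S\<close> that contains them. The factor \<open>a p ^ (N - \<alpha> j)\<close> homogenises
  the relation in the function \<open>u j\<close>: if \<open>u j = b\<close> and
  \<open>a p * p j = b p\<close>, it clears the denominator of \<open>p j = b p / a p\<close>; for
  \<open>a = 1\<close> the relation is an ordinary one.\<close>

lemma algebraic_relation:
  fixes S :: "('v \<Rightarrow> 'a::field) set" and u :: "'i \<Rightarrow> ('v \<Rightarrow> 'a) \<Rightarrow> 'a"
  assumes V: "finite V" and dep: "\<And>I. I \<subseteq> V \<Longrightarrow> card I = Suc k \<Longrightarrow> \<not> indep I S"
    and J: "finite J" "card J = Suc k" "j \<in> J"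
    and u: "\<And>v. v \<in> J \<Longrightarrow> u v \<in> polyfun V" and a: "a \<in> polyfun V"
  shows "\<exists>N c. (\<exists>\<alpha>\<in>box J (\<lambda>_. Suc N). c \<alpha> \<noteq> 0) \<and> (\<forall>p\<in>S.
    (\<Sum>\<alpha>\<in>box J (\<lambda>_. Suc N). c \<alpha> * ((\<Prod>v\<in>J. u v p ^ \<alpha> v) * a p ^ (N - \<alpha> j))) = 0)"
proof -
  obtain w C where wC: "\<And>t. \<exists>B. finite B \<and> card B \<le> C * Suc t ^ k \<and>
     (\<forall>\<gamma>\<in>supp_in V. wt V w \<gamma> \<le> t \<longrightarrow> res S (monomial V \<gamma> :: _ \<Rightarrow> 'a) \<in> fs.span B)"
    using growth_bound[of V k S] V dep by metis
  have "\<forall>v\<in>J. \<exists>t. u v \<in> filt V w t" using polyfun_filt[OF V u] by blast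
  from bchoice[OF this] obtain d where d: "\<forall>v\<in>J. u v \<in> filt V w (d v)" by blast
  obtain da where da: "a \<in> filt V w da" using polyfun_filt[OF V a] by blast
  define D where "D = da + (\<Sum>v\<in>J. d v)"
  have uD: "u v \<in> filt V w D" if "v \<in> J" for v
  proof -
    have "d v \<le> (\<Sum>v\<in>J. d v)" using that J(1) by (intro member_le_sum) auto
    hence "d v \<le> D" by (simp add: D_def)
    thus ?thesis by (rule filt_mono) (use d that in blast)
  qed
  have aD: "a \<in> filt V w D" by (rule filt_mono[OF _ da]) (simp add: D_def)
  \<comment> \<open>Weight per unit of \<open>N\<close>: the \<open>Suc k\<close> functions
    \<open>u v\<close>, each to a power at most \<open>N\<close>, and one power of
    \<open>a\<close>.\<close>
  define E where "E = (Suc k + 1) * D"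
  \<comment> \<open>Chosen so that \<open>C * (Suc E * Suc N) ^ k = N * Suc N ^ k\<close>, which is
    less than the number \<open>Suc N ^ Suc k\<close> of products.\<close>
  define N where "N = C * Suc E ^ k"
  let ?G = "\<lambda>\<alpha> p. (\<Prod>v\<in>J. u v p ^ \<alpha> v) * a p ^ (N - \<alpha> j)"
  have G: "?G \<alpha> \<in> filt V w (E * N)" if \<alpha>: "\<alpha> \<in> box J (\<lambda>_. Suc N)" for \<alpha>
  proof -
    have "(\<lambda>p. \<Prod>v\<in>J. u v p ^ \<alpha> v) \<in> filt V w (\<Sum>v\<in>J. \<alpha> v * D)"
      by (intro filt_prod filt_power uD)
    moreover have "(\<lambda>p. a p ^ (N - \<alpha> j)) \<in> filt V w ((N - \<alpha> j) * D)"
      by (intro filt_power aD)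
    ultimately have "?G \<alpha> \<in> filt V w ((\<Sum>v\<in>J. \<alpha> v * D) + (N - \<alpha> j) * D)"
      by (rule filt_mult)
    moreover have "(\<Sum>v\<in>J. \<alpha> v * D) \<le> (\<Sum>v\<in>J. N * D)"
      by (intro sum_mono mult_right_mono) (use \<alpha> in \<open>auto simp: box_def less_Suc_eq_le\<close>)
    moreover have "(N - \<alpha> j) * D \<le> N * D" by simp
    ultimately show ?thesis
      by (elim filt_mono[rotated]) (simp add: J(2) E_def algebra_simps)
  qed
  obtain B where B: "finite B" "card B \<le> C * Suc (E * N) ^ k"
    and span: "\<forall>\<gamma>\<in>supp_in V. wt V w \<gamma> \<le> E * N \<longrightarrow> res S (monomial V \<gamma> :: _ \<Rightarrow> 'a) \<in> fs.span B"
    using wC by blast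
  have res_span: "res S f \<in> fs.span B" if "f \<in> filt V w (E * N)" for f
    using that unfolding filt_def
  proof (induction rule: fs.span_induct_alt)
    case base
    have "res S (0 :: _ \<Rightarrow> 'a) = 0" by (simp add: res_def fun_eq_iff)
    thus ?case by (simp only: fs.span_zero)
  next
    case (step c x y)
    have "res S x \<in> fs.span B" using step(1) span by blast
    hence "(\<lambda>p. c * res S x p) + res S y \<in> fs.span B"
      using step(2) by (intro fs.span_add fs.span_scale)
    also have "(\<lambda>p. c * res S x p) + res S y = res S ((\<lambda>p. c * x p) + y)"
      by (simp add: res_def fun_eq_iff)
    finally show ?case .
  qed
  have less: "card B < card (box J (\<lambda>_. Suc N))"
  proof -
    have "Suc (E * N) \<le> Suc E * Suc N" by simp
    hence "Suc (E * N) ^ k \<le> (Suc E * Suc N) ^ k" by (rule power_mono) simp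
    hence "card B \<le> C * (Suc E * Suc N) ^ k" using B(2) by (meson le_trans mult_le_mono2)
    also have "\<dots> = N * Suc N ^ k" by (simp only: N_def power_mult_distrib mult.assoc)
    also have "\<dots> < Suc N * Suc N ^ k" by simp
    also have "\<dots> = card (box J (\<lambda>_. Suc N))" by (simp add: card_box[OF J(1)] J(2))
    finally show ?thesis .
  qed
  have "\<exists>c. (\<exists>\<alpha>\<in>box J (\<lambda>_. Suc N). c \<alpha> \<noteq> 0) \<and>
    (\<forall>p. (\<Sum>\<alpha>\<in>box J (\<lambda>_. Suc N). c \<alpha> * res S (?G \<alpha>) p) = 0)"
    by (rule family_dependent[OF finite_box[OF J(1)] B(1) less]) (rule res_span[OF G])
  then obtain c where c: "\<exists>\<alpha>\<in>box J (\<lambda>_. Suc N). c \<alpha> \<noteq> 0"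
    "\<forall>p. (\<Sum>\<alpha>\<in>box J (\<lambda>_. Suc N). c \<alpha> * res S (?G \<alpha>) p) = 0"
    by (elim exE conjE)
  have "(\<Sum>\<alpha>\<in>box J (\<lambda>_. Suc N). c \<alpha> * ?G \<alpha> p) = 0" if "p \<in> S" for p
    using c(2)[rule_format, of p] that by (simp add: res_def)
  with c(1) show ?thesis by blast
qed

section \<open>Sizes of independent sets under strict inclusion and elimination\<close>

lemma sum_box_insert:
  assumes "x \<notin> J"
  shows "(\<Sum>\<alpha>\<in>box (insert x J) b. g \<alpha>) = (\<Sum>i<b x. \<Sum>\<beta>\<in>box J b. g (\<beta>(x := i)))"
  unfolding sum.cartesian_product
  by (rule sum.reindex_bij_witness[of _ "\<lambda>(i, \<beta>). \<beta>(x := i)" "\<lambda>\<alpha>. (\<alpha> x, \<alpha>(x := 0))"])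
     (use assms in \<open>auto simp: box_def supp_in_def fun_eq_iff\<close>)

text \<open>An algebraic relation of \<open>f\<close> over the coordinates in \<open>J\<close>, valid on \<open>Y'\<close> and divided by a
  power of \<open>f\<close>, has a nonzero constant term, which would vanish on \<open>Y\<close>.\<close>

lemma indep_card_step:
  fixes Y Y' :: "('v \<Rightarrow> 'a::field) set"
  assumes inf: "infinite (UNIV :: 'a set)" and V: "finite V" and J: "J \<subseteq> V" "indep J Y"
    and f: "f \<in> polyfun V" "\<And>p. p \<in> Y \<Longrightarrow> f p = 0" "p0 \<in> Y'" "f p0 \<noteq> 0" and sub: "Y \<subseteq> Y'"
    and prime: "\<And>g h. g \<in> polyfun V \<Longrightarrow> h \<in> polyfun V \<Longrightarrow> (\<And>p. p \<in> Y' \<Longrightarrow> g p * h p = 0) \<Longrightarrow>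
       (\<forall>p\<in>Y'. g p = 0) \<or> (\<forall>p\<in>Y'. h p = 0)"
  shows "\<exists>I\<subseteq>V. card I = Suc (card J) \<and> indep I Y'"
proof (rule ccontr)
  assume no: "\<not> ?thesis"
  have finJ: "finite J" using J(1) V finite_subset by blast
  have "J \<noteq> V" using indepD[OF J(2), of f p0] f by auto
  then obtain x where x: "x \<in> V" "x \<notin> J" using J(1) by blast
  \<comment> \<open>\<open>x\<close> serves only as a free label under which \<open>f\<close> joins
    the coordinates in \<open>J\<close>; the coordinate \<open>x\<close> itself does not enter the
    relation as a factor.\<close>
  define u where "u v p = (if v = x then f p else p v)" for v and p :: "'v \<Rightarrow> 'a"
  have u: "u v \<in> polyfun V" if "v \<in> insert x J" for v
    using that f(1) x J(1) by (cases "v = x") (auto simp: u_def[abs_def] intro: polyfun.coord)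
  have "\<exists>N c. (\<exists>\<alpha>\<in>box (insert x J) (\<lambda>_. Suc N). c \<alpha> \<noteq> 0) \<and> (\<forall>p\<in>Y'.
    (\<Sum>\<alpha>\<in>box (insert x J) (\<lambda>_. Suc N). c \<alpha> * ((\<Prod>v\<in>insert x J. u v p ^ \<alpha> v) * 1 ^ (N - \<alpha> x))) = 0)"
    by (rule algebraic_relation[OF V, where k="card J"])
       (use no finJ x u in \<open>auto intro: polyfun.const\<close>)
  then obtain N c where c: "\<exists>\<alpha>\<in>box (insert x J) (\<lambda>_. Suc N). c \<alpha> \<noteq> 0"
    and rel: "\<And>p. p \<in> Y' \<Longrightarrow> (\<Sum>\<alpha>\<in>box (insert x J) (\<lambda>_. Suc N). c \<alpha> * (\<Prod>v\<in>insert x J. u v p ^ \<alpha> v)) = 0"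
    by auto
  define q where "q i p = (\<Sum>\<beta>\<in>box J (\<lambda>_. Suc N). c (\<beta>(x := i)) * monomial J \<beta> p)" for i p
  have q_poly: "q i \<in> polyfun J" for i
    unfolding q_def[abs_def] by (intro polyfun_sum polyfun.mult polyfun.const monomial_polyfun) auto
  have rel': "(\<Sum>i<Suc N. q i p * f p ^ i) = 0" if "p \<in> Y'" for p
  proof -
    have "(\<Prod>v\<in>insert x J. u v p ^ (\<beta>(x := i)) v) = f p ^ i * monomial J \<beta> p" for i \<beta>
    proof -
      have "(\<Prod>v\<in>J. u v p ^ (\<beta>(x := i)) v) = monomial J \<beta> p"
        unfolding monomial_def by (rule prod.cong) (use x in \<open>auto simp: u_def\<close>)
      thus ?thesis using x(2) finJ by (simp add: u_def)
    qed
    hence "c (\<beta>(x := i)) * (\<Prod>v\<in>insert x J. u v p ^ (\<beta>(x := i)) v) =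
       c (\<beta>(x := i)) * monomial J \<beta> p * f p ^ i" for i \<beta> by simp
    thus ?thesis using rel[OF that] unfolding sum_box_insert[OF x(2)] q_def
      by (simp only: sum_distrib_right)
  qed
  have cz: "c \<alpha> = 0" if \<alpha>: "\<alpha> \<in> box (insert x J) (\<lambda>_. Suc N)" and z: "\<And>p. q (\<alpha> x) p = 0" for \<alpha>
  proof -
    have sub: "box J (\<lambda>_. Suc N) \<subseteq> supp_in J" by (auto simp: box_def)
    have mem: "\<alpha>(x := 0) \<in> box J (\<lambda>_. Suc N)" using \<alpha> x(2) by (auto simp: box_def supp_in_def)
    have "c ((\<alpha>(x := 0))(x := \<alpha> x)) = 0"
      using monomial_independent[OF inf finJ finite_box[OF finJ] sub _ mem, of "\<lambda>\<beta>. c (\<beta>(x := \<alpha> x))"]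
        z[unfolded q_def] by blast
    thus ?thesis by simp
  qed
  have "\<exists>i p. q i p \<noteq> 0"
    using c cz by blast
  then obtain i0 where i0: "\<exists>p. q i0 p \<noteq> 0" and least: "\<And>i p. i < i0 \<Longrightarrow> q i p = 0"
    using exists_least_iff[of "\<lambda>i. \<exists>p. q i p \<noteq> 0"] by blast
  define r where "r p = (\<Sum>i\<in>{i0..<Suc N}. q i p * f p ^ (i - i0))" for p
  have r_poly: "r \<in> polyfun V"
    unfolding r_def[abs_def] by (intro polyfun_sum polyfun.mult polyfun_power f(1) polyfun_mono[OF q_poly J(1)])
  have "f p ^ i0 * r p = 0" if "p \<in> Y'" for p
  proof -
    have "f p ^ i0 * r p = (\<Sum>i\<in>{i0..<Suc N}. q i p * f p ^ i)"
      unfolding r_def sum_distrib_left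
      by (rule sum.cong) (auto simp: mult.left_commute simp flip: power_add)
    also have "\<dots> = (\<Sum>i<Suc N. q i p * f p ^ i)"
      by (rule sum.mono_neutral_left) (use least in auto)
    finally show ?thesis using rel'[OF that] by simp
  qed
  hence "(\<forall>p\<in>Y'. f p ^ i0 = 0) \<or> (\<forall>p\<in>Y'. r p = 0)"
    by (rule prime[OF polyfun_power[OF f(1)] r_poly])
  hence r0: "\<And>p. p \<in> Y' \<Longrightarrow> r p = 0" using f(3,4) by (metis power_not_zero)
  have i0N: "i0 < Suc N"
  proof (rule ccontr)
    assume "\<not> i0 < Suc N"
    hence "\<alpha> x < i0" if "\<alpha> \<in> box (insert x J) (\<lambda>_. Suc N)" for \<alpha>
      using that by (auto simp: box_def)
    hence "c \<alpha> = 0" if "\<alpha> \<in> box (insert x J) (\<lambda>_. Suc N)" for \<alpha>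
      using that by (intro cz least)
    thus False using c by blast
  qed
  have "q i0 p = 0" if "p \<in> Y" for p
  proof -
    have "r p = (\<Sum>i\<in>{i0..<Suc N}. if i = i0 then q i0 p else 0)"
      unfolding r_def by (rule sum.cong) (use f(2)[OF that] in auto)
    also have "\<dots> = q i0 p" using i0N by simp
    finally show ?thesis using r0 that sub by auto
  qed
  with indepD[OF J(2) q_poly] i0 show False by blast
qed

text \<open>On \<open>S\<close> the coordinate \<open>j\<close> is the fraction \<open>b / a\<close>
  of the others. If every set of this size avoiding \<open>j\<close> were dependent, the functions
  in \<open>I\<close>, with \<open>b\<close> in place of coordinate \<open>j\<close>, would satisfy
  a homogenised relation; divided by \<open>a ^ N\<close> it becomes a relation on \<open>I\<close>
  itself.\<close>

lemma indep_eliminate_coord: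
  fixes S :: "('v \<Rightarrow> 'a::field) set"
  assumes inf: "infinite (UNIV :: 'a set)" and V: "finite V"
    and ab: "a \<in> polyfun (V - {j})" "b \<in> polyfun (V - {j})"
    and eq: "\<And>p. p \<in> S \<Longrightarrow> a p \<noteq> 0 \<and> a p * p j = b p"
    and I: "I \<subseteq> V" "indep I S"
  shows "\<exists>I'\<subseteq>V - {j}. card I' = card I \<and> indep I' S"
proof (cases "j \<in> I")
  case False
  thus ?thesis using I by blast
next
  case True
  show ?thesis
  proof (rule ccontr)
    assume no: "\<not> ?thesis"
    have finI: "finite I" using I(1) V finite_subset by blast
    define u where "u v p = (if v = j then b p else p v)" for v and p :: "'v \<Rightarrow> 'a"
    have u: "u v \<in> polyfun (V - {j})" if "v \<in> I" for v
      using that ab(2) I(1) by (cases "v = j") (auto simp: u_def[abs_def] intro: polyfun.coord)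
    have cI: "card I = Suc (card I - 1)" using card_Suc_Diff1[OF finI True] True finI by simp
    have "\<exists>N c. (\<exists>\<alpha>\<in>box I (\<lambda>_. Suc N). c \<alpha> \<noteq> 0) \<and> (\<forall>p\<in>S.
      (\<Sum>\<alpha>\<in>box I (\<lambda>_. Suc N). c \<alpha> * ((\<Prod>v\<in>I. u v p ^ \<alpha> v) * a p ^ (N - \<alpha> j))) = 0)"
    proof (rule algebraic_relation[where V="V - {j}" and k="card I - 1"])
      show "finite (V - {j})" using V by simp
      show "card I = Suc (card I - 1)" by (rule cI)
      show "\<not> indep I' S" if "I' \<subseteq> V - {j}" "card I' = Suc (card I - 1)" for I'
        using no that(1) that(2) cI by (metis (no_types))
      show "u v \<in> polyfun (V - {j})" if "v \<in> I" for v using that by (rule u)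
    qed (rule finI True ab(1))+
    then obtain N c where c: "\<exists>\<alpha>\<in>box I (\<lambda>_. Suc N). c \<alpha> \<noteq> 0"
      and rel: "\<And>p. p \<in> S \<Longrightarrow>
        (\<Sum>\<alpha>\<in>box I (\<lambda>_. Suc N). c \<alpha> * ((\<Prod>v\<in>I. u v p ^ \<alpha> v) * a p ^ (N - \<alpha> j))) = 0"
      by blast
    let ?h = "\<lambda>p. \<Sum>\<alpha>\<in>box I (\<lambda>_. Suc N). c \<alpha> * monomial I \<alpha> p"
    have "?h p = 0" if p: "p \<in> S" for p
    proof -
      \<comment> \<open>The homogenising power supplies what is missing:
        \<open>b ^ \<alpha> j * a ^ (N - \<alpha> j)\<close> equals
        \<open>a ^ N * p j ^ \<alpha> j\<close>, so all terms share the factor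
        \<open>a ^ N\<close>.\<close>
      have "(\<Prod>v\<in>I. u v p ^ \<alpha> v) * a p ^ (N - \<alpha> j) = a p ^ N * monomial I \<alpha> p"
        if \<alpha>: "\<alpha> \<in> box I (\<lambda>_. Suc N)" for \<alpha>
      proof -
        have le: "\<alpha> j \<le> N" using \<alpha> True by (auto simp: box_def)
        have "(\<Prod>v\<in>I. u v p ^ \<alpha> v) = b p ^ \<alpha> j * (\<Prod>v\<in>I-{j}. p v ^ \<alpha> v)"
          using True finI by (subst prod.remove[of _ j]) (auto simp: u_def intro!: prod.cong)
        also have "b p ^ \<alpha> j = a p ^ \<alpha> j * p j ^ \<alpha> j"
          using eq[OF p] by (metis power_mult_distrib)
        also have "a p ^ \<alpha> j * p j ^ \<alpha> j * (\<Prod>v\<in>I-{j}. p v ^ \<alpha> v) = a p ^ \<alpha> j * monomial I \<alpha> p"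
          unfolding monomial_def using True finI by (subst (2) prod.remove[of _ j]) auto
        finally show ?thesis using le by (simp add: mult_ac flip: power_add)
      qed
      hence "(\<Sum>\<alpha>\<in>box I (\<lambda>_. Suc N). c \<alpha> * (a p ^ N * monomial I \<alpha> p)) = 0"
        using rel[OF p] by simp
      hence "a p ^ N * ?h p = 0" by (simp add: sum_distrib_left mult.left_commute)
      thus ?thesis using eq[OF p] by simp
    qed
    moreover have "?h \<in> polyfun I"
      by (intro polyfun_sum polyfun.mult polyfun.const monomial_polyfun) auto
    ultimately have "?h p = 0" for p using indepD[OF I(2)] by blast
    hence "c \<alpha> = 0" if "\<alpha> \<in> box I (\<lambda>_. Suc N)" for \<alpha>
      using monomial_independent[OF inf finI finite_box[OF finI] _ _ that, of c] by (auto simp: box_def)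
    with c show False by blast
  qed
qed

text \<open>Gaussian elimination: each pivot coefficient is nonzero on one piece of \<open>S\<close>.\<close>

lemma indep_eliminate:
  fixes S :: "('v \<Rightarrow> 'a::field) set" and a :: "'e \<Rightarrow> 'v \<Rightarrow> ('v \<Rightarrow> 'a) \<Rightarrow> 'a"
  assumes inf: "infinite (UNIV :: 'a set)" and fin: "finite R" "finite E" "finite W" "finite T"
    and disj: "W \<inter> R = {}" "T \<inter> R = {}"
    and a: "\<And>e i. a e i \<in> polyfun W"
    and eqs: "\<And>p e. p \<in> S \<Longrightarrow> e \<in> E \<Longrightarrow> (\<Sum>i\<in>R \<union> T. a e i p * p i) = 0"
    and nondeg: "\<And>p x i. p \<in> S \<Longrightarrow> (\<And>e. e \<in> E \<Longrightarrow> (\<Sum>i\<in>R. a e i p * x i) = 0) \<Longrightarrow> i \<in> R \<Longrightarrow> x i = 0"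
    and I: "I \<subseteq> W \<union> R \<union> T" "indep I S"
  shows "\<exists>I'\<subseteq>W \<union> T. card I' = card I \<and> indep I' S"
  using fin(1) disj a eqs nondeg I
proof (induction R arbitrary: S a I rule: finite_induct)
  case empty
  thus ?case by auto
next
  case (insert j R)
  note a = insert.prems(3) and eqs = insert.prems(4) and nondeg = insert.prems(5)
  have jT: "j \<notin> R \<union> T" "j \<notin> W" using insert.hyps insert.prems(1,2) by auto
  \<comment> \<open>The piece on which row \<open>e\<close> can serve as pivot row for column
    \<open>j\<close>; by nondegeneracy these pieces cover \<open>S\<close>.\<close>
  let ?S = "\<lambda>e. {p \<in> S. a e j p \<noteq> 0}"
  have "S \<subseteq> (\<Union>e\<in>E. ?S e)"
  proof
    fix p assume p: "p \<in> S"
    have "\<exists>e\<in>E. a e j p \<noteq> 0"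
    proof (rule ccontr)
      assume z: "\<not> ?thesis"
      have "(\<Sum>i\<in>insert j R. a e i p * (if i = j then 1 else 0)) = 0" if "e \<in> E" for e
        using z that by (intro sum.neutral) auto
      from nondeg[OF p this, of j] show False by simp
    qed
    thus "p \<in> (\<Union>e\<in>E. ?S e)" using p by blast
  qed
  from indep_Union[OF inf fin(2) insert.prems(7) this]
  obtain e0 where e0: "e0 \<in> E" "indep I (?S e0)" by blast
  have eq_j: "a e j p * p j = - (\<Sum>i\<in>R \<union> T. a e i p * p i)" if "p \<in> S" "e \<in> E" for p e
    using eqs[OF that] jT(1) fin(4) insert.hyps(1) by (simp add: eq_neg_iff_add_eq_0)
  have Wsub: "W \<subseteq> W \<union> insert j R \<union> T - {j}" using jT(2) by blast
  have "\<exists>I'\<subseteq>(W \<union> insert j R \<union> T) - {j}. card I' = card I \<and> indep I' (?S e0)"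
  proof (rule indep_eliminate_coord[OF inf _ _ _ _ insert.prems(6) e0(2)])
    show "finite (W \<union> insert j R \<union> T)" using fin insert.hyps(1) by simp
    show "a e0 j \<in> polyfun (W \<union> insert j R \<union> T - {j})"
      by (rule polyfun_mono[OF a Wsub])
    show "(\<lambda>p. - (\<Sum>i\<in>R \<union> T. a e0 i p * p i)) \<in> polyfun (W \<union> insert j R \<union> T - {j})"
      by (intro polyfun_uminus polyfun_sum polyfun.mult polyfun_mono[OF a Wsub] polyfun.coord) (use jT in blast)
  qed (use eq_j e0(1) in auto)
  moreover have "W \<union> insert j R \<union> T - {j} = W \<union> R \<union> T" using jT by blast
  ultimately obtain I1 where I1: "I1 \<subseteq> W \<union> R \<union> T" "card I1 = card I" "indep I1 (?S e0)"
    by blast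
  \<comment> \<open>Elimination without division: row \<open>e\<close> times the pivot minus a
    multiple of the pivot row, so the entries remain polynomials in \<open>W\<close> and column
    \<open>j\<close> becomes zero.\<close>
  define a' where "a' e i p = a e0 j p * a e i p - a e j p * a e0 i p" for e i p
  have sum_a': "(\<Sum>i\<in>K. a' e i p * x i) = a e0 j p * (\<Sum>i\<in>K. a e i p * x i) - a e j p * (\<Sum>i\<in>K. a e0 i p * x i)"
    for K e p x by (simp add: a'_def sum_distrib_left left_diff_distrib sum_subtractf mult.assoc)
  have "\<exists>I'\<subseteq>W \<union> T. card I' = card I1 \<and> indep I' (?S e0)"
  proof (rule insert.IH[of a' "?S e0" I1])
    show "a' e i \<in> polyfun W" for e i
      unfolding a'_def[abs_def] by (intro polyfun_diff polyfun.mult a)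
    show "(\<Sum>i\<in>R \<union> T. a' e i p * p i) = 0" if "p \<in> ?S e0" "e \<in> E" for p e
    proof -
      have "(\<Sum>i\<in>R \<union> T. a e' i p * p i) = - (a e' j p * p j)" if "e' \<in> E" for e'
        using eq_j[of p e'] \<open>p \<in> ?S e0\<close> that by simp
      thus ?thesis using that e0(1) unfolding sum_a' by simp
    qed
    show "x i = 0" if p: "p \<in> ?S e0" and x: "\<And>e. e \<in> E \<Longrightarrow> (\<Sum>i\<in>R. a' e i p * x i) = 0" and i: "i \<in> R" for p x i
    proof -
      \<comment> \<open>A solution of the reduced system extends to the old one by solving the pivot
        row for the entry at \<open>j\<close>, so nondegeneracy passes to the smaller
        system.\<close>
      define y where "y = x(j := - (\<Sum>i\<in>R. a e0 i p * x i) / a e0 j p)"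
      have yR: "(\<Sum>i\<in>R. a e i p * y i) = (\<Sum>i\<in>R. a e i p * x i)" for e
        by (rule sum.cong) (use jT in \<open>auto simp: y_def\<close>)
      have "(\<Sum>i\<in>insert j R. a e i p * y i) = 0" if e: "e \<in> E" for e
      proof -
        have "a e0 j p * (\<Sum>i\<in>insert j R. a e i p * y i) = a e0 j p * (a e j p * y j) + a e0 j p * (\<Sum>i\<in>R. a e i p * x i)"
          using jT insert.hyps(1) yR[of e] by (simp add: distrib_left)
        also have "a e0 j p * (a e j p * y j) = - a e j p * (\<Sum>i\<in>R. a e0 i p * x i)"
          using p by (simp add: y_def)
        finally have "a e0 j p * (\<Sum>i\<in>insert j R. a e i p * y i) = (\<Sum>i\<in>R. a' e i p * x i)"
          by (simp add: sum_a')
        thus ?thesis using x[OF e] p by simp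
      qed
      hence "y i = 0" using nondeg[of p y i] p i by simp
      moreover have "i \<noteq> j" using i jT(1) by blast
      ultimately show ?thesis by (simp add: y_def)
    qed
  qed (use insert.prems I1 in auto)
  then obtain I2 where "I2 \<subseteq> W \<union> T" "card I2 = card I1" "indep I2 (?S e0)" by blast
  thus ?case using I1(2) indep_mono[of I2 "?S e0" I2 S] by auto
qed

section \<open>Extending zeros of prime ideals\<close>

text \<open>A strict bound is used in place of a degree; the zero function then needs no special
  treatment and is the case \<open>k = 0\<close>.\<close>

definition deg_lt :: "'v set \<Rightarrow> 'v \<Rightarrow> nat \<Rightarrow> (('v \<Rightarrow> 'a::field) \<Rightarrow> 'a) set" where
  "deg_lt W v k = {f. \<exists>g. (\<forall>i. g i \<in> polyfun W) \<and> f = (\<lambda>p. \<Sum>i<k. g i p * p v ^ i)}"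

lemma deg_ltI: "(\<And>i. g i \<in> polyfun W) \<Longrightarrow> (\<lambda>p. \<Sum>i<k. g i p * p v ^ i) \<in> deg_lt W v k"
  unfolding deg_lt_def by blast

lemma deg_lt_0: "f \<in> deg_lt W v 0 \<Longrightarrow> f p = 0"
  unfolding deg_lt_def by auto

lemma zero_deg_lt: "(\<lambda>p. 0) \<in> deg_lt W v k"
  using deg_ltI[of "\<lambda>i p. 0" W v k] by (simp add: polyfun.const)

lemma deg_lt_SucI:
  fixes c f :: "('v \<Rightarrow> 'a::field) \<Rightarrow> 'a"
  assumes "c \<in> polyfun W" "f \<in> deg_lt W v k"
  shows "(\<lambda>p. c p * p v ^ k + f p) \<in> deg_lt W v (Suc k)"
proof -
  obtain g where g: "\<And>i. g i \<in> polyfun W" "f = (\<lambda>p. \<Sum>i<k. g i p * p v ^ i)"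
    using assms(2) unfolding deg_lt_def by blast
  define g' where "g' i = (if i = k then c else g i)" for i
  have "(\<lambda>p. \<Sum>i<Suc k. g' i p * p v ^ i) \<in> deg_lt W v (Suc k)"
    by (rule deg_ltI) (simp add: g'_def g assms)
  also have "(\<lambda>p. \<Sum>i<Suc k. g' i p * p v ^ i) = (\<lambda>p. c p * p v ^ k + f p)"
    by (rule ext) (simp add: g'_def g(2))
  finally show ?thesis .
qed

lemma deg_lt_SucE:
  assumes "f \<in> deg_lt W v (Suc k)"
  obtains c f' where "c \<in> polyfun W" "f' \<in> deg_lt W v k" "f = (\<lambda>p. c p * p v ^ k + f' p)"
proof -
  obtain g where g: "\<And>i. g i \<in> polyfun W" "f = (\<lambda>p. \<Sum>i<Suc k. g i p * p v ^ i)"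
    using assms unfolding deg_lt_def by blast
  show ?thesis
  proof (rule that)
    show "g k \<in> polyfun W" by (rule g(1))
    show "(\<lambda>p. \<Sum>i<k. g i p * p v ^ i) \<in> deg_lt W v k" by (rule deg_ltI) (rule g(1))
    show "f = (\<lambda>p. g k p * p v ^ k + (\<Sum>i<k. g i p * p v ^ i))" by (rule ext) (simp add: g(2))
  qed
qed

lemma deg_lt_polyfun: "f \<in> deg_lt W v k \<Longrightarrow> f \<in> polyfun (insert v W)"
proof (induction k arbitrary: f)
  case 0
  have "f = (\<lambda>p. 0)" using deg_lt_0[OF 0] by (rule ext)
  thus ?case by (simp add: polyfun.const)
next
  case (Suc k)
  obtain c f' where c: "c \<in> polyfun W" "f' \<in> deg_lt W v k" "f = (\<lambda>p. c p * p v ^ k + f' p)"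
    by (rule deg_lt_SucE[OF Suc.prems])
  show ?case unfolding c(3)
    by (intro polyfun.add polyfun.mult polyfun_power polyfun.coord Suc.IH c(2) polyfun_mono[OF c(1)]) auto
qed

lemma deg_lt_add:
  fixes f g :: "('v \<Rightarrow> 'a::field) \<Rightarrow> 'a"
  assumes "f \<in> deg_lt W v k" "g \<in> deg_lt W v k"
  shows "(\<lambda>p. f p + g p) \<in> deg_lt W v k"
proof -
  obtain a b where ab: "\<And>i. a i \<in> polyfun W" "f = (\<lambda>p. \<Sum>i<k. a i p * p v ^ i)"
     "\<And>i. b i \<in> polyfun W" "g = (\<lambda>p. \<Sum>i<k. b i p * p v ^ i)"
    using assms unfolding deg_lt_def by blast
  have "(\<lambda>p. \<Sum>i<k. (a i p + b i p) * p v ^ i) \<in> deg_lt W v k"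
    by (rule deg_ltI) (intro polyfun.add ab)
  thus ?thesis by (simp add: ab(2,4) distrib_right sum.distrib)
qed

lemma deg_lt_scale:
  fixes f c :: "('v \<Rightarrow> 'a::field) \<Rightarrow> 'a"
  assumes "c \<in> polyfun W" "f \<in> deg_lt W v k"
  shows "(\<lambda>p. c p * f p) \<in> deg_lt W v k"
proof -
  obtain a where a: "\<And>i. a i \<in> polyfun W" "f = (\<lambda>p. \<Sum>i<k. a i p * p v ^ i)"
    using assms unfolding deg_lt_def by blast
  have "(\<lambda>p. \<Sum>i<k. (c p * a i p) * p v ^ i) \<in> deg_lt W v k"
    by (rule deg_ltI) (intro polyfun.mult a assms)
  thus ?thesis by (simp add: a(2) sum_distrib_left mult.assoc)
qed

lemma deg_lt_diff:
  fixes f g :: "('v \<Rightarrow> 'a::field) \<Rightarrow> 'a"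
  assumes "f \<in> deg_lt W v k" "g \<in> deg_lt W v k"
  shows "(\<lambda>p. f p - g p) \<in> deg_lt W v k"
  using deg_lt_add[OF assms(1) deg_lt_scale[OF polyfun.const[of "-1"] assms(2)]] by simp

lemma deg_lt_mono:
  fixes f :: "('v \<Rightarrow> 'a::field) \<Rightarrow> 'a"
  assumes "f \<in> deg_lt W v k" "k \<le> l" shows "f \<in> deg_lt W v l"
  using assms(2)
proof (induction l rule: dec_induct)
  case (step l)
  show ?case using deg_lt_SucI[OF polyfun.const[of 0] step.IH] by simp
qed (rule assms(1))

lemma deg_lt_shift:
  fixes f :: "('v \<Rightarrow> 'a::field) \<Rightarrow> 'a"
  assumes "f \<in> deg_lt W v k" shows "(\<lambda>p. p v ^ j * f p) \<in> deg_lt W v (k + j)"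
  using assms
proof (induction k arbitrary: f)
  case 0
  have "(\<lambda>p. p v ^ j * f p) = (\<lambda>p. 0)" using deg_lt_0[OF 0] by (intro ext) simp
  thus ?case by (simp add: zero_deg_lt)
next
  case (Suc k)
  obtain c f' where c: "c \<in> polyfun W" "f' \<in> deg_lt W v k" "f = (\<lambda>p. c p * p v ^ k + f' p)"
    by (rule deg_lt_SucE[OF Suc.prems])
  show ?case using deg_lt_SucI[OF c(1) Suc.IH[OF c(2)]] by (simp add: c(3) algebra_simps power_add)
qed

lemma deg_lt_mult:
  fixes f g :: "('v \<Rightarrow> 'a::field) \<Rightarrow> 'a"
  assumes "f \<in> deg_lt W v k" "g \<in> deg_lt W v l"
  shows "(\<lambda>p. f p * g p) \<in> deg_lt W v (l + k)"
  using assms(1)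
proof (induction k arbitrary: f)
  case 0
  have "(\<lambda>p. f p * g p) = (\<lambda>p. 0)" using deg_lt_0[OF 0] by (intro ext) simp
  thus ?case by (simp add: zero_deg_lt)
next
  case (Suc k)
  obtain c f' where c: "c \<in> polyfun W" "f' \<in> deg_lt W v k" "f = (\<lambda>p. c p * p v ^ k + f' p)"
    by (rule deg_lt_SucE[OF Suc.prems])
  have "(\<lambda>p. c p * (p v ^ k * g p) + f' p * g p) \<in> deg_lt W v (l + Suc k)"
    by (intro deg_lt_add deg_lt_mono[OF deg_lt_scale[OF c(1) deg_lt_shift[OF assms(2)]]]
          deg_lt_mono[OF Suc.IH[OF c(2)]]) auto
  thus ?case by (simp add: c(3) algebra_simps)
qed

lemma polyfun_deg_lt:
  assumes "f \<in> polyfun (insert v W)" shows "\<exists>k. f \<in> deg_lt W v k"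
  using assms
proof (induction rule: polyfun.induct)
  case (const c)
  have "(\<lambda>p. c * p v ^ 0 + 0) \<in> deg_lt W v (Suc 0)"
    by (rule deg_lt_SucI[OF polyfun.const zero_deg_lt])
  thus ?case by auto
next
  case (coord u)
  show ?case
  proof (cases "u = v")
    case True
    have "(\<lambda>p. 1 * p v ^ 1 + 0) \<in> deg_lt W v (Suc 1)"
      by (rule deg_lt_SucI[OF polyfun.const zero_deg_lt])
    thus ?thesis using True by auto
  next
    case False
    have "(\<lambda>p. p u * p v ^ 0 + 0) \<in> deg_lt W v (Suc 0)"
      by (rule deg_lt_SucI[OF polyfun.coord zero_deg_lt]) (use False coord in auto)
    thus ?thesis by auto
  qed
next
  case (add f g)
  then obtain k l where kl: "f \<in> deg_lt W v k" "g \<in> deg_lt W v l" by blast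
  have "(\<lambda>p. f p + g p) \<in> deg_lt W v (max k l)"
    by (intro deg_lt_add deg_lt_mono[OF kl(1)] deg_lt_mono[OF kl(2)]) auto
  thus ?case ..
next
  case (mult f g)
  then obtain k l where kl: "f \<in> deg_lt W v k" "g \<in> deg_lt W v l" by blast
  show ?case using deg_lt_mult[OF kl] ..
qed

text \<open>Division by \<open>l v^n + f'\<close> without inverting \<open>l\<close>: the top term
  \<open>c v^k\<close> of \<open>g\<close> is removed by passing to
  \<open>l g - c v^(k - n) (l v^n + f')\<close>, at the cost of one factor \<open>l\<close> per
  step.\<close>

lemma pseudo_division:
  fixes g l f' :: "('v \<Rightarrow> 'a::field) \<Rightarrow> 'a"
  assumes l: "l \<in> polyfun W" and f': "f' \<in> deg_lt W v n" and g: "g \<in> deg_lt W v k"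
  shows "\<exists>m. \<exists>q\<in>deg_lt W v (k - n). \<exists>r\<in>deg_lt W v n.
    \<forall>p. l p ^ m * g p = q p * (l p * p v ^ n + f' p) + r p"
  using g
proof (induction k arbitrary: g)
  case 0
  have "\<forall>p. l p ^ 0 * g p = 0 * (l p * p v ^ n + f' p) + 0" using deg_lt_0[OF 0] by simp
  thus ?case by (intro exI[of _ 0] bexI[of _ "\<lambda>p. 0"]) (auto intro: zero_deg_lt)
next
  case (Suc k)
  show ?case
  proof (cases "Suc k \<le> n")
    case True
    have "\<forall>p. l p ^ 0 * g p = 0 * (l p * p v ^ n + f' p) + g p" by simp
    thus ?thesis by (intro exI[of _ 0] bexI[of _ "\<lambda>p. 0"] bexI[of _ g])
      (auto intro: zero_deg_lt deg_lt_mono[OF Suc.prems True])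
  next
    case False
    obtain c g' where c: "c \<in> polyfun W" "g' \<in> deg_lt W v k" "g = (\<lambda>p. c p * p v ^ k + g' p)"
      by (rule deg_lt_SucE[OF Suc.prems])
    let ?g1 = "\<lambda>p. l p * g' p - c p * (p v ^ (k - n) * f' p)"
    have "(\<lambda>p. p v ^ (k - n) * f' p) \<in> deg_lt W v k"
      using deg_lt_shift[OF f', of "k - n"] False by simp
    hence "?g1 \<in> deg_lt W v k"
      by (rule deg_lt_diff[OF deg_lt_scale[OF l c(2)] deg_lt_scale[OF c(1)]])
    then obtain m q r where mqr: "q \<in> deg_lt W v (k - n)" "r \<in> deg_lt W v n"
      "\<And>p. l p ^ m * ?g1 p = q p * (l p * p v ^ n + f' p) + r p"
      using Suc.IH by blast
    let ?q = "\<lambda>p. (l p ^ m * c p) * p v ^ (k - n) + q p"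
    have "?q \<in> deg_lt W v (Suc (k - n))"
      by (intro deg_lt_SucI polyfun.mult polyfun_power l c mqr)
    hence q: "?q \<in> deg_lt W v (Suc k - n)" using False by (simp add: Suc_diff_le)
    have "l p ^ Suc m * g p = ?q p * (l p * p v ^ n + f' p) + r p" for p
    proof -
      have pw: "p v ^ k = p v ^ (k - n) * p v ^ n" using False by (simp flip: power_add)
      have "l p ^ Suc m * g p = l p ^ m * ?g1 p + l p ^ m * c p * p v ^ (k - n) * (l p * p v ^ n + f' p)"
        by (simp add: c(3) pw algebra_simps)
      also have "\<dots> = ?q p * (l p * p v ^ n + f' p) + r p"
        unfolding mqr(3) by (simp add: algebra_simps)
      finally show ?thesis .
    qed
    thus ?thesis by (intro exI[of _ "Suc m"] bexI[OF _ q] bexI[OF _ mqr(2)]) blast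
  qed
qed

section \<open>Prime ideals and elimination of a coordinate\<close>

locale prime_polyideal =
  fixes V :: "'v set" and P :: "(('v \<Rightarrow> 'a::field) \<Rightarrow> 'a) set"
  assumes sub: "P \<subseteq> polyfun V"
    and zero: "(\<lambda>p. 0) \<in> P"
    and add: "f \<in> P \<Longrightarrow> g \<in> P \<Longrightarrow> (\<lambda>p. f p + g p) \<in> P"
    and mult: "f \<in> P \<Longrightarrow> g \<in> polyfun V \<Longrightarrow> (\<lambda>p. g p * f p) \<in> P"
    and one: "(\<lambda>p. 1) \<notin> P"
    and prime: "f \<in> polyfun V \<Longrightarrow> g \<in> polyfun V \<Longrightarrow> (\<lambda>p. f p * g p) \<in> P \<Longrightarrow> f \<in> P \<or> g \<in> P"
begin

lemma diff: "f \<in> P \<Longrightarrow> g \<in> P \<Longrightarrow> (\<lambda>p. f p - g p) \<in> P"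
  using add[OF _ mult[OF _ polyfun.const[of "-1"]]] by simp

lemma power_notin: "f \<in> polyfun V \<Longrightarrow> f \<notin> P \<Longrightarrow> (\<lambda>p. f p ^ m) \<notin> P"
proof (induction m)
  case (Suc m)
  show ?case using prime[OF Suc.prems(1) polyfun_power[OF Suc.prems(1), of m]] Suc by auto
qed (simp add: one)

text \<open>For \<open>v\<close> outside \<open>W\<close>, such a function puts no condition on
  \<open>v\<close>: over a zero of \<open>P \<inter> polyfun W\<close> it vanishes whatever value
  \<open>v\<close> takes.\<close>

definition coeffs_in :: "'v set \<Rightarrow> 'v \<Rightarrow> nat \<Rightarrow> (('v \<Rightarrow> 'a) \<Rightarrow> 'a) \<Rightarrow> bool" where
  "coeffs_in W v k f \<longleftrightarrow> (\<exists>g. (\<forall>i. g i \<in> polyfun W \<inter> P) \<and> f = (\<lambda>p. \<Sum>i<k. g i p * p v ^ i))"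

text \<open>The coefficient \<open>l\<close> must lie outside \<open>P\<close>, so that the top term
  of \<open>l v^n + f\<close> does not disappear modulo \<open>P\<close>.\<close>

definition leading :: "'v set \<Rightarrow> 'v \<Rightarrow> (('v \<Rightarrow> 'a) \<Rightarrow> 'a) \<Rightarrow> (('v \<Rightarrow> 'a) \<Rightarrow> 'a) \<Rightarrow> nat \<Rightarrow> bool" where
  "leading W v l f n \<longleftrightarrow> l \<in> polyfun W \<and> l \<notin> P \<and> f \<in> deg_lt W v n"

lemma coeffs_in_vanish:
  assumes "coeffs_in W v k f" "\<And>g. g \<in> P \<inter> polyfun W \<Longrightarrow> g p0 = 0" "\<And>u. u \<in> W \<Longrightarrow> p u = p0 u"
  shows "f p = 0"
proof -
  obtain g where g: "\<forall>i. g i \<in> polyfun W \<inter> P" "f = (\<lambda>p. \<Sum>i<k. g i p * p v ^ i)"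
    using assms(1) unfolding coeffs_in_def by (elim exE conjE)
  have "g i p = 0" for i
  proof -
    have gi: "g i \<in> polyfun W" "g i \<in> P" using g(1) by auto
    have "g i p = g i p0" by (rule polyfun_cong[OF gi(1) assms(3)])
    also have "\<dots> = 0" by (rule assms(2)) (use gi in simp)
    finally show ?thesis .
  qed
  thus ?thesis by (simp add: g(2))
qed

text \<open>The top coefficient of \<open>f\<close> must lie in \<open>P\<close>, since otherwise
  \<open>f\<close> would be a relation of the excluded kind; subtracting the top term leaves an
  element of \<open>P\<close> of smaller degree.\<close>

lemma coeffs_in_if_no_leading:
  assumes W: "insert v W \<subseteq> V" and no: "\<And>n l f. n < k \<Longrightarrow> leading W v l f n \<Longrightarrow> (\<lambda>p. l p * p v ^ n + f p) \<notin> P"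
    and f: "f \<in> deg_lt W v k" "f \<in> P"
  shows "coeffs_in W v k f"
  using no f
proof (induction k arbitrary: f)
  case 0
  have "f = (\<lambda>p. 0)" using deg_lt_0[OF 0(2)] by (rule ext)
  hence "f = (\<lambda>p. \<Sum>i<0. 0 * p v ^ i)" by simp
  thus ?case unfolding coeffs_in_def by (intro exI[of _ "\<lambda>i p. 0"]) (simp add: zero polyfun.const)
next
  case (Suc k)
  obtain c f' where c: "c \<in> polyfun W" "f' \<in> deg_lt W v k" "f = (\<lambda>p. c p * p v ^ k + f' p)"
    by (rule deg_lt_SucE[OF Suc.prems(2)])
  have cP: "c \<in> P" using Suc.prems(1)[of k c f'] Suc.prems(3) c by (auto simp: leading_def)
  have "(\<lambda>p. p v ^ k * c p) \<in> P"
    by (rule mult[OF cP polyfun_power[OF polyfun.coord]]) (use W in auto)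
  from diff[OF Suc.prems(3) this] have "f' \<in> P" by (simp add: c(3) mult.commute)
  have "coeffs_in W v k f'"
    by (rule Suc.IH[OF Suc.prems(1) c(2) \<open>f' \<in> P\<close>]) auto
  then obtain g where g: "\<forall>i. g i \<in> polyfun W \<inter> P" "f' = (\<lambda>p. \<Sum>i<k. g i p * p v ^ i)"
    unfolding coeffs_in_def by (elim exE conjE)
  have "f = (\<lambda>p. \<Sum>i<Suc k. (if i = k then c else g i) p * p v ^ i)"
    by (rule ext) (simp add: c(3) g(2))
  moreover have "\<forall>i. (if i = k then c else g i) \<in> polyfun W \<inter> P" using g(1) c(1) cP by simp
  ultimately show ?case unfolding coeffs_in_def by (intro exI[of _ "\<lambda>i. if i = k then c else g i"]) simp
qed

text \<open>Top coefficients lying in \<open>P\<close> are dropped until one outside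
  \<open>P\<close> is met; it exists because \<open>f\<close> itself is outside
  \<open>P\<close>.\<close>

lemma strip_leading:
  assumes W: "insert v W \<subseteq> V" and f: "f \<in> deg_lt W v k" "f \<notin> P"
  shows "\<exists>e<k. \<exists>l f'. leading W v l f' e \<and> (\<lambda>p. f p - (l p * p v ^ e + f' p)) \<in> P"
  using f
proof (induction k arbitrary: f)
  case 0
  have "f = (\<lambda>p. 0)" using deg_lt_0[OF 0(1)] by (rule ext)
  thus ?case using 0(2) zero by simp
next
  case (Suc k)
  obtain c f' where c: "c \<in> polyfun W" "f' \<in> deg_lt W v k" "f = (\<lambda>p. c p * p v ^ k + f' p)"
    by (rule deg_lt_SucE[OF Suc.prems(1)])
  show ?case
  proof (cases "c \<in> P")
    case True
    have x: "(\<lambda>p. p v ^ k * c p) \<in> P"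
      by (rule mult[OF True polyfun_power[OF polyfun.coord]]) (use W in auto)
    have "f' \<notin> P"
    proof
      assume "f' \<in> P"
      from add[OF x this] Suc.prems(2) show False by (simp add: c(3) mult.commute)
    qed
    from Suc.IH[OF c(2) this] obtain e l f'' where e: "e < k" "leading W v l f'' e"
      "(\<lambda>p. f' p - (l p * p v ^ e + f'' p)) \<in> P" by blast
    have "(\<lambda>p. f p - (l p * p v ^ e + f'' p)) \<in> P"
      using add[OF x e(3)] by (simp add: c(3) algebra_simps)
    thus ?thesis using e(1,2) less_SucI by blast
  next
    case False
    have "(\<lambda>p. f p - (c p * p v ^ k + f' p)) \<in> P" by (simp add: c(3) zero)
    moreover have "leading W v c f' k" using c False by (simp add: leading_def)
    ultimately show ?thesis by blast
  qed
qed

lemma leading_deg_lt: "leading W v l f n \<Longrightarrow> (\<lambda>p. l p * p v ^ n + f p) \<in> deg_lt W v (Suc n)"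
  unfolding leading_def by (blast intro: deg_lt_SucI)

text \<open>If \<open>v\<close> is algebraic modulo \<open>P\<close>, with relation \<open>l v\<^sup>n + f = 0\<close> of least degree, every \<open>b\<close> outside \<open>P\<close> has a
  multiple that is congruent to a polynomial without \<open>v\<close>: take an element of least \<open>v\<close>-degree in the
  ideal generated by \<open>b\<close>, and divide the relation by it.\<close>

lemma multiple_without_coord:
  assumes W: "insert v W \<subseteq> V" and lead: "leading W v l f n" "(\<lambda>p. l p * p v ^ n + f p) \<in> P"
    and least: "\<And>i c g. i < n \<Longrightarrow> leading W v c g i \<Longrightarrow> (\<lambda>p. c p * p v ^ i + g p) \<notin> P"
    and b: "b \<in> polyfun (insert v W)" "b \<notin> P"
  shows "\<exists>h\<in>polyfun W. h \<notin> P \<and> (\<exists>q\<in>polyfun (insert v W). (\<lambda>p. h p - q p * b p) \<in> P)"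
proof -
  let ?W = "insert v W"
  \<comment> \<open>\<open>Q\<close> is the ideal generated by \<open>b\<close> modulo
    \<open>P\<close>, with multipliers from \<open>polyfun ?W\<close>.\<close>
  define Q where "Q g \<longleftrightarrow> (\<exists>q\<in>polyfun ?W. (\<lambda>p. g p - q p * b p) \<in> P)" for g
  have up: "g \<in> polyfun V" if "g \<in> polyfun ?W" for g using that W by (rule polyfun_mono)
  have upW: "g \<in> polyfun V" if "g \<in> polyfun W" for g by (rule polyfun_mono[OF that]) (use W in auto)
  have upI: "g \<in> polyfun ?W" if "g \<in> polyfun W" for g by (rule polyfun_mono[OF that]) auto
  have Q_P: "Q g" if "g \<in> P" for g
    unfolding Q_def by (rule bexI[OF _ polyfun.const[of 0]]) (simp add: that)
  have Q_b: "Q b"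
    unfolding Q_def by (rule bexI[OF _ polyfun.const[of 1]]) (simp add: zero)
  have Q_mult: "Q (\<lambda>p. c p * g p)" if c: "c \<in> polyfun ?W" and "Q g" for c g
  proof -
    obtain q where q: "q \<in> polyfun ?W" "(\<lambda>p. g p - q p * b p) \<in> P" using \<open>Q g\<close> unfolding Q_def by (elim bexE)
    show ?thesis unfolding Q_def
      by (rule bexI[OF _ polyfun.mult[OF c q(1)]]) (use mult[OF q(2) up[OF c]] in \<open>simp add: algebra_simps\<close>)
  qed
  have Q_diff: "Q (\<lambda>p. g p - g' p)" if "Q g" "Q g'" for g g'
  proof -
    obtain q where q: "q \<in> polyfun ?W" "(\<lambda>p. g p - q p * b p) \<in> P" using \<open>Q g\<close> unfolding Q_def by (elim bexE)
    obtain q' where q': "q' \<in> polyfun ?W" "(\<lambda>p. g' p - q' p * b p) \<in> P" using \<open>Q g'\<close> unfolding Q_def by (elim bexE)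
    show ?thesis unfolding Q_def
      by (rule bexI[OF _ polyfun_diff[OF q(1) q'(1)]]) (use diff[OF q(2) q'(2)] in \<open>simp add: algebra_simps\<close>)
  qed
  have xV: "(\<lambda>p. p v ^ i) \<in> polyfun V" for i by (rule polyfun_power[OF polyfun.coord]) (use W in auto)
  \<comment> \<open>The degrees occurring in \<open>Q\<close> outside \<open>P\<close>; the least of
    them will turn out to be 0.\<close>
  define R where "R e \<longleftrightarrow> (\<exists>c g. leading W v c g e \<and> Q (\<lambda>p. c p * p v ^ e + g p) \<and> (\<lambda>p. c p * p v ^ e + g p) \<notin> P)" for e
  have R_from: "\<exists>e<k. R e" if r: "r \<in> deg_lt W v k" "r \<notin> P" "Q r" for r k
  proof -
    obtain e c g where e: "e < k" "leading W v c g e" and d: "(\<lambda>p. r p - (c p * p v ^ e + g p)) \<in> P"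
      using strip_leading[OF W r(1,2)] by (elim exE conjE)
    have eq: "(\<lambda>p. c p * p v ^ e + g p) = (\<lambda>p. r p - (r p - (c p * p v ^ e + g p)))" by simp
    have "Q (\<lambda>p. c p * p v ^ e + g p)" by (subst eq) (rule Q_diff[OF r(3) Q_P[OF d]])
    moreover have "(\<lambda>p. c p * p v ^ e + g p) \<notin> P"
    proof
      assume "(\<lambda>p. c p * p v ^ e + g p) \<in> P"
      from add[OF d this] r(2) show False by simp
    qed
    ultimately show ?thesis using e unfolding R_def by (intro exI[of _ e] conjI exI[of _ c] exI[of _ g])
  qed
  have l: "l \<in> polyfun W" "l \<notin> P" "f \<in> deg_lt W v n" using lead(1) by (auto simp: leading_def)
  obtain k where k: "b \<in> deg_lt W v k" using polyfun_deg_lt[OF b(1)] by (elim exE)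
  \<comment> \<open>Reducing \<open>b\<close> by the relation shows that some degree below
    \<open>n\<close> occurs. The remainder stays outside \<open>P\<close> because
    \<open>l ^ m * b\<close> does, \<open>P\<close> being prime.\<close>
  obtain m q r where mqr: "q \<in> deg_lt W v (k - n)" "r \<in> deg_lt W v n"
      "\<forall>p. l p ^ m * b p = q p * (l p * p v ^ n + f p) + r p"
    using pseudo_division[OF l(1,3) k] by (elim exE bexE)
  have qF: "(\<lambda>p. q p * (l p * p v ^ n + f p)) \<in> P" by (rule mult[OF lead(2) up[OF deg_lt_polyfun[OF mqr(1)]]])
  have r_eq: "r = (\<lambda>p. l p ^ m * b p - q p * (l p * p v ^ n + f p))" using mqr(3) by (intro ext) simp
  have "Q r" unfolding r_eq by (rule Q_diff[OF Q_mult[OF polyfun_power[OF upI[OF l(1)]] Q_b] Q_P[OF qF]])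
  moreover have "r \<notin> P"
  proof
    assume "r \<in> P"
    from add[OF qF this] have "(\<lambda>p. l p ^ m * b p) \<in> P" using mqr(3) by simp
    from prime[OF polyfun_power[OF upW[OF l(1)]] up[OF b(1)] this] show False
      using power_notin[OF upW[OF l(1)] l(2)] b(2) by blast
  qed
  ultimately obtain e0 where e0: "e0 < n" "R e0" using R_from[OF mqr(2)] by blast
  define e where "e = (LEAST e. R e)"
  have Re: "R e" unfolding e_def by (rule LeastI[of R, OF e0(2)])
  have e_min: "\<not> R i" if "i < e" for i using that not_less_Least[of i R] by (simp add: e_def)
  have en: "e < n" using Least_le[of R, OF e0(2)] e0(1) by (simp add: e_def)
  obtain c g where cg: "leading W v c g e" and Qc: "Q (\<lambda>p. c p * p v ^ e + g p)"
    and nP: "(\<lambda>p. c p * p v ^ e + g p) \<notin> P" using Re unfolding R_def by (elim exE conjE)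
  have c: "c \<in> polyfun W" "c \<notin> P" "g \<in> deg_lt W v e" using cg by (auto simp: leading_def)
  have "e = 0"
  proof (rule ccontr)
    assume "e \<noteq> 0"
    let ?R = "\<lambda>p. c p * p v ^ e + g p" and ?F = "\<lambda>p. l p * p v ^ n + f p"
    \<comment> \<open>The first step of dividing the relation by the least element is done by hand,
      because \<open>pseudo_division\<close> does not disclose the leading coefficient of the
      quotient, here \<open>c ^ m * l\<close>.\<close>
    let ?f1 = "\<lambda>p. c p * f p - l p * (p v ^ (n - e) * g p)"
    have "(\<lambda>p. p v ^ (n - e) * g p) \<in> deg_lt W v n" using deg_lt_shift[OF c(3), of "n - e"] en by simp
    hence f1: "?f1 \<in> deg_lt W v n"
      by (rule deg_lt_diff[OF deg_lt_scale[OF c(1) l(3)] deg_lt_scale[OF l(1)]])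
    have f1_eq: "?f1 p = c p * ?F p - l p * p v ^ (n - e) * ?R p" for p
    proof -
      have "p v ^ n = p v ^ (n - e) * p v ^ e" using en by (simp flip: power_add)
      thus ?thesis by (simp add: algebra_simps)
    qed
    obtain m q s where mqs: "q \<in> deg_lt W v (n - e)" "s \<in> deg_lt W v e" "\<forall>p. c p ^ m * ?f1 p = q p * ?R p + s p"
      using pseudo_division[OF c(1,3) f1] by (elim exE bexE)
    let ?q = "\<lambda>p. c p ^ m * l p * p v ^ (n - e) + q p"
    have s_eq: "s = (\<lambda>p. c p ^ Suc m * ?F p - ?q p * ?R p)"
    proof
      fix p
      have "s p = c p ^ m * ?f1 p - q p * ?R p" using mqs(3) by simp
      thus "s p = c p ^ Suc m * ?F p - ?q p * ?R p" unfolding f1_eq by (simp add: algebra_simps)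
    qed
    have cF: "(\<lambda>p. c p ^ Suc m * ?F p) \<in> P" by (rule mult[OF lead(2) polyfun_power[OF upW[OF c(1)]]])
    have q_lead: "leading W v (\<lambda>p. c p ^ m * l p) q (n - e)"
      unfolding leading_def
      using mqs(1) c(1) l(1) prime[OF polyfun_power[OF upW[OF c(1)], of m] upW[OF l(1)]] l(2)
        power_notin[OF upW[OF c(1)] c(2)]
      by (intro conjI polyfun.mult polyfun_power) auto
    have qW: "?q \<in> polyfun ?W"
      by (rule deg_lt_polyfun[OF leading_deg_lt[OF q_lead]])
    have "Q s" unfolding s_eq by (rule Q_diff[OF Q_P[OF cF] Q_mult[OF qW Qc]])
    \<comment> \<open>The remainder \<open>s\<close> has degree below \<open>e\<close>, so
      minimality puts it in \<open>P\<close>. Then the product of the quotient and \<open>?R\<close>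
      is in \<open>P\<close>, hence the quotient is: a relation of degree \<open>n - e\<close>,
      which is less than \<open>n\<close>.\<close>
    hence "s \<in> P" using R_from[OF mqs(2)] e_min by blast
    from diff[OF cF this] have "(\<lambda>p. ?q p * ?R p) \<in> P" by (simp add: s_eq)
    moreover have "?R \<in> polyfun V" by (rule up[OF deg_lt_polyfun[OF leading_deg_lt[OF cg]]])
    ultimately have "?q \<in> P" using prime[OF up[OF qW], of ?R] nP by blast
    moreover have "n - e < n" using \<open>e \<noteq> 0\<close> en by simp
    ultimately show False using least[OF _ q_lead] by blast
  qed
  have "(\<lambda>p. c p * p v ^ e + g p) = c" using deg_lt_0[of g W v] c(3) \<open>e = 0\<close> by (intro ext) simp
  hence "Q c" using Qc by simp
  thus ?thesis using c unfolding Q_def by blast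
qed

end

section \<open>Zeros of prime ideals over an algebraically closed field\<close>

locale prime_polyideal_ac = prime_polyideal V P
  for V :: "'v set" and P :: "(('v \<Rightarrow> 'a::alg_closed_field) \<Rightarrow> 'a) set" +
  assumes infinite_field: "infinite (UNIV :: 'a set)"
begin

text \<open>Zeros of the elimination ideal \<open>P \<inter> polyfun W\<close>; coordinates outside
  \<open>W\<close> are unconstrained.\<close>

definition zeros :: "'v set \<Rightarrow> ('v \<Rightarrow> 'a) set" where
  "zeros W = {p. \<forall>f\<in>P \<inter> polyfun W. f p = 0}"

lemma zerosD: "p \<in> zeros W \<Longrightarrow> f \<in> P \<Longrightarrow> f \<in> polyfun W \<Longrightarrow> f p = 0"
  unfolding zeros_def by simp

text \<open>If \<open>v\<close> is transcendental modulo \<open>P\<close>, elements of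
  \<open>P\<close> have their coefficients in \<open>P\<close>, so every value of \<open>v\<close>
  extends \<open>a\<close>, and \<open>h\<close> is a coefficient of \<open>b\<close>. Otherwise
  \<open>v\<close> is sent to a root of the relation of least degree, and \<open>h\<close> is its
  leading coefficient times a function free of \<open>v\<close> that is congruent to a multiple of
  \<open>b\<close>.\<close>

lemma extend_zero_coord:
  assumes W: "insert v W \<subseteq> V" "v \<notin> W" and b: "b \<in> polyfun (insert v W)" "b \<notin> P"
  shows "\<exists>h\<in>polyfun W. h \<notin> P \<and> (\<forall>a\<in>zeros W. h a \<noteq> 0 \<longrightarrow> (\<exists>\<xi>. a(v := \<xi>) \<in> zeros (insert v W) \<and> b (a(v := \<xi>)) \<noteq> 0))"
proof (cases "\<exists>n l f. leading W v l f n \<and> (\<lambda>p. l p * p v ^ n + f p) \<in> P")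
  case False
  have coeffs: "coeffs_in W v k f" if "f \<in> deg_lt W v k" "f \<in> P" for f k
    by (rule coeffs_in_if_no_leading[OF W(1) _ that]) (use False in blast)
  obtain k where "b \<in> deg_lt W v k" using polyfun_deg_lt[OF b(1)] by (elim exE)
  then obtain g where g: "\<forall>i. g i \<in> polyfun W" "b = (\<lambda>p. \<Sum>i<k. g i p * p v ^ i)"
    unfolding deg_lt_def by blast
  have "\<exists>i<k. g i \<notin> P"
  proof (rule ccontr)
    assume no: "\<not> ?thesis"
    have "(\<lambda>p. \<Sum>i\<in>I. g i p * p v ^ i) \<in> P" if "finite I" "\<forall>i\<in>I. i < k" for I
      using that
    proof (induction I rule: finite_induct)
      case (insert i I)
      have "(\<lambda>p. p v ^ i) \<in> polyfun V" by (rule polyfun_power[OF polyfun.coord]) (use W in auto)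
      from mult[OF _ this, of "g i"] no insert have "(\<lambda>p. p v ^ i * g i p) \<in> P" by auto
      from add[OF this insert.IH] insert show ?case by (simp add: mult.commute)
    qed (simp add: zero)
    from this[of "{..<k}"] b(2) g(2) show False by simp
  qed
  then obtain i where i: "i < k" "g i \<notin> P" by blast
  have "\<exists>\<xi>. a(v := \<xi>) \<in> zeros (insert v W) \<and> b (a(v := \<xi>)) \<noteq> 0" if a: "a \<in> zeros W" "g i a \<noteq> 0" for a
  proof -
    \<comment> \<open>\<open>b\<close> over the fixed point \<open>a\<close>, as a polynomial in the
      value of \<open>v\<close>; it is nonzero because its \<open>i\<close>-th coefficient is
      \<open>g i a\<close>.\<close>
    define U where "U = (\<Sum>j<k. Polynomial.monom (g j a) j)"
    have "Polynomial.coeff U i = g i a" unfolding U_def coeff_sum using i(1) by simp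
    hence "U \<noteq> 0" using a(2) by auto
    hence "finite {t. poly U t = 0}" by (rule poly_roots_finite)
    then obtain \<xi> where \<xi>: "poly U \<xi> \<noteq> 0" using infinite_field by (metis (mono_tags) ex_new_if_finite mem_Collect_eq)
    have "b (a(v := \<xi>)) = poly U \<xi>"
    proof -
      have "g j (a(v := \<xi>)) = g j a" for j
        by (rule polyfun_cong[OF spec[OF g(1)]]) (use W(2) in auto)
      thus ?thesis by (simp add: g(2) U_def poly_sum poly_monom)
    qed
    moreover have "a(v := \<xi>) \<in> zeros (insert v W)"
      unfolding zeros_def
    proof (intro CollectI ballI)
      fix f assume f: "f \<in> P \<inter> polyfun (insert v W)"
      obtain k where "f \<in> deg_lt W v k" using polyfun_deg_lt[of f] f by auto
      from coeffs[OF this] f have "coeffs_in W v k f" by auto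
      thus "f (a(v := \<xi>)) = 0"
        by (rule coeffs_in_vanish[of _ _ _ _ a]) (use a(1) W(2) in \<open>auto simp: zeros_def\<close>)
    qed
    ultimately show ?thesis using \<xi> by (intro exI[of _ \<xi>]) simp
  qed
  thus ?thesis using i(2) g(1) by (intro bexI[of _ "g i"]) auto
next
  case True
  define R where "R n \<longleftrightarrow> (\<exists>l f. leading W v l f n \<and> (\<lambda>p. l p * p v ^ n + f p) \<in> P)" for n
  define n where "n = (LEAST n. R n)"
  have Rn: "R n" unfolding n_def using True by (intro LeastI_ex[of R]) (simp add: R_def)
  have n_min: "\<not> R i" if "i < n" for i using that not_less_Least[of i R] by (simp add: n_def)
  obtain l f where lead: "leading W v l f n" and F: "(\<lambda>p. l p * p v ^ n + f p) \<in> P" (is "?F \<in> P")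
    using Rn unfolding R_def by (elim exE conjE)
  have least: "(\<lambda>p. c p * p v ^ i + g p) \<notin> P" if "i < n" "leading W v c g i" for i c g
    using n_min[OF that(1)] that(2) unfolding R_def by blast
  have l: "l \<in> polyfun W" "l \<notin> P" "f \<in> deg_lt W v n" using lead by (auto simp: leading_def)
  have "n \<noteq> 0"
  proof
    assume "n = 0"
    hence "?F = l" using deg_lt_0[of f W v] l(3) by (intro ext) simp
    thus False using F l(2) by simp
  qed
  obtain h q where h: "h \<in> polyfun W" "h \<notin> P" and q: "q \<in> polyfun (insert v W)" "(\<lambda>p. h p - q p * b p) \<in> P"
    using multiple_without_coord[OF W(1) lead F least b] by blast
  have upW: "g \<in> polyfun V" if "g \<in> polyfun W" for g by (rule polyfun_mono[OF that]) (use W in auto)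
  have "(\<lambda>p. l p * h p) \<notin> P" using prime[OF upW[OF l(1)] upW[OF h(1)]] l(2) h(2) by blast
  moreover have "\<exists>\<xi>. a(v := \<xi>) \<in> zeros (insert v W) \<and> b (a(v := \<xi>)) \<noteq> 0"
    if a: "a \<in> zeros W" "l a * h a \<noteq> 0" for a
  proof -
    obtain g where g: "\<forall>i. g i \<in> polyfun W" "f = (\<lambda>p. \<Sum>i<n. g i p * p v ^ i)"
      using l(3) unfolding deg_lt_def by blast
    have Wa: "g' (a(v := \<xi>)) = g' a" if "g' \<in> polyfun W" for g' \<xi>
      by (rule polyfun_cong[OF that]) (use W(2) in auto)
    \<comment> \<open>The least relation specialised at \<open>a\<close>;
      \<open>l a \<noteq> 0\<close> keeps its degree \<open>n > 0\<close>, so it has a root.\<close>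
    have "\<exists>\<xi>. (\<Sum>i\<le>n. (if i = n then l a else g i a) * \<xi> ^ i) = 0"
      by (rule alg_closed) (use \<open>n \<noteq> 0\<close> a(2) in auto)
    then obtain \<xi> where \<xi>: "(\<Sum>i\<le>n. (if i = n then l a else g i a) * \<xi> ^ i) = 0" by blast
    have F0: "?F (a(v := \<xi>)) = 0"
    proof -
      have "?F (a(v := \<xi>)) = l a * \<xi> ^ n + (\<Sum>i<n. g i a * \<xi> ^ i)"
        using Wa[OF l(1)] Wa[OF spec[OF g(1)]] by (simp add: g(2))
      moreover have "l a * \<xi> ^ n + (\<Sum>i<n. g i a * \<xi> ^ i) = 0"
        using \<xi> by (simp add: lessThan_Suc_atMost[symmetric] add.commute)
      ultimately show ?thesis by (rule trans)
    qed
    \<comment> \<open>Dividing an element of \<open>P\<close> by the relation leaves a remainder in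
      \<open>P\<close> of degree below \<open>n\<close>. By minimality its coefficients are in
      \<open>P\<close>, so it vanishes over \<open>a\<close>.\<close>
    have Z: "a(v := \<xi>) \<in> zeros (insert v W)"
      unfolding zeros_def
    proof (intro CollectI ballI)
      fix g' assume g': "g' \<in> P \<inter> polyfun (insert v W)"
      obtain k where k: "g' \<in> deg_lt W v k" using polyfun_deg_lt[of g'] g' by auto
      obtain m q' r where mqr: "q' \<in> deg_lt W v (k - n)" "r \<in> deg_lt W v n"
          "\<forall>p. l p ^ m * g' p = q' p * ?F p + r p"
        using pseudo_division[OF l(1,3) k] by (elim exE bexE)
      have q'V: "q' \<in> polyfun V" by (rule polyfun_mono[OF deg_lt_polyfun[OF mqr(1)] W(1)])
      have "(\<lambda>p. l p ^ m * g' p - q' p * ?F p) \<in> P"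
        by (rule diff[OF mult[OF _ polyfun_power[OF upW[OF l(1)]]] mult[OF F q'V]]) (use g' in auto)
      hence "r \<in> P" using mqr(3) by simp
      have "coeffs_in W v n r" by (rule coeffs_in_if_no_leading[OF W(1) least mqr(2) \<open>r \<in> P\<close>])
      hence "r (a(v := \<xi>)) = 0"
        by (rule coeffs_in_vanish[of _ _ _ _ a]) (use a(1) W(2) in \<open>auto simp: zeros_def\<close>)
      hence "l (a(v := \<xi>)) ^ m * g' (a(v := \<xi>)) = 0" using F0 spec[OF mqr(3), of "a(v := \<xi>)"] by simp
      thus "g' (a(v := \<xi>)) = 0" using a(2) Wa[OF l(1)] by simp
    qed
    have "(\<lambda>p. h p - q p * b p) \<in> polyfun (insert v W)"
      by (intro polyfun_diff polyfun.mult q(1) b(1) polyfun_mono[OF h(1)]) auto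
    from zerosD[OF Z q(2) this] have "h (a(v := \<xi>)) - q (a(v := \<xi>)) * b (a(v := \<xi>)) = 0" .
    hence "b (a(v := \<xi>)) \<noteq> 0" using a(2) Wa[OF h(1)] by auto
    with Z show ?thesis by blast
  qed
  ultimately show ?thesis using polyfun.mult[OF l(1) h(1)] by (intro bexI[of _ "\<lambda>p. l p * h p"]) auto
qed

text \<open>The projection of the zero set contains the open part \<open>h \<noteq> 0\<close> of
  \<open>zeros J\<close>: the nonvanishing condition produced by removing one coordinate is the one
  imposed when removing the next.\<close>

lemma extend_zero:
  assumes "finite K" "J \<union> K \<subseteq> V" "J \<inter> K = {}" "b \<in> polyfun (J \<union> K)" "b \<notin> P"
  shows "\<exists>h\<in>polyfun J. h \<notin> P \<and> (\<forall>a\<in>zeros J. h a \<noteq> 0 \<longrightarrow>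
    (\<exists>p\<in>zeros (J \<union> K). (\<forall>v\<in>J. p v = a v) \<and> b p \<noteq> 0))"
  using assms
proof (induction K arbitrary: b rule: finite_induct)
  case empty
  thus ?case by (intro bexI[of _ b]) auto
next
  case (insert v K)
  have eq: "J \<union> insert v K = insert v (J \<union> K)" by auto
  have "\<exists>h\<in>polyfun (J \<union> K). h \<notin> P \<and> (\<forall>a\<in>zeros (J \<union> K). h a \<noteq> 0 \<longrightarrow>
      (\<exists>\<xi>. a(v := \<xi>) \<in> zeros (insert v (J \<union> K)) \<and> b (a(v := \<xi>)) \<noteq> 0))"
    by (rule extend_zero_coord) (use insert.prems insert.hyps in \<open>auto simp: eq\<close>)
  then obtain h1 where h1: "h1 \<in> polyfun (J \<union> K)" "h1 \<notin> P"
    "\<forall>a\<in>zeros (J \<union> K). h1 a \<noteq> 0 \<longrightarrow> (\<exists>\<xi>. a(v := \<xi>) \<in> zeros (insert v (J \<union> K)) \<and> b (a(v := \<xi>)) \<noteq> 0)"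
    by (elim bexE conjE)
  have "\<exists>h\<in>polyfun J. h \<notin> P \<and> (\<forall>a\<in>zeros J. h a \<noteq> 0 \<longrightarrow>
    (\<exists>p\<in>zeros (J \<union> K). (\<forall>v\<in>J. p v = a v) \<and> h1 p \<noteq> 0))"
    by (rule insert.IH) (use insert.prems h1 in auto)
  then obtain h where h: "h \<in> polyfun J" "h \<notin> P"
    "\<forall>a\<in>zeros J. h a \<noteq> 0 \<longrightarrow> (\<exists>p\<in>zeros (J \<union> K). (\<forall>v\<in>J. p v = a v) \<and> h1 p \<noteq> 0)"
    by (elim bexE conjE)
  have "\<exists>p\<in>zeros (J \<union> insert v K). (\<forall>v\<in>J. p v = a v) \<and> b p \<noteq> 0" if a: "a \<in> zeros J" "h a \<noteq> 0" for a
  proof -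
    obtain p where p: "p \<in> zeros (J \<union> K)" "\<forall>v\<in>J. p v = a v" "h1 p \<noteq> 0" using h(3) a by blast
    obtain \<xi> where \<xi>: "p(v := \<xi>) \<in> zeros (insert v (J \<union> K))" "b (p(v := \<xi>)) \<noteq> 0" using h1(3) p by blast
    have "\<forall>u\<in>J. (p(v := \<xi>)) u = a u" using p(2) insert.prems(2) by auto
    with \<xi> show ?thesis unfolding eq by blast
  qed
  with h(1,2) show ?case by (intro bexI[of _ h]) auto
qed

lemma zeros_empty: "zeros {} = UNIV"
proof -
  have "f a = 0" if f: "f \<in> P" "f \<in> polyfun {}" for f a
  proof (rule ccontr)
    assume "f a \<noteq> 0"
    have "f p = f a" for p by (rule polyfun_cong[OF f(2)]) simp
    hence "(\<lambda>p. 1 / f a * f p) = (\<lambda>p. 1)" using \<open>f a \<noteq> 0\<close> by (intro ext) simp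
    with mult[OF f(1) polyfun.const[of "1 / f a"]] one show False by simp
  qed
  thus ?thesis unfolding zeros_def by auto
qed

lemma zero_in_pts:
  assumes "p \<in> zeros V"
  shows "(\<lambda>v. if v \<in> V then p v else 0) \<in> pts V \<inter> zeros V"
    and "f \<in> polyfun V \<Longrightarrow> f (\<lambda>v. if v \<in> V then p v else 0) = f p"
proof -
  show eq: "f (\<lambda>v. if v \<in> V then p v else 0) = f p" if "f \<in> polyfun V" for f
    by (rule polyfun_cong[OF that]) simp
  show "(\<lambda>v. if v \<in> V then p v else 0) \<in> pts V \<inter> zeros V"
  proof
    show "(\<lambda>v. if v \<in> V then p v else 0) \<in> zeros V"
      unfolding zeros_def
    proof (rule CollectI, rule ballI)
      fix f assume f: "f \<in> P \<inter> polyfun V"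
      show "f (\<lambda>v. if v \<in> V then p v else 0) = 0"
        by (rule trans[OF eq zerosD[OF assms]]) (use f in auto)
    qed
  qed (simp add: pts_def)
qed

text \<open>Extension from no coordinates at all: there \<open>h\<close> is a constant outside
  \<open>P\<close>, hence nonzero, and every point may serve as \<open>a\<close>.\<close>

lemma nullstellensatz:
  assumes "finite V" "b \<in> polyfun V" "b \<notin> P"
  shows "\<exists>p\<in>pts V \<inter> zeros V. b p \<noteq> 0"
proof -
  have "\<exists>h\<in>polyfun {}. h \<notin> P \<and> (\<forall>a\<in>zeros {}. h a \<noteq> 0 \<longrightarrow>
    (\<exists>p\<in>zeros ({} \<union> V). (\<forall>v\<in>{}. p v = a v) \<and> b p \<noteq> 0))"
    by (rule extend_zero) (use assms in auto)
  then obtain h where h: "h \<notin> P" "\<forall>a\<in>zeros {}. h a \<noteq> 0 \<longrightarrow>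
    (\<exists>p\<in>zeros ({} \<union> V). (\<forall>v\<in>{}. p v = a v) \<and> b p \<noteq> 0)" by (elim bexE conjE)
  have "\<exists>a. h a \<noteq> 0"
  proof (rule ccontr)
    assume "\<not> ?thesis"
    hence "h = (\<lambda>p. 0)" by (intro ext) simp
    thus False using h(1) zero by simp
  qed
  then obtain p where p: "p \<in> zeros V" "b p \<noteq> 0" using h(2) zeros_empty by auto
  have "b (\<lambda>v. if v \<in> V then p v else 0) \<noteq> 0" using zero_in_pts(2)[OF p(1) assms(2)] p(2) by (rule ssubst)
  thus ?thesis by (rule bexI[OF _ zero_in_pts(1)[OF p(1)]])
qed

text \<open>The hypothesis makes \<open>zeros J\<close> the whole space, so every \<open>a\<close>
  with \<open>h a \<noteq> 0\<close> lifts to a zero of \<open>P\<close>. If \<open>c\<close> is the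
  \<open>j\<close>-th entry of one such point, \<open>h\<close> stays nonzero on the hyperplane, and
  the projection of the section contains a nonempty open subset of it.\<close>

lemma hyperplane_section:
  assumes V: "finite V" and J: "J \<subseteq> V" "j \<in> J"
    and ind: "\<And>f p. f \<in> P \<Longrightarrow> f \<in> polyfun J \<Longrightarrow> f p = 0"
  shows "\<exists>c. indep (J - {j}) {p \<in> pts V \<inter> zeros V. p j = c}"
proof -
  have "\<exists>h\<in>polyfun J. h \<notin> P \<and> (\<forall>a\<in>zeros J. h a \<noteq> 0 \<longrightarrow>
    (\<exists>p\<in>zeros (J \<union> (V - J)). (\<forall>v\<in>J. p v = a v) \<and> 1 \<noteq> (0 :: 'a)))"
    by (rule extend_zero[where b="\<lambda>p. 1"]) (use V J one in \<open>auto intro: polyfun.const\<close>)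
  then obtain h where h: "h \<in> polyfun J" "h \<notin> P" "\<forall>a\<in>zeros J. h a \<noteq> 0 \<longrightarrow>
    (\<exists>p\<in>zeros (J \<union> (V - J)). (\<forall>v\<in>J. p v = a v) \<and> 1 \<noteq> (0 :: 'a))" by (elim bexE conjE)
  have JV: "J \<union> (V - J) = V" using J by blast
  have zJ: "zeros J = UNIV" using ind unfolding zeros_def by auto
  have "\<exists>a. h a \<noteq> 0"
  proof (rule ccontr)
    assume "\<not> ?thesis"
    hence "h = (\<lambda>p. 0)" by (intro ext) simp
    thus False using h(2) zero by simp
  qed
  then obtain a0 where a0: "h a0 \<noteq> 0" ..
  have "indep (J - {j}) {p \<in> pts V \<inter> zeros V. p j = a0 j}"
    unfolding indep_def
  proof (rule ballI, rule impI)
    fix f assume f: "f \<in> polyfun (J - {j})" and van: "\<forall>p\<in>{p \<in> pts V \<inter> zeros V. p j = a0 j}. f p = 0"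
    let ?h = "\<lambda>p. h (p(j := a0 j))"
    have hJ: "?h \<in> polyfun (J - {j})"
    proof (rule polyfun_compose[OF h(1)])
      fix v assume "v \<in> J"
      thus "(\<lambda>p. (p(j := a0 j)) v) \<in> polyfun (J - {j})"
        by (cases "v = j") (auto intro: polyfun.const polyfun.coord)
    qed
    \<comment> \<open>Unless the second factor is 0, the point \<open>p\<close>, moved to the
      hyperplane, lifts to a point of the section, where \<open>f\<close> vanishes.\<close>
    have "f p * ?h p = 0" for p
    proof (cases "?h p = 0")
      case False
      then obtain q where q: "q \<in> zeros V" "\<forall>v\<in>J. q v = (p(j := a0 j)) v"
        using h(3) zJ JV by auto
      let ?q = "\<lambda>v. if v \<in> V then q v else 0"
      have "?q \<in> {p \<in> pts V \<inter> zeros V. p j = a0 j}"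
        using zero_in_pts(1)[OF q(1)] q(2) J by auto
      hence "f ?q = 0" using van by blast
      also have "f ?q = f p"
        by (rule polyfun_cong[OF f]) (use q(2) J in auto)
      finally show ?thesis by simp
    qed simp
    hence "(\<forall>p. f p = 0) \<or> (\<forall>p. ?h p = 0)"
      by (rule polyfun_mult_eq_0[OF infinite_field f hJ])
    moreover have "?h a0 \<noteq> 0" using a0 by simp
    ultimately show "\<forall>p. f p = 0" by blast
  qed
  thus ?thesis ..
qed

end

section \<open>Closed sets, irreducible sets and chains\<close>

definition poly_closed :: "'v set \<Rightarrow> ('v \<Rightarrow> 'a::field) set \<Rightarrow> bool" where
  "poly_closed V Y \<longleftrightarrow> (\<exists>Q\<subseteq>polyfun V. Y = {p \<in> pts V. \<forall>f\<in>Q. f p = 0})"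

text \<open>Irreducibility as primality of the vanishing ideal, the form in which it is both
  produced and used; for finite \<open>V\<close> it agrees with indecomposability by
  \<open>poly_irreducible_iff\<close>.\<close>

definition poly_irreducible :: "'v set \<Rightarrow> ('v \<Rightarrow> 'a::field) set \<Rightarrow> bool" where
  "poly_irreducible V Y \<longleftrightarrow> poly_closed V Y \<and> Y \<noteq> {} \<and> (\<forall>g\<in>polyfun V. \<forall>h\<in>polyfun V.
     (\<forall>p\<in>Y. g p * h p = 0) \<longrightarrow> (\<forall>p\<in>Y. g p = 0) \<or> (\<forall>p\<in>Y. h p = 0))"

lemma poly_closed_Int:
  assumes "poly_closed V A" "poly_closed V B" shows "poly_closed V (A \<inter> B)"
proof -
  obtain Q R where "Q \<subseteq> polyfun V" "A = {p \<in> pts V. \<forall>f\<in>Q. f p = 0}"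
     "R \<subseteq> polyfun V" "B = {p \<in> pts V. \<forall>f\<in>R. f p = 0}" using assms unfolding poly_closed_def by blast
  thus ?thesis unfolding poly_closed_def by (intro exI[of _ "Q \<union> R"]) auto
qed

lemma poly_closed_zero_set:
  assumes "f \<in> polyfun V" shows "poly_closed V {p \<in> pts V. f p = 0}"
  unfolding poly_closed_def by (rule exI[of _ "{f}"]) (use assms in simp)

lemma poly_closed_separate:
  assumes "poly_closed V Y" "p \<in> pts V" "p \<notin> Y"
  shows "\<exists>f\<in>polyfun V. (\<forall>q\<in>Y. f q = 0) \<and> f p \<noteq> 0"
  using assms unfolding poly_closed_def by blast

text \<open>Zorn's lemma gives an ideal maximal among those meeting \<open>polyfun J\<close> trivially; it is prime.\<close>

lemma prime_avoiding_exists: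
  fixes Y :: "('v \<Rightarrow> 'a::alg_closed_field) set"
  assumes inf: "infinite (UNIV :: 'a set)" and J: "J \<subseteq> V" "indep J Y"
  shows "\<exists>P. prime_polyideal_ac V P \<and> (\<forall>f\<in>polyfun V. (\<forall>p\<in>Y. f p = 0) \<longrightarrow> f \<in> P) \<and>
    (\<forall>f\<in>P. f \<in> polyfun J \<longrightarrow> (\<forall>p. f p = 0))"
proof -
  define A where "A = {P. P \<subseteq> polyfun V \<and> (\<forall>f\<in>polyfun V. (\<forall>p\<in>Y. f p = 0) \<longrightarrow> f \<in> P) \<and>
    (\<forall>f\<in>P. \<forall>g\<in>P. (\<lambda>p. f p + g p) \<in> P) \<and> (\<forall>f\<in>P. \<forall>g\<in>polyfun V. (\<lambda>p. g p * f p) \<in> P) \<and>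
    (\<forall>f\<in>P. f \<in> polyfun J \<longrightarrow> (\<forall>p. f p = 0))}"
  have "{f \<in> polyfun V. \<forall>p\<in>Y. f p = 0} \<in> A"
    using J(2) unfolding A_def indep_def by (auto intro: polyfun.add polyfun.mult)
  hence "A \<noteq> {}" by blast
  moreover have "\<Union>C \<in> A" if C: "C \<noteq> {}" "subset.chain A C" for C
  proof -
    have CA: "C \<subseteq> A" using C(2) by (simp add: subset_chain_def)
    have lin: "P \<subseteq> Q \<or> Q \<subseteq> P" if "P \<in> C" "Q \<in> C" for P Q
      using C(2) that by (auto simp: subset_chain_def)
    have "(\<lambda>p. f p + g p) \<in> \<Union>C" if fg: "f \<in> \<Union>C" "g \<in> \<Union>C" for f g
    proof -
      obtain P Q where PQ: "P \<in> C" "f \<in> P" "Q \<in> C" "g \<in> Q" using fg by blast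
      then obtain R where "R \<in> C" "f \<in> R" "g \<in> R" using lin[of P Q] by blast
      moreover have "R \<in> A" using \<open>R \<in> C\<close> CA by blast
      ultimately show ?thesis unfolding A_def by blast
    qed
    moreover have "\<Union>C \<subseteq> polyfun V" using CA unfolding A_def by blast
    moreover have "\<forall>f\<in>polyfun V. (\<forall>p\<in>Y. f p = 0) \<longrightarrow> f \<in> \<Union>C" using CA C(1) unfolding A_def by blast
    moreover have "\<forall>f\<in>\<Union>C. \<forall>g\<in>polyfun V. (\<lambda>p. g p * f p) \<in> \<Union>C" using CA unfolding A_def by blast
    moreover have "\<forall>f\<in>\<Union>C. f \<in> polyfun J \<longrightarrow> (\<forall>p. f p = 0)" using CA unfolding A_def by blast
    ultimately show ?thesis unfolding A_def by blast
  qed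
  ultimately obtain P where P: "P \<in> A" and max: "\<And>Q. Q \<in> A \<Longrightarrow> P \<subseteq> Q \<Longrightarrow> Q = P"
    using subset_Zorn_nonempty[of A] by blast
  have sub: "P \<subseteq> polyfun V" and I: "\<And>f. f \<in> polyfun V \<Longrightarrow> (\<And>p. p \<in> Y \<Longrightarrow> f p = 0) \<Longrightarrow> f \<in> P"
    and add: "\<And>f g. f \<in> P \<Longrightarrow> g \<in> P \<Longrightarrow> (\<lambda>p. f p + g p) \<in> P"
    and mult: "\<And>f g. f \<in> P \<Longrightarrow> g \<in> polyfun V \<Longrightarrow> (\<lambda>p. g p * f p) \<in> P"
    and PJ: "\<And>f p. f \<in> P \<Longrightarrow> f \<in> polyfun J \<Longrightarrow> f p = 0"
    using P unfolding A_def by simp_all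
  have zero: "(\<lambda>p. 0) \<in> P" by (rule I[OF polyfun.const]) simp
  \<comment> \<open>Maximality: the ideal generated by \<open>P\<close> and an \<open>f\<close>
    outside it must contain a nonzero function of the coordinates \<open>J\<close>.\<close>
  have combine: "\<exists>m\<in>P. \<exists>q\<in>polyfun V. (\<lambda>p. m p + q p * f p) \<in> polyfun J \<and> (\<exists>p. m p + q p * f p \<noteq> 0)"
    if f: "f \<in> polyfun V" "f \<notin> P" for f
  proof (rule ccontr)
    assume no: "\<not> ?thesis"
    define Q where "Q = {g. \<exists>m\<in>P. \<exists>q\<in>polyfun V. g = (\<lambda>p. m p + q p * f p)}"
    have QI: "(\<lambda>p. m p + q p * f p) \<in> Q" if "m \<in> P" "q \<in> polyfun V" for m q
      unfolding Q_def using that by blast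
    have PQ: "g \<in> Q" if "g \<in> P" for g using QI[OF that polyfun.const[of 0]] by simp
    have "Q \<in> A" unfolding A_def
    proof (intro CollectI conjI ballI impI allI)
      show "Q \<subseteq> polyfun V" unfolding Q_def using sub f(1) by (auto intro!: polyfun.add polyfun.mult)
      show "g \<in> Q" if "g \<in> polyfun V" "\<forall>p\<in>Y. g p = 0" for g using that by (intro PQ I) auto
      show "(\<lambda>p. g p + g' p) \<in> Q" if gg: "g \<in> Q" "g' \<in> Q" for g g'
      proof -
        obtain m q m' q' where "m \<in> P" "q \<in> polyfun V" "g = (\<lambda>p. m p + q p * f p)"
          "m' \<in> P" "q' \<in> polyfun V" "g' = (\<lambda>p. m' p + q' p * f p)" using gg unfolding Q_def by blast
        thus ?thesis using QI[OF add[of m m'] polyfun.add[of q V q']] by (simp add: algebra_simps)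
      qed
      show "(\<lambda>p. g' p * g p) \<in> Q" if gg: "g \<in> Q" "g' \<in> polyfun V" for g g'
      proof -
        obtain m q where "m \<in> P" "q \<in> polyfun V" "g = (\<lambda>p. m p + q p * f p)" using gg unfolding Q_def by blast
        thus ?thesis using QI[OF mult[of m g'] polyfun.mult[of g' V q]] gg(2) by (simp add: algebra_simps)
      qed
      show "g p = 0" if gg: "g \<in> Q" "g \<in> polyfun J" for g p
      proof -
        obtain m q where mq: "m \<in> P" "q \<in> polyfun V" and g: "g = (\<lambda>p. m p + q p * f p)" using gg unfolding Q_def by blast
        have "(\<lambda>p. m p + q p * f p) \<in> polyfun J" using gg(2) g by simp
        hence "m p + q p * f p = 0" using no mq by blast
        thus ?thesis by (simp add: g)
      qed
    qed
    hence "Q = P" using max PQ by blast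
    moreover have "f \<in> Q" using QI[OF zero polyfun.const[of 1]] by simp
    ultimately show False using f(2) by simp
  qed
  have "prime_polyideal_ac V P"
  proof
    show "(\<lambda>p. 1) \<notin> P" using PJ[OF _ polyfun.const[of 1]] by fastforce
    fix f g assume f: "f \<in> polyfun V" and g: "g \<in> polyfun V" and fg: "(\<lambda>p. f p * g p) \<in> P"
    show "f \<in> P \<or> g \<in> P"
    proof (rule ccontr)
      assume "\<not> ?thesis"
      hence "f \<notin> P" "g \<notin> P" by auto
      obtain m q where 1: "m \<in> P" "q \<in> polyfun V" "(\<lambda>p. m p + q p * f p) \<in> polyfun J" "\<exists>p. m p + q p * f p \<noteq> 0"
        using combine[OF f \<open>f \<notin> P\<close>] by (elim bexE conjE)
      obtain m' q' where 2: "m' \<in> P" "q' \<in> polyfun V" "(\<lambda>p. m' p + q' p * g p) \<in> polyfun J" "\<exists>p. m' p + q' p * g p \<noteq> 0"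
        using combine[OF g \<open>g \<notin> P\<close>] by (elim bexE conjE)
      have mV: "m \<in> polyfun V" using 1(1) sub by blast
      \<comment> \<open>Expanding the product of the two functions of \<open>J\<close> shows that it
        lies in \<open>P\<close>. Hence it vanishes identically, against the domain
        property.\<close>
      have "(\<lambda>p. (m' p + q' p * g p) * m p + ((q p * f p) * m' p + (q p * q' p) * (f p * g p))) \<in> P"
        by (intro add mult[OF 1(1)] mult[OF 2(1)] mult[OF fg] polyfun.mult polyfun_mono[OF 2(3) J(1)] 1(2) 2(2) f)
      also have "(\<lambda>p. (m' p + q' p * g p) * m p + ((q p * f p) * m' p + (q p * q' p) * (f p * g p))) =
         (\<lambda>p. (m p + q p * f p) * (m' p + q' p * g p))" by (rule ext) (simp add: algebra_simps)
      finally have "(m p + q p * f p) * (m' p + q' p * g p) = 0" for p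
        using PJ polyfun.mult[OF 1(3) 2(3)] by blast
      from polyfun_mult_eq_0[OF inf 1(3) 2(3) this] 1(4) 2(4) show False by blast
    qed
  qed (use sub zero add mult inf in auto)
  thus ?thesis using I PJ by blast
qed

text \<open>\<open>Z\<close> is the zero set of a prime ideal above the vanishing ideal of
  \<open>Y\<close>. By \<open>nullstellensatz\<close> no further functions vanish on it, so
  primality and the freeness of \<open>J\<close> pass from the ideal to the set.\<close>

lemma irreducible_component_exists:
  fixes Y :: "('v \<Rightarrow> 'a::alg_closed_field) set"
  assumes inf: "infinite (UNIV :: 'a set)" and V: "finite V" and Y: "poly_closed V Y"
    and J: "J \<subseteq> V" "indep J Y"
  shows "\<exists>Z. poly_irreducible V Z \<and> Z \<subseteq> Y \<and> indep J Z \<and>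
    (\<forall>j\<in>J. \<exists>c. indep (J - {j}) {p \<in> Z. p j = c})"
proof -
  obtain P where P: "prime_polyideal_ac V P" and I: "\<forall>f\<in>polyfun V. (\<forall>p\<in>Y. f p = 0) \<longrightarrow> f \<in> P"
    and PJ: "\<forall>f\<in>P. f \<in> polyfun J \<longrightarrow> (\<forall>p. f p = 0)"
    using prime_avoiding_exists[OF inf J] by (elim exE conjE)
  interpret prime_polyideal_ac V P by (rule P)
  let ?Z = "pts V \<inter> zeros V"
  have zP: "f \<in> P" if "f \<in> polyfun V" "\<forall>p\<in>?Z. f p = 0" for f
    using nullstellensatz[OF V that(1)] that(2) by blast
  have zeros_V: "zeros V = {p. \<forall>f\<in>P. f p = 0}" using sub unfolding zeros_def by blast
  have "?Z \<noteq> {}" using nullstellensatz[OF V polyfun.const one] by blast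
  moreover have "poly_closed V ?Z"
    unfolding poly_closed_def zeros_V by (rule exI[of _ P]) (use sub in auto)
  moreover have "(\<forall>p\<in>?Z. g p = 0) \<or> (\<forall>p\<in>?Z. h p = 0)"
    if gh: "g \<in> polyfun V" "h \<in> polyfun V" "\<forall>p\<in>?Z. g p * h p = 0" for g h
    using prime[OF gh(1,2) zP[OF polyfun.mult[OF gh(1,2)] gh(3)]] zerosD[of _ V] gh(1,2) by blast
  ultimately have "poly_irreducible V ?Z" unfolding poly_irreducible_def by blast
  moreover have "?Z \<subseteq> Y"
  proof
    fix p assume p: "p \<in> ?Z"
    show "p \<in> Y"
    proof (rule ccontr)
      assume "p \<notin> Y"
      then obtain f where f: "f \<in> polyfun V" "\<forall>q\<in>Y. f q = 0" "f p \<noteq> 0"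
        using poly_closed_separate[OF Y] p by blast
      hence "f \<in> P" using I by blast
      thus False using zerosD[of p V f] p f by blast
    qed
  qed
  moreover have "indep J ?Z"
    unfolding indep_def
  proof (rule ballI, rule impI)
    fix f assume f: "f \<in> polyfun J" "\<forall>p\<in>?Z. f p = 0"
    have "f \<in> P" by (rule zP[OF polyfun_mono[OF f(1) J(1)] f(2)])
    thus "\<forall>p. f p = 0" using PJ f(1) by blast
  qed
  moreover have "\<forall>j\<in>J. \<exists>c. indep (J - {j}) {p \<in> ?Z. p j = c}"
    using hyperplane_section[OF V J(1)] PJ by blast
  ultimately show ?thesis by blast
qed

text \<open>A section \<open>p j = c\<close> of \<open>Z\<close> need not be irreducible, which is
  why the induction runs over arbitrary closed sets. The chain found inside the section is topped by
  \<open>Z\<close>; the last step is strict because \<open>p j - c\<close> cannot vanish on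
  \<open>Z\<close> while \<open>J\<close> is independent there.\<close>

lemma irreducible_chain_exists:
  fixes Y :: "('v \<Rightarrow> 'a::alg_closed_field) set"
  assumes inf: "infinite (UNIV :: 'a set)" and V: "finite V" and Y: "poly_closed V Y"
    and J: "J \<subseteq> V" "indep J Y" "card J = k"
  shows "\<exists>C. (\<forall>i\<le>k. poly_irreducible V (C i) \<and> C i \<subseteq> Y) \<and> (\<forall>i<k. C i \<subset> C (Suc i))"
  using Y J
proof (induction k arbitrary: Y J)
  case (0 Y J)
  obtain Z where "poly_irreducible V Z" "Z \<subseteq> Y"
    using irreducible_component_exists[OF inf V 0(1-3)] by (elim exE conjE)
  thus ?case by (intro exI[of _ "\<lambda>_. Z"]) simp
next
  case (Suc k Y J)
  obtain Z where Z: "poly_irreducible V Z" "Z \<subseteq> Y" "indep J Z"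
    and hyp: "\<forall>j\<in>J. \<exists>c. indep (J - {j}) {p \<in> Z. p j = c}"
    using irreducible_component_exists[OF inf V Suc.prems(1-3)] by (elim exE conjE)
  obtain j where j: "j \<in> J" using Suc.prems(4) by fastforce
  obtain c where c: "indep (J - {j}) {p \<in> Z. p j = c}" using hyp j by blast
  have xc: "(\<lambda>p. p j - c) \<in> polyfun J" by (intro polyfun_diff polyfun.coord polyfun.const j)
  have xcV: "(\<lambda>p. p j - c) \<in> polyfun V" using xc Suc.prems(2) by (rule polyfun_mono)
  have "{p \<in> Z. p j = c} = Z \<inter> {p \<in> pts V. p j - c = 0}"
    using Z(1) unfolding poly_irreducible_def poly_closed_def by auto
  hence closed: "poly_closed V {p \<in> Z. p j = c}"
    using poly_closed_Int[OF _ poly_closed_zero_set[OF xcV]] Z(1) by (simp add: poly_irreducible_def)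
  have "J - {j} \<subseteq> V" "card (J - {j}) = k" using Suc.prems(2,4) j by auto
  from Suc.IH[OF closed this(1) c this(2)] obtain C where
    C: "\<forall>i\<le>k. poly_irreducible V (C i) \<and> C i \<subseteq> {p \<in> Z. p j = c}" "\<forall>i<k. C i \<subset> C (Suc i)"
    by (elim exE conjE)
  have "{p \<in> Z. p j = c} \<noteq> Z"
  proof
    assume "{p \<in> Z. p j = c} = Z"
    hence "p j - c = 0" for p using indepD[OF Z(3) xc] by auto
    from this[of "\<lambda>_. c + 1"] show False by simp
  qed
  hence Ck: "C k \<subset> Z" using C(1) by blast
  have CY: "C i \<subseteq> Y" if "i \<le> k" for i using C(1) Z(2) that by blast
  have "\<forall>i\<le>Suc k. poly_irreducible V ((C(Suc k := Z)) i) \<and> (C(Suc k := Z)) i \<subseteq> Y"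
    using C(1) Z(1,2) CY by (simp add: le_Suc_eq)
  moreover have "\<forall>i<Suc k. (C(Suc k := Z)) i \<subset> (C(Suc k := Z)) (Suc i)"
    using C(2) Ck by (simp add: less_Suc_eq)
  ultimately show ?case by blast
qed

section \<open>Dimension of Zariski closures\<close>

lemma meval_polyfun:
  assumes "mpoly_vars f \<subseteq> V" shows "meval_with phi f \<in> polyfun V"
proof -
  have "(\<lambda>x. \<Sum>mon\<in>Poly_Mapping.keys f. phi (Poly_Mapping.lookup f mon) *
     (\<Prod>v\<in>Poly_Mapping.keys mon. x v ^ Poly_Mapping.lookup mon v)) \<in> polyfun V"
    using assms unfolding mpoly_vars_def
    by (intro polyfun_sum polyfun.mult polyfun.const polyfun_prod polyfun_power polyfun.coord) blast
  thus ?thesis by (simp add: meval_with_def[abs_def])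
qed

text \<open>Finiteness of \<open>V\<close> turns every exponent of the monomial expansion into a
  finitely supported one, so the expansion can be read as a formal polynomial.\<close>

lemma polyfun_meval:
  assumes V: "finite V" and f: "f \<in> polyfun V"
  shows "\<exists>F. mpoly_vars F \<subseteq> V \<and> f = meval F"
proof -
  obtain A c where A: "finite A" "A \<subseteq> supp_in V" "f = (\<lambda>p. \<Sum>\<alpha>\<in>A. c \<alpha> * monomial V \<alpha> p)"
    using polyfun_expansion[OF V f] by (elim exE conjE)
  let ?l = "\<lambda>m. if Poly_Mapping.lookup m \<in> A then c (Poly_Mapping.lookup m) else 0"
  have inj: "inj (Poly_Mapping.lookup :: ('a \<Rightarrow>\<^sub>0 nat) \<Rightarrow> _)" by (rule injI) (rule poly_mapping_eqI, simp)
  have fin: "finite (Poly_Mapping.lookup -` A :: ('a \<Rightarrow>\<^sub>0 nat) set)"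
    by (rule finite_vimageI[OF A(1) inj])
  have "finite {m. ?l m \<noteq> 0}" by (rule finite_subset[OF _ fin]) auto
  define F where "F = Abs_poly_mapping ?l"
  have look: "Poly_Mapping.lookup F = ?l"
    unfolding F_def by (rule lookup_Abs_poly_mapping) (rule \<open>finite {m. ?l m \<noteq> 0}\<close>)
  have keysF: "Poly_Mapping.keys F = {m. ?l m \<noteq> 0}"
    by (simp add: keys.rep_eq look)
  have keys_sub: "Poly_Mapping.keys m \<subseteq> V" if "Poly_Mapping.lookup m \<in> A" for m
    using subsetD[OF A(2) that] by (auto simp: supp_in_def in_keys_iff)
  have "mpoly_vars F \<subseteq> V"
    unfolding mpoly_vars_def keysF using keys_sub by (auto split: if_splits)
  moreover have "f p = meval F p" for p
  proof -
    have mon: "(\<Prod>v\<in>Poly_Mapping.keys m. p v ^ Poly_Mapping.lookup m v) = monomial V (Poly_Mapping.lookup m) p"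
      if "Poly_Mapping.lookup m \<in> A" for m
      unfolding monomial_def by (rule prod.mono_neutral_left) (use V keys_sub[OF that] in \<open>auto simp: in_keys_iff\<close>)
    have "meval F p = (\<Sum>m\<in>Poly_Mapping.keys F. c (Poly_Mapping.lookup m) * monomial V (Poly_Mapping.lookup m) p)"
      unfolding meval_with_def by (rule sum.cong) (auto simp: keysF look mon split: if_splits)
    also have "\<dots> = (\<Sum>m\<in>Poly_Mapping.lookup -` A. c (Poly_Mapping.lookup m) * monomial V (Poly_Mapping.lookup m) p)"
      by (rule sum.mono_neutral_left[OF fin]) (auto simp: keysF split: if_splits)
    also have "\<dots> = (\<Sum>\<alpha>\<in>A. c \<alpha> * monomial V \<alpha> p)"
    proof (rule sum.reindex_bij_betw[of Poly_Mapping.lookup "Poly_Mapping.lookup -` A" A])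
      have "\<alpha> \<in> range Poly_Mapping.lookup" if "\<alpha> \<in> A" for \<alpha>
      proof -
        have "finite {v. \<alpha> v \<noteq> 0}"
          by (rule finite_subset[OF _ V]) (use subsetD[OF A(2) that] in \<open>auto simp: supp_in_def\<close>)
        hence "Poly_Mapping.lookup (Abs_poly_mapping \<alpha>) = \<alpha>" by (rule lookup_Abs_poly_mapping)
        thus ?thesis by (metis rangeI)
      qed
      thus "bij_betw Poly_Mapping.lookup (Poly_Mapping.lookup -` A) A"
        unfolding bij_betw_def by (intro conjI inj_on_subset[OF inj]) auto
    qed
    finally show ?thesis by (simp add: A(3))
  qed
  hence "f = meval F" by (rule ext)
  ultimately show ?thesis by blast
qed

lemma zar_closed_iff:
  assumes V: "finite V" shows "zar_closed V Y \<longleftrightarrow> poly_closed V Y"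
proof
  assume "zar_closed V Y"
  then obtain Ps where Ps: "\<forall>f\<in>Ps. mpoly_vars f \<subseteq> V" "Y = {p \<in> pts V. \<forall>f\<in>Ps. meval f p = 0}"
    unfolding zar_closed_def by blast
  show "poly_closed V Y" unfolding poly_closed_def
    by (rule exI[of _ "meval ` Ps"]) (use Ps in \<open>auto intro!: meval_polyfun\<close>)
next
  assume "poly_closed V Y"
  then obtain Q where Q: "Q \<subseteq> polyfun V" "Y = {p \<in> pts V. \<forall>f\<in>Q. f p = 0}"
    unfolding poly_closed_def by blast
  have "Y = {p \<in> pts V. \<forall>f\<in>{F. mpoly_vars F \<subseteq> V \<and> meval F \<in> Q}. meval f p = 0}"
  proof -
    have "(\<forall>f\<in>{F. mpoly_vars F \<subseteq> V \<and> meval F \<in> Q}. meval f p = 0) \<longleftrightarrow> (\<forall>f\<in>Q. f p = 0)" for p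
    proof
      assume *: "\<forall>f\<in>{F. mpoly_vars F \<subseteq> V \<and> meval F \<in> Q}. meval f p = 0"
      show "\<forall>f\<in>Q. f p = 0"
      proof
        fix f assume f: "f \<in> Q"
        obtain F where F: "mpoly_vars F \<subseteq> V" "f = meval F"
          using polyfun_meval[OF V subsetD[OF Q(1) f]] by (elim exE conjE)
        thus "f p = 0" using * f by simp
      qed
    qed blast
    thus ?thesis unfolding Q(2) by simp
  qed
  thus "zar_closed V Y" unfolding zar_closed_def
    by (intro exI[of _ "{F. mpoly_vars F \<subseteq> V \<and> meval F \<in> Q}"] conjI) simp_all
qed

lemma poly_irreducible_iff:
  assumes V: "finite V" shows "zar_irreducible V Y \<longleftrightarrow> poly_irreducible V Y"
proof
  assume Y: "zar_irreducible V Y"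
  hence cl: "poly_closed V Y" and ne: "Y \<noteq> {}" using zar_closed_iff[OF V] by (auto simp: zar_irreducible_def)
  have "(\<forall>p\<in>Y. g p = 0) \<or> (\<forall>p\<in>Y. h p = 0)"
    if gh: "g \<in> polyfun V" "h \<in> polyfun V" "\<forall>p\<in>Y. g p * h p = 0" for g h
  proof -
    let ?A = "\<lambda>g. Y \<inter> {p \<in> pts V. g p = 0}"
    have "zar_closed V (?A g)" "zar_closed V (?A h)"
      using poly_closed_Int[OF cl poly_closed_zero_set] gh(1,2) zar_closed_iff[OF V] by blast+
    moreover have "Y \<subseteq> pts V" using cl unfolding poly_closed_def by blast
    hence "Y = ?A g \<union> ?A h" using gh(3) by auto
    ultimately have "Y = ?A g \<or> Y = ?A h" using Y unfolding zar_irreducible_def by blast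
    thus ?thesis by blast
  qed
  thus "poly_irreducible V Y" using cl ne unfolding poly_irreducible_def by blast
next
  assume Y: "poly_irreducible V Y"
  hence cl: "zar_closed V Y" and ne: "Y \<noteq> {}" using zar_closed_iff[OF V] by (auto simp: poly_irreducible_def)
  have "Y = A \<or> Y = B" if AB: "zar_closed V A" "zar_closed V B" "Y = A \<union> B" for A B
  proof (rule ccontr)
    assume no: "\<not> ?thesis"
    have A: "poly_closed V A" and B: "poly_closed V B" using AB(1,2) zar_closed_iff[OF V] by auto
    have pts: "Y \<subseteq> pts V" using Y unfolding poly_irreducible_def poly_closed_def by blast
    obtain a b where ab: "a \<in> Y" "a \<notin> A" "b \<in> Y" "b \<notin> B" using no AB(3) by blast
    obtain f where f: "f \<in> polyfun V" "\<forall>q\<in>A. f q = 0" "f a \<noteq> 0"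
      using poly_closed_separate[OF A, of a] ab pts by blast
    obtain g where g: "g \<in> polyfun V" "\<forall>q\<in>B. g q = 0" "g b \<noteq> 0"
      using poly_closed_separate[OF B, of b] ab pts by blast
    have "\<forall>p\<in>Y. f p * g p = 0" using f(2) g(2) AB(3) by auto
    thus False using Y f g ab unfolding poly_irreducible_def by blast
  qed
  thus "zar_irreducible V Y" using cl ne unfolding zar_irreducible_def by blast
qed

lemma zar_closure_poly_closed: "poly_closed V (zar_closure V S)"
  unfolding poly_closed_def
proof (intro exI conjI)
  let ?Q = "meval_with to_ac ` {f. mpoly_vars f \<subseteq> V \<and> (\<forall>s\<in>S. meval f s = 0)}"
  show "?Q \<subseteq> polyfun V" using meval_polyfun by blast
  show "zar_closure V S = {p \<in> pts V. \<forall>f\<in>?Q. f p = 0}" unfolding zar_closure_def by blast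
qed

lemma meval_to_ac: "meval_with to_ac f (\<lambda>v. to_ac (s v)) = to_ac (meval f s)"
  by (simp add: meval_with_def to_ac_sum to_ac_prod)

lemma embed_in_zar_closure: "s \<in> S \<Longrightarrow> S \<subseteq> pts V \<Longrightarrow> (\<lambda>v. to_ac (s v)) \<in> zar_closure V S"
  unfolding zar_closure_def by (auto simp: meval_to_ac pts_def subset_iff)

section \<open>Descent from the algebraic closure\<close>

interpretation ac: vector_space "\<lambda>(c :: 'a::field) (x :: 'a alg_closure). to_ac c * x"
  by standard (auto simp: algebra_simps)

interpretation ac_pair: vector_space_pair
  "\<lambda>(c :: 'a::field) (x :: 'a alg_closure). to_ac c * x" "(*) :: 'a \<Rightarrow> 'a \<Rightarrow> 'a"
  by standard (auto simp: algebra_simps)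

text \<open>\<open>{x}\<close> is linearly independent over the base field, so the assignment of 1
  to \<open>x\<close> extends to a linear functional.\<close>

lemma ac_functional:
  fixes x :: "'a::field alg_closure"
  assumes "x \<noteq> 0"
  shows "\<exists>\<phi>. \<phi> x = (1::'a) \<and> (\<forall>y z. \<phi> (y + z) = \<phi> y + \<phi> z) \<and> (\<forall>c y. \<phi> (to_ac c * y) = c * \<phi> y)"
proof -
  have "ac.independent {x}" using assms by simp
  from ac_pair.linear_independent_extend[OF this, of "\<lambda>_. 1"]
  obtain \<phi> where \<phi>: "Vector_Spaces.linear (\<lambda>(c :: 'a) x. to_ac c * x) (*) \<phi>" "\<phi> x = 1" by auto
  thus ?thesis by (auto simp: Vector_Spaces.linear_iff)
qed

text \<open>A polynomial over the closure vanishing on \<open>K\<close>-points yields one over \<open>K\<close> by applying a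
  \<open>K\<close>-linear functional to its coefficients.\<close>

lemma indep_zar_closure:
  fixes S :: "('v \<Rightarrow> 'a::field) set"
  assumes inf: "infinite (UNIV :: 'a set)" and J: "finite J" and S: "S \<subseteq> pts V" "indep J S"
  shows "indep J (zar_closure V S)"
  unfolding indep_def
proof (rule ballI, rule impI, rule allI, rule ccontr)
  fix f p assume f: "f \<in> polyfun J" "\<forall>p\<in>zar_closure V S. f p = 0" "f p \<noteq> 0"
  obtain A c where A: "finite A" "A \<subseteq> supp_in J" "f = (\<lambda>p. \<Sum>\<alpha>\<in>A. c \<alpha> * monomial J \<alpha> p)"
    using polyfun_expansion[OF J f(1)] by (elim exE conjE)
  have "\<exists>\<alpha>\<in>A. c \<alpha> \<noteq> 0"
  proof (rule ccontr)
    assume "\<not> ?thesis"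
    hence "f p = 0" unfolding A(3) by (intro sum.neutral) auto
    thus False using f(3) by simp
  qed
  then obtain \<alpha>0 where \<alpha>0: "\<alpha>0 \<in> A" "c \<alpha>0 \<noteq> 0" by blast
  \<comment> \<open>Normalising at a nonzero coefficient guarantees that the descended polynomial
    \<open>?g\<close> is not zero.\<close>
  obtain \<phi> where \<phi>: "\<phi> (c \<alpha>0) = 1" "\<And>y z. \<phi> (y + z) = \<phi> y + \<phi> z" "\<And>c y. \<phi> (to_ac c * y) = c * \<phi> y"
    using ac_functional[OF \<alpha>0(2)] by blast
  have \<phi>0: "\<phi> 0 = 0" using \<phi>(3)[of 0 0] by simp
  have \<phi>_sum: "\<phi> (\<Sum>i\<in>B. h i) = (\<Sum>i\<in>B. \<phi> (h i))" for B :: "('v \<Rightarrow> nat) set" and h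
    by (induction B rule: infinite_finite_induct) (simp_all add: \<phi>0 \<phi>(2))
  let ?g = "\<lambda>s. \<Sum>\<alpha>\<in>A. \<phi> (c \<alpha>) * monomial J \<alpha> s"
  have "?g \<in> polyfun J" by (intro polyfun_sum polyfun.mult polyfun.const monomial_polyfun) simp
  moreover have "?g s = 0" if s: "s \<in> S" for s
  proof -
    let ?e = "\<lambda>v. to_ac (s v)"
    \<comment> \<open>At points with coordinates in the base field the monomials are scalars, so
      \<open>\<phi>\<close> passes to the coefficients.\<close>
    have "monomial J \<alpha> ?e = to_ac (monomial J \<alpha> s)" for \<alpha> by (simp add: monomial_def to_ac_prod)
    hence "f ?e = (\<Sum>\<alpha>\<in>A. to_ac (monomial J \<alpha> s) * c \<alpha>)" by (simp add: A(3) mult.commute)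
    hence "\<phi> (f ?e) = (\<Sum>\<alpha>\<in>A. monomial J \<alpha> s * \<phi> (c \<alpha>))" by (simp only: \<phi>_sum \<phi>(3))
    hence "\<phi> (f ?e) = ?g s" by (simp only: mult.commute)
    moreover have "f ?e = 0" using f(2) embed_in_zar_closure[OF s S(1)] by blast
    ultimately show ?thesis using \<phi>0 by simp
  qed
  ultimately have "?g s = 0" for s using indepD[OF S(2)] by blast
  hence "\<phi> (c \<alpha>0) = 0"
    using monomial_independent[OF inf J A(1,2), of "\<lambda>\<alpha>. \<phi> (c \<alpha>)"] \<alpha>0(1) by blast
  thus False using \<phi>(1) by simp
qed

text \<open>The closure is cut out by the very polynomials over the base field that vanish on
  \<open>S\<close>, so a relation on \<open>S\<close> becomes, after embedding its coefficients, one
  on the closure.\<close>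

lemma indep_of_zar_closure:
  fixes S :: "('v \<Rightarrow> 'a::field) set"
  assumes J: "finite J" "J \<subseteq> V" and ind: "indep J (zar_closure V S)"
  shows "indep J S"
  unfolding indep_def
proof (rule ballI, rule impI, rule allI)
  fix f p assume f: "f \<in> polyfun J" "\<forall>s\<in>S. f s = 0"
  obtain F where F: "mpoly_vars F \<subseteq> J" "f = meval F" using polyfun_meval[OF J(1) f(1)] by (elim exE conjE)
  have "meval_with to_ac F q = 0" if "q \<in> zar_closure V S" for q
    using that F f(2) J(2) unfolding zar_closure_def by blast
  from indepD[OF ind meval_polyfun[OF F(1)] this]
  have "meval_with to_ac F (\<lambda>v. to_ac (p v)) = 0" .
  thus "f p = 0" by (simp add: meval_to_ac F(2))
qed

section \<open>Independent sets and the dimension of a closure\<close>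

text \<open>For empty \<open>S\<close> no set is independent and the maximum is unspecified; only
  the values for nonempty \<open>S\<close> carry meaning.\<close>

definition indep_dim :: "'v set \<Rightarrow> ('v \<Rightarrow> 'a::field) set \<Rightarrow> nat" where
  "indep_dim V S = Max {card J | J. J \<subseteq> V \<and> indep J S}"

lemma indep_card_set: "finite V \<Longrightarrow> finite {card J | J. J \<subseteq> V \<and> indep J S}"
  by (rule finite_subset[of _ "card ` Pow V"]) auto

lemma indep_dim_ge: "finite V \<Longrightarrow> J \<subseteq> V \<Longrightarrow> indep J S \<Longrightarrow> card J \<le> indep_dim V S"
  unfolding indep_dim_def by (rule Max_ge[OF indep_card_set]) auto

lemma indep_dim_attained:
  assumes "finite V" "S \<noteq> {}"
  shows "\<exists>J\<subseteq>V. indep J S \<and> card J = indep_dim V S"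
proof -
  have "0 \<in> {card J | J. J \<subseteq> V \<and> indep J S}"
    using assms(2) by (intro CollectI exI[of _ "{}"]) (simp add: indep_empty_iff)
  hence "indep_dim V S \<in> {card J | J. J \<subseteq> V \<and> indep J S}"
    unfolding indep_dim_def by (intro Max_in[OF indep_card_set[OF assms(1)]]) blast
  thus ?thesis by auto
qed

lemma indep_dim_le: "finite V \<Longrightarrow> S \<noteq> {} \<Longrightarrow> indep_dim V S \<le> card V"
  using indep_dim_attained by (metis card_mono)

text \<open>Each strict inclusion gains one coordinate by \<open>indep_card_step\<close>. The
  independent sets of consecutive members of the chain need not be nested; only their sizes are
  controlled.\<close>

lemma irreducible_chain_indep:
  fixes C :: "nat \<Rightarrow> ('v \<Rightarrow> 'a::field) set"
  assumes inf: "infinite (UNIV :: 'a set)" and V: "finite V"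
    and C: "\<forall>i\<le>k. poly_irreducible V (C i)" "\<forall>i<k. C i \<subset> C (Suc i)"
  shows "\<exists>J\<subseteq>V. card J = k \<and> indep J (C k)"
  using C
proof (induction k)
  case 0
  hence "C 0 \<noteq> {}" by (simp add: poly_irreducible_def)
  thus ?case by (intro exI[of _ "{}"]) (simp add: indep_empty_iff)
next
  case (Suc k)
  then obtain J where J: "J \<subseteq> V" "card J = k" "indep J (C k)" by auto
  have irr: "poly_irreducible V (C k)" "poly_irreducible V (C (Suc k))" and sub: "C k \<subset> C (Suc k)"
    using Suc.prems by auto
  then obtain p where p: "p \<in> C (Suc k)" "p \<notin> C k" by blast
  have "p \<in> pts V" using p(1) irr(2) unfolding poly_irreducible_def poly_closed_def by blast
  then obtain f where f: "f \<in> polyfun V" "\<forall>q\<in>C k. f q = 0" "f p \<noteq> 0"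
    using poly_closed_separate[of V "C k" p] irr(1) p(2) unfolding poly_irreducible_def by blast
  have "\<exists>I\<subseteq>V. card I = Suc (card J) \<and> indep I (C (Suc k))"
  proof (rule indep_card_step[OF inf V J(1,3) f(1)])
    show "f q = 0" if "q \<in> C k" for q using f(2) that by blast
    show "C k \<subseteq> C (Suc k)" using sub by blast
    show "(\<forall>p\<in>C (Suc k). g p = 0) \<or> (\<forall>p\<in>C (Suc k). h p = 0)"
      if "g \<in> polyfun V" "h \<in> polyfun V" "\<And>p. p \<in> C (Suc k) \<Longrightarrow> g p * h p = 0" for g h
      using that irr(2) unfolding poly_irreducible_def by blast
  qed (rule p(1) f(3))+
  thus ?case using J(2) by simp
qed

text \<open>Independence is tested on \<open>S\<close> over the base field, while chains consist of
  sets over the algebraic closure; \<open>indep_zar_closure\<close> and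
  \<open>indep_of_zar_closure\<close> give the passage in either direction.\<close>

lemma alg_dim_zar_closure:
  fixes S :: "('v \<Rightarrow> 'a::field) set"
  assumes inf: "infinite (UNIV :: 'a set)" and V: "finite V" and S: "S \<subseteq> pts V" "S \<noteq> {}"
  shows "alg_dim V (zar_closure V S) = enat (indep_dim V S)"
proof -
  have infL: "infinite (UNIV :: 'a alg_closure set)"
    using inf finite_imageD[OF _ inj_to_ac] finite_subset[OF subset_UNIV] by blast
  let ?Y = "zar_closure V S"
  let ?K = "{enat k | k. \<exists>C :: nat \<Rightarrow> ('v \<Rightarrow> 'a alg_closure) set.
      (\<forall>i\<le>k. zar_irreducible V (C i) \<and> C i \<subseteq> ?Y) \<and> (\<forall>i<k. C i \<subset> C (Suc i))}"
  obtain J where J: "J \<subseteq> V" "indep J S" "card J = indep_dim V S"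
    using indep_dim_attained[OF V S(2)] by blast
  have "\<exists>C. (\<forall>i\<le>indep_dim V S. poly_irreducible V (C i) \<and> C i \<subseteq> ?Y) \<and> (\<forall>i<indep_dim V S. C i \<subset> C (Suc i))"
    by (rule irreducible_chain_exists[OF infL V zar_closure_poly_closed J(1)
          indep_zar_closure[OF inf finite_subset[OF J(1) V] S(1) J(2)] J(3)])
  hence "enat (indep_dim V S) \<in> ?K" unfolding poly_irreducible_iff[OF V] by blast
  moreover have "x \<le> enat (indep_dim V S)" if x: "x \<in> ?K" for x
  proof -
    obtain k C where k: "x = enat k" "\<forall>i\<le>k. poly_irreducible V (C i) \<and> C i \<subseteq> ?Y" "\<forall>i<k. C i \<subset> C (Suc i)"
      using x unfolding poly_irreducible_iff[OF V] by blast
    obtain I where I: "I \<subseteq> V" "card I = k" "indep I (C k)"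
      using irreducible_chain_indep[OF infL V _ k(3)] k(2) by blast
    have "indep I ?Y" using indep_mono[OF I(3) order_refl] k(2) by blast
    hence "indep I S" by (rule indep_of_zar_closure[OF finite_subset[OF I(1) V] I(1)])
    thus ?thesis using indep_dim_ge[OF V I(1)] I(2) k(1) by simp
  qed
  ultimately show ?thesis unfolding alg_dim_def by (intro antisym Sup_least Sup_upper)
qed

lemma alg_codim_zar_closure:
  fixes S :: "('v \<Rightarrow> 'a::field) set"
  assumes inf: "infinite (UNIV :: 'a set)" and V: "finite V" and S: "S \<subseteq> pts V"
  shows "alg_codim V (zar_closure V S) = (if S = {} then \<infinity> else enat (card V - indep_dim V S))"
proof (cases "S = {}")
  case True
  have "zar_closure V S = {}"
  proof -
    have "p \<notin> zar_closure V S" for p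
    proof
      assume "p \<in> zar_closure V S"
      hence "indep {} (zar_closure V S)" by (auto simp: indep_empty_iff)
      from indep_of_zar_closure[OF _ _ this] True show False by (simp add: indep_empty_iff)
    qed
    thus ?thesis by blast
  qed
  thus ?thesis using True by (simp add: alg_codim_def)
next
  case False
  then obtain s where "s \<in> S" by blast
  hence "zar_closure V S \<noteq> {}" using embed_in_zar_closure[OF _ S] by blast
  thus ?thesis using False by (simp add: alg_codim_def alg_dim_zar_closure[OF inf V S False])
qed

section \<open>Kernels of a multilinear map\<close>

text \<open>The columns of \<open>G\<close> are the \<open>g j\<close>. Those indexed by
  \<open>R\<close> form a basis of the column space, and \<open>T\<close> is the complement of
  \<open>R\<close>: entries at \<open>T\<close> are prescribed, those at \<open>R\<close> are solved
  for. The last clause is linear independence of the columns in \<open>R\<close>, in the form that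
  elimination uses.\<close>

lemma kernel_coordinates:
  fixes g :: "nat \<Rightarrow> nat \<Rightarrow> 'a::field" and N m :: nat
  assumes G: "\<And>x. x \<in> vecs N \<Longrightarrow> G x = (\<lambda>k. \<Sum>j<N. x j * g j k)"
    and g: "\<And>j. j < N \<Longrightarrow> g j \<in> vecs m"
  shows "\<exists>T\<subseteq>{..<N}. lin_rank N G \<le> min N m \<and> card T = N - lin_rank N G \<and>
    (\<forall>y. \<exists>x\<in>vecs N. G x = (\<lambda>_. 0) \<and> (\<forall>t\<in>T. x t = y t)) \<and>
    (\<forall>x. (\<forall>k<m. (\<Sum>j\<in>{..<N} - T. g j k * x j) = 0) \<longrightarrow> (\<forall>j\<in>{..<N} - T. x j = 0))"
proof -
  obtain B where B: "B \<subseteq> g ` {..<N}" "fs.independent B" "g ` {..<N} \<subseteq> fs.span B"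
    using fs.maximal_independent_subset[of "g ` {..<N}"] by blast
  obtain R where R: "R \<subseteq> {..<N}" "inj_on g R" "B = g ` R"
    using B(1) by (auto simp: subset_image_inj)
  have finR: "finite R" using R(1) finite_subset by blast
  have image: "G ` vecs N \<subseteq> fs.span (g ` {..<N})"
  proof
    fix y assume "y \<in> G ` vecs N"
    then obtain x where "x \<in> vecs N" "y = G x" by blast
    hence "y = (\<Sum>j<N. (\<lambda>k. x j * g j k))" using G by (simp add: fun_eq_iff fs_sum_apply)
    also have "\<dots> \<in> fs.span (g ` {..<N})" by (intro fs.span_sum fs.span_scale fs.span_base) auto
    finally show "y \<in> fs.span (g ` {..<N})" .
  qed
  have gG: "g ` {..<N} \<subseteq> G ` vecs N"
  proof
    fix y assume "y \<in> g ` {..<N}"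
    then obtain j where j: "j < N" "y = g j" by blast
    let ?x = "\<lambda>i. if i = j then 1 else (0 :: 'a)"
    have x: "?x \<in> vecs N" using j by (auto simp: vecs_def)
    have "G ?x = (\<lambda>k. \<Sum>i<N. if i = j then g j k else 0)"
      unfolding G[OF x] by (intro ext sum.cong) auto
    hence "G ?x = y" using j by (simp add: fun_eq_iff)
    thus "y \<in> G ` vecs N" using x by blast
  qed
  have spanB: "fs.span B = fs.span (g ` {..<N})"
    by (rule subset_antisym[OF fs.span_mono[OF B(1)] fs.span_minimal[OF B(3) fs.subspace_span]])
  have "fs.dim (G ` vecs N) = card B"
    by (rule fs.dim_unique[of B, OF _ _ B(2) refl]) (use B(1) gG image spanB in auto)
  hence rank: "lin_rank N G = card R" unfolding lin_rank_def R(3) card_image[OF R(2)] by simp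
  have "lin_rank N G \<le> N" using card_mono[OF _ R(1)] rank by simp
  moreover have "lin_rank N G \<le> m"
  proof -
    let ?E = "(\<lambda>i k. if k = i then 1 else (0 :: 'a)) ` {..<m}"
    have "G ` vecs N \<subseteq> fs.span ?E"
    proof
      fix y assume "y \<in> G ` vecs N"
      then obtain x where x: "x \<in> vecs N" "y = G x" by blast
      have "y k = 0" if "k \<ge> m" for k
        using x that g by (simp add: G vecs_def)
      hence "y k = (\<Sum>i<m. if k = i then y i else 0)" for k
        by (cases "k < m") (simp_all add: not_less)
      hence yk: "y k = (\<Sum>i<m. y i * (if k = i then 1 else 0))" for k
        by (rule trans) (rule sum.cong, auto)
      have "y = (\<Sum>i<m. (\<lambda>k. y i * (if k = i then 1 else 0)))"
        unfolding fun_eq_iff fs_sum_apply by (rule allI) (rule yk)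
      also have "\<dots> \<in> fs.span ?E" by (intro fs.span_sum fs.span_scale fs.span_base) auto
      finally show "y \<in> fs.span ?E" .
    qed
    hence "fs.dim (G ` vecs N) \<le> card ?E" by (rule fs.dim_le_card) simp
    also have "\<dots> \<le> m" using card_image_le[of "{..<m}"] by simp
    finally show ?thesis by (simp add: lin_rank_def)
  qed
  ultimately have bound: "lin_rank N G \<le> min N m" by simp
  let ?T = "{..<N} - R"
  have comp: "{..<N} - ?T = R" using R(1) by blast
  have cardT: "card ?T = N - lin_rank N G" using card_Diff_subset[OF finR R(1)] rank by simp
  have ex: "\<exists>x\<in>vecs N. G x = (\<lambda>_. 0) \<and> (\<forall>t\<in>?T. x t = y t)" for y
  proof -
    \<comment> \<open>The contribution of the free columns, with opposite sign, is a combination of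
      the basis columns; its coefficients are the entries at \<open>R\<close>.\<close>
    have "(\<Sum>t\<in>?T. (\<lambda>k. - y t * g t k)) \<in> fs.span B"
      unfolding spanB by (intro fs.span_sum fs.span_scale fs.span_base) auto
    then obtain u where u: "(\<Sum>t\<in>?T. (\<lambda>k. - y t * g t k)) = (\<Sum>b\<in>B. (\<lambda>k. u b * b k))"
      using fs.span_finite[of B] finR R(3) by auto
    define x where "x j = (if j \<in> R then u (g j) else if j \<in> ?T then y j else 0)" for j
    have x: "x \<in> vecs N" using R(1) by (auto simp: x_def vecs_def)
    have "G x k = 0" for k
    proof -
      have "(\<Sum>t\<in>?T. - y t * g t k) = (\<Sum>j\<in>R. u (g j) * g j k)"
        using fun_cong[OF u, of k] unfolding R(3) sum.reindex[OF R(2)] by (simp add: fs_sum_apply)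
      moreover have "(\<Sum>j<N. x j * g j k) = (\<Sum>j\<in>?T. x j * g j k) + (\<Sum>j\<in>R. x j * g j k)"
        using sum.subset_diff[OF R(1), of "\<lambda>j. x j * g j k"] by simp
      moreover have "(\<Sum>j\<in>?T. x j * g j k) = (\<Sum>t\<in>?T. y t * g t k)"
        by (rule sum.cong) (auto simp: x_def)
      moreover have "(\<Sum>j\<in>R. x j * g j k) = (\<Sum>j\<in>R. u (g j) * g j k)"
        by (rule sum.cong) (auto simp: x_def)
      ultimately show ?thesis by (simp add: G[OF x] sum_negf) (metis add.right_inverse)
    qed
    moreover have "\<forall>t\<in>?T. x t = y t" by (simp add: x_def)
    ultimately show ?thesis using x by (intro bexI[of _ x]) auto
  qed
  have uniq: "x j = 0" if x: "\<forall>k<m. (\<Sum>j\<in>{..<N} - ?T. g j k * x j) = 0" and j: "j \<in> {..<N} - ?T" for x j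
  proof -
    \<comment> \<open>The system has only the rows below \<open>m\<close>; in the other rows all
      columns vanish.\<close>
    have z: "(\<Sum>i\<in>R. x i * g i k) = 0" for k
    proof (cases "k < m")
      case True
      thus ?thesis using x unfolding comp by (simp add: mult.commute)
    next
      case False
      hence "g i k = 0" if "i \<in> R" for i using g[of i] R(1) that by (auto simp: vecs_def)
      thus ?thesis by (intro sum.neutral) simp
    qed
    let ?u = "\<lambda>b. x (inv_into R g b)"
    have "(\<Sum>b\<in>B. (\<lambda>k. ?u b * b k)) = 0"
      unfolding R(3) sum.reindex[OF R(2)]
      using z R(2) by (simp add: fun_eq_iff fs_sum_apply)
    hence "?u (g j) = 0"
      using fs.independentD[OF B(2), of B ?u "g j"] finR R(3) j comp by auto
    thus ?thesis using j comp R(2) by simp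
  qed
  show ?thesis using bound cardT ex uniq by (intro exI[of _ ?T]) blast
qed

section \<open>Matrix entries of a multilinear map as polynomials\<close>

locale multilinear_map =
  fixes d m :: nat and n :: "nat \<Rightarrow> nat" and F :: "(nat \<Rightarrow> nat \<Rightarrow> 'a::field) \<Rightarrow> nat \<Rightarrow> 'a"
  assumes d: "d > 0" and multilinear: "multilinear d n m F"
begin

definition unit_vec :: "nat \<Rightarrow> nat \<Rightarrow> 'a" where
  "unit_vec j i = (if i = j then 1 else 0)"

lemma unit_vec_vecs: "j < N \<Longrightarrow> unit_vec j \<in> vecs N"
  by (simp add: unit_vec_def[abs_def] vecs_def)

lemma blocks_upd: "v \<in> blocks d n \<Longrightarrow> i < d \<Longrightarrow> x \<in> vecs (n i) \<Longrightarrow> v(i := x) \<in> blocks d n"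
  by (auto simp: blocks_def vecs_def)

lemma expand:
  assumes i: "i < d" and v: "v \<in> blocks d n" and x: "x \<in> vecs (n i)"
  shows "F (v(i := x)) k = (\<Sum>j<n i. x j * F (v(i := unit_vec j)) k)"
proof -
  have lin: "F (v(i := (\<lambda>j. c * x j + y j))) = (\<lambda>k. c * F (v(i := x)) k + F (v(i := y)) k)"
    if "x \<in> vecs (n i)" "y \<in> vecs (n i)" for x y c
    using multilinear i v that unfolding multilinear_def by blast
  have z: "(\<lambda>_. 0) \<in> vecs (n i)" by (simp add: vecs_def)
  \<comment> \<open>With \<open>c = 1\<close> and two zero vectors the linearity law says that the
    value at zero equals its double.\<close>
  have "F (v(i := (\<lambda>_. 0))) k = F (v(i := (\<lambda>_. 0))) k + F (v(i := (\<lambda>_. 0))) k"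
    using fun_cong[OF lin[OF z z, of 1], of k] by (simp only: mult_1_left add_0)
  hence F0: "F (v(i := (\<lambda>_. 0))) k = 0" by (simp only: add_cancel_right_right)
  have part: "F (v(i := (\<lambda>j. if j < N then x j else 0))) k = (\<Sum>j<N. x j * F (v(i := unit_vec j)) k)"
    if "N \<le> n i" for N
    using that
  proof (induction N)
    case 0
    have "(\<lambda>j. if j < 0 then x j else 0) = (\<lambda>_. 0)" by (rule ext) simp
    thus ?case using F0 by (simp only: lessThan_0 sum.empty)
  next
    case (Suc N)
    let ?y = "\<lambda>j. if j < N then x j else 0"
    have eq: "(\<lambda>j. if j < Suc N then x j else 0) = (\<lambda>j. x N * unit_vec N j + ?y j)"
      by (auto simp: fun_eq_iff unit_vec_def less_Suc_eq)
    have "?y \<in> vecs (n i)" using Suc.prems by (auto simp: vecs_def)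
    moreover have "unit_vec N \<in> vecs (n i)" by (rule unit_vec_vecs) (use Suc.prems in simp)
    ultimately have "F (v(i := (\<lambda>j. x N * unit_vec N j + ?y j))) k = x N * F (v(i := unit_vec N)) k + F (v(i := ?y)) k"
      using fun_cong[OF lin[of "unit_vec N" ?y "x N"], of k] by blast
    moreover have "F (v(i := ?y)) k = (\<Sum>j<N. x j * F (v(i := unit_vec j)) k)"
      using Suc.prems by (intro Suc.IH) simp
    ultimately show ?case unfolding eq by (simp only: sum.lessThan_Suc add.commute)
  qed
  have "(\<lambda>j. if j < n i then x j else 0) = x" using x by (auto simp: fun_eq_iff vecs_def)
  with part[OF order_refl] show ?thesis by (simp only:)
qed

text \<open>The first \<open>i\<close> blocks come from the flat point \<open>p\<close>, cut off at
  their lengths, the rest from the fixed \<open>w\<close>. Raising \<open>i\<close> by one turns one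
  more block into variables, which is the induction in \<open>fill_polyfun\<close>.\<close>

definition fill :: "nat \<Rightarrow> (nat \<times> nat \<Rightarrow> 'a) \<Rightarrow> (nat \<Rightarrow> nat \<Rightarrow> 'a) \<Rightarrow> nat \<Rightarrow> nat \<Rightarrow> 'a" where
  "fill i p w a = (if a < i then (\<lambda>b. if b < n a then p (a, b) else 0) else w a)"

lemma fill_blocks: "i \<le> d \<Longrightarrow> w \<in> blocks d n \<Longrightarrow> fill i p w \<in> blocks d n"
  by (auto simp: blocks_def fill_def)

lemma fill_polyfun:
  assumes "i \<le> d" "w \<in> blocks d n"
  shows "(\<lambda>p. F (fill i p w) k) \<in> polyfun (coords i n)"
  using assms
proof (induction i arbitrary: w)
  case 0
  have "fill 0 p w = w" for p by (simp add: fill_def fun_eq_iff)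
  thus ?case by (simp add: polyfun.const)
next
  case (Suc i)
  have i: "i < d" using Suc.prems by simp
  have "F (fill (Suc i) p w) k = (\<Sum>j<n i. p (i, j) * F (fill i p (w(i := unit_vec j))) k)" for p
  proof -
    let ?x = "\<lambda>b. if b < n i then p (i, b) else 0"
    have 1: "fill (Suc i) p w = (fill i p w)(i := ?x)" by (auto simp: fill_def fun_eq_iff less_Suc_eq)
    have 2: "(fill i p w)(i := unit_vec j) = fill i p (w(i := unit_vec j))" for j
      by (auto simp: fill_def fun_eq_iff)
    have "?x \<in> vecs (n i)" by (simp add: vecs_def)
    have "F (fill (Suc i) p w) k = (\<Sum>j<n i. ?x j * F (fill i p (w(i := unit_vec j))) k)"
      using expand[OF i fill_blocks[OF less_imp_le[OF i] Suc.prems(2)] \<open>?x \<in> vecs (n i)\<close>, of p k]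
      by (simp only: 1 2)
    also have "\<dots> = (\<Sum>j<n i. p (i, j) * F (fill i p (w(i := unit_vec j))) k)"
      by (rule sum.cong) auto
    finally show ?thesis .
  qed
  moreover have "(\<lambda>p. \<Sum>j<n i. p (i, j) * F (fill i p (w(i := unit_vec j))) k) \<in> polyfun (coords (Suc i) n)"
  proof (intro polyfun_sum polyfun.mult)
    fix j assume j: "j \<in> {..<n i}"
    show "(\<lambda>p. p (i, j)) \<in> polyfun (coords (Suc i) n)"
      by (rule polyfun.coord) (use j in \<open>simp add: coords_def\<close>)
    show "(\<lambda>p. F (fill i p (w(i := unit_vec j))) k) \<in> polyfun (coords (Suc i) n)"
    proof (rule polyfun_mono[OF Suc.IH])
      show "w(i := unit_vec j) \<in> blocks d n"
        by (rule blocks_upd[OF Suc.prems(2) i unit_vec_vecs]) (use j in simp)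
    qed (use i in \<open>auto simp: coords_def\<close>)
  qed
  ultimately show ?case by (simp only:)
qed

abbreviation "D \<equiv> d - 1"

text \<open>The matrix of the induced linear map, row \<open>k\<close> and column \<open>j\<close>.
  Columns outside the last block are set to 0 so that the entry is polynomial for all indices, as
  \<open>indep_eliminate\<close> expects.\<close>

definition coef :: "nat \<Rightarrow> nat \<Rightarrow> (nat \<times> nat \<Rightarrow> 'a) \<Rightarrow> 'a" where
  "coef k j p = (if j < n D then F (fill D p ((\<lambda>_ _. 0)(D := unit_vec j))) k else 0)"

lemma coef_polyfun: "coef k j \<in> polyfun (coords D n)"
proof (cases "j < n D")
  case True
  have "(\<lambda>_ _. 0)(D := unit_vec j) \<in> blocks d n"
    by (rule blocks_upd[OF _ _ unit_vec_vecs[OF True]]) (use d in \<open>simp_all add: blocks_def\<close>)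
  from fill_polyfun[OF _ this, of D k] True show ?thesis by (simp add: coef_def[abs_def])
qed (simp add: coef_def[abs_def] polyfun.const)

lemma blocks_D: "v \<in> blocks D n \<Longrightarrow> v \<in> blocks d n"
  by (auto simp: blocks_def)

lemma F_coef:
  assumes v: "v \<in> blocks D n" and x: "x \<in> vecs (n D)"
  shows "F (v(D := x)) = (\<lambda>k. \<Sum>j<n D. x j * coef k j (case_prod v))"
proof
  fix k
  have "fill D (case_prod v) ((\<lambda>_ _. 0)(D := y)) = v(D := y)" for y
    using v d by (auto simp: fill_def blocks_def fun_eq_iff)
  thus "F (v(D := x)) k = (\<Sum>j<n D. x j * coef k j (case_prod v))"
    using expand[OF _ blocks_D[OF v] x, of k] d by (simp add: coef_def)
qed

lemma coef_vecs:
  assumes v: "v \<in> blocks D n"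
  shows "(\<lambda>k. coef k j (case_prod v)) \<in> vecs m"
proof (cases "j < n D")
  case True
  have "fill D (case_prod v) ((\<lambda>_ _. 0)(D := unit_vec j)) = v(D := unit_vec j)"
    using v d by (auto simp: fill_def blocks_def fun_eq_iff)
  moreover have "v(D := unit_vec j) \<in> blocks d n"
    by (rule blocks_upd[OF blocks_D[OF v] _ unit_vec_vecs[OF True]]) (use d in simp)
  hence "F (v(D := unit_vec j)) \<in> vecs m" using multilinear unfolding multilinear_def by blast
  ultimately show ?thesis using True by (simp add: coef_def)
qed (simp add: coef_def vecs_def)

abbreviation "rank_at v \<equiv> lin_rank (n D) (\<lambda>x. F (v(D := x)))"

lemma kernel_coords_at:
  assumes v: "v \<in> blocks D n"
  shows "\<exists>T\<subseteq>{..<n D}. rank_at v \<le> min (n D) m \<and> card T = n D - rank_at v \<and>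
    (\<forall>y. \<exists>x\<in>vecs (n D). F (v(D := x)) = (\<lambda>_. 0) \<and> (\<forall>t\<in>T. x t = y t)) \<and>
    (\<forall>x. (\<forall>k<m. (\<Sum>j\<in>{..<n D} - T. coef k j (case_prod v) * x j) = 0) \<longrightarrow> (\<forall>j\<in>{..<n D} - T. x j = 0))"
  by (rule kernel_coordinates[OF F_coef[OF v] coef_vecs[OF v]])

abbreviation "V \<equiv> coords d n"
abbreviation "W \<equiv> coords D n"
abbreviation "Z \<equiv> mult_variety d n F"
abbreviation "L \<equiv> rank_locus d n F"
abbreviation last_coords :: "nat set \<Rightarrow> (nat \<times> nat) set" where
  "last_coords T \<equiv> Pair D ` T"

lemma finite_coords: "finite (coords i n)"
  by (rule finite_subset[of _ "Sigma {..<i} (\<lambda>i. {..<n i})"]) (auto simp: coords_def)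

lemma coords_split: "V = W \<union> last_coords {..<n D}"
proof -
  have "i < d \<longleftrightarrow> i < D \<or> i = D" for i using d by linarith
  thus ?thesis unfolding coords_def by auto
qed

lemma W_last: "W \<inter> last_coords T = {}"
  by (auto simp: coords_def)

lemma card_coords: "card V = card W + n D"
  unfolding coords_split using finite_coords W_last by (simp add: card_Un_disjoint card_image inj_on_def)

lemma Z_pts: "Z \<subseteq> pts V"
  by (auto simp: mult_variety_def pts_def blocks_def coords_def)

lemma L_pts: "L r \<subseteq> pts W"
  by (auto simp: rank_locus_def pts_def blocks_def coords_def)

section \<open>The two bounds on the dimension of the zero set\<close>

text \<open>After elimination the independent set splits: the part in \<open>W\<close> is
  independent on \<open>L r\<close>, since it sees only the base points, and the part in
  \<open>last_coords T\<close> has at most \<open>n D - r\<close> elements.\<close>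

lemma indep_Z_le:
  assumes inf: "infinite (UNIV :: 'a set)" and J: "J \<subseteq> V" "indep J Z"
  shows "\<exists>r\<le>min (n D) m. \<exists>I\<subseteq>W. indep I (L r) \<and> card J \<le> card I + (n D - r)"
proof -
  \<comment> \<open>The columns outside \<open>T\<close> of the coefficient matrix at
    \<open>p\<close> are linearly independent, which is the nondegeneracy that elimination asks
    for.\<close>
  define good where "good T p \<longleftrightarrow> (\<forall>x. (\<forall>k<m. (\<Sum>j\<in>{..<n D} - T. coef k j p * x j) = 0) \<longrightarrow>
    (\<forall>j\<in>{..<n D} - T. x j = 0))" for T p
  let ?S = "\<lambda>(T, r). {q. \<exists>v\<in>blocks D n. \<exists>x\<in>vecs (n D). q = case_prod (v(D := x)) \<and>
     F (v(D := x)) = (\<lambda>_. 0) \<and> rank_at v = r \<and> good T (case_prod v)}"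
  let ?E = "{(T, r). T \<subseteq> {..<n D} \<and> r \<le> min (n D) m \<and> card T = n D - r}"
  have "Z \<subseteq> (\<Union>e\<in>?E. ?S e)"
  proof
    fix q assume "q \<in> Z"
    then obtain u where u: "q = case_prod u" "u \<in> blocks d n" "F u = (\<lambda>_. 0)"
      unfolding mult_variety_def by blast
    let ?v = "u(D := (\<lambda>_. 0))"
    have v: "?v \<in> blocks D n" using u(2) d by (auto simp: blocks_def)
    have x: "u D \<in> vecs (n D)" using u(2) by (auto simp: blocks_def vecs_def)
    obtain T where T: "T \<subseteq> {..<n D}" "rank_at ?v \<le> min (n D) m" "card T = n D - rank_at ?v"
      "good T (case_prod ?v)"
      using kernel_coords_at[OF v] unfolding good_def by blast
    have "q \<in> ?S (T, rank_at ?v)"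
      unfolding prod.case mem_Collect_eq
      by (rule bexI[OF _ v], rule bexI[OF _ x]) (use u T in simp)
    moreover have "(T, rank_at ?v) \<in> ?E" using T by blast
    ultimately show "q \<in> (\<Union>e\<in>?E. ?S e)" by (rule UN_I[rotated])
  qed
  note cover = this
  have "finite ?E"
    by (rule finite_subset[of _ "Pow {..<n D} \<times> {..min (n D) m}"]) auto
  note fin = this
  from indep_Union[OF inf fin J(2) cover]
  obtain e where e: "e \<in> ?E" "indep J (?S e)" by (elim bexE)
  obtain T r where Tr: "e = (T, r)" by (cases e)
  have T: "T \<subseteq> {..<n D}" "r \<le> min (n D) m" "card T = n D - r" using e(1) Tr by auto
  define S where "S = ?S (T, r)"
  have JS: "indep J S" using e(2) Tr by (simp add: S_def)
  let ?R = "last_coords ({..<n D} - T)" and ?T = "last_coords T"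
  \<comment> \<open>The coefficients read only the blocks before the last, so they agree at a point
    of \<open>Z\<close> and at its base point.\<close>
  have coefW: "coef k j (case_prod (v(D := x))) = coef k j (case_prod v)" for k j v x
    by (rule polyfun_cong[OF coef_polyfun]) (auto simp: coords_def)
  have inj: "inj_on (Pair D) A" for A by (simp add: inj_on_def)
  have "\<exists>I\<subseteq>W \<union> ?T. card I = card J \<and> indep I S"
  proof (rule indep_eliminate[OF inf, where R="?R" and E="{..<m}" and a="\<lambda>k ij. coef k (snd ij)"])
    show "finite W" by (rule finite_coords)
    show "finite ?T" using T(1) finite_subset by blast
    show "W \<inter> ?R = {}" by (rule W_last)
    show "coef e (snd i) \<in> polyfun W" for e i by (rule coef_polyfun)
    show "J \<subseteq> W \<union> ?R \<union> ?T" using J(1) T(1) unfolding coords_split by blast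
    show "(\<Sum>i\<in>?R \<union> ?T. coef e (snd i) p * p i) = 0" if p: "p \<in> S" "e \<in> {..<m}" for p e
    proof -
      obtain v x where vx: "v \<in> blocks D n" "x \<in> vecs (n D)" "p = case_prod (v(D := x))"
        "F (v(D := x)) = (\<lambda>_. 0)" using p(1) unfolding S_def by auto
      have "?R \<union> ?T = last_coords {..<n D}" using T(1) by blast
      hence "(\<Sum>i\<in>?R \<union> ?T. coef e (snd i) p * p i) = (\<Sum>j<n D. coef e j p * p (D, j))"
        by (simp only: sum.reindex[OF inj] o_def snd_conv)
      also have "\<dots> = F (v(D := x)) e"
        unfolding F_coef[OF vx(1,2)] vx(3) coefW prod.case fun_upd_same by (simp only: mult.commute)
      finally show ?thesis using vx(4) by simp
    qed
    show "x i = 0" if p: "p \<in> S" and x: "\<And>e. e \<in> {..<m} \<Longrightarrow> (\<Sum>i\<in>?R. coef e (snd i) p * x i) = 0"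
      and i: "i \<in> ?R" for p x i
    proof -
      obtain v y where v: "p = case_prod (v(D := y))" "good T (case_prod v)" using p unfolding S_def by auto
      have "\<forall>k<m. (\<Sum>j\<in>{..<n D} - T. coef k j (case_prod v) * x (D, j)) = 0"
      proof (rule allI, rule impI)
        fix k assume "k < m"
        hence "(\<Sum>i\<in>?R. coef k (snd i) p * x i) = 0" by (intro x) simp
        thus "(\<Sum>j\<in>{..<n D} - T. coef k j (case_prod v) * x (D, j)) = 0"
          by (simp only: sum.reindex[OF inj] o_def snd_conv v(1) coefW)
      qed
      hence "\<forall>j\<in>{..<n D} - T. x (D, j) = 0"
        using spec[OF v(2)[unfolded good_def], of "\<lambda>j. x (D, j)"] by blast
      thus ?thesis using i by auto
    qed
  qed (use JS in auto)
  then obtain I where I: "I \<subseteq> W \<union> ?T" "card I = card J" "indep I S" by blast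
  have "indep (I \<inter> W) (L r)"
    unfolding indep_def
  proof (rule ballI, rule impI)
    fix f assume f: "f \<in> polyfun (I \<inter> W)" "\<forall>p\<in>L r. f p = 0"
    \<comment> \<open>\<open>f\<close> uses base coordinates only, and the base point of
      \<open>p\<close> has rank \<open>r\<close>.\<close>
    have "f p = 0" if p: "p \<in> S" for p
    proof -
      obtain v x where vx: "v \<in> blocks D n" "p = case_prod (v(D := x))" "rank_at v = r"
        using p unfolding S_def by auto
      have "f p = f (case_prod v)"
        by (rule polyfun_cong[OF f(1)]) (auto simp: vx(2) coords_def)
      also have "\<dots> = 0" using f(2) vx unfolding rank_locus_def by blast
      finally show ?thesis .
    qed
    thus "\<forall>p. f p = 0" using indepD[OF I(3) polyfun_mono[OF f(1)]] by blast
  qed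
  moreover have "card J \<le> card (I \<inter> W) + (n D - r)"
  proof -
    have fin: "finite I" using I(1) finite_coords T(1) by (meson finite_Un finite_imageI finite_lessThan finite_subset)
    have "card I = card (I \<inter> W) + card (I - W)" using fin by (metis card_Int_Diff)
    also have "card (I - W) \<le> card ?T"
      by (rule card_mono) (use I(1) finite_subset[OF T(1)] in auto)
    also have "card ?T = n D - r" using T(3) by (simp only: card_image[OF inj])
    finally show ?thesis using I(2) by simp
  qed
  ultimately show ?thesis using T(2) by blast
qed

text \<open>\<open>T\<close> depends on the base point, so a piece of \<open>L r\<close> with
  constant \<open>T\<close> is chosen on which \<open>J\<close> is still independent. Over its
  points kernel vectors with arbitrary entries at \<open>T\<close> exist, so a relation on
  \<open>Z\<close> gives a relation in \<open>J\<close> for every frozen choice of these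
  entries.\<close>

lemma indep_Z_ge:
  assumes inf: "infinite (UNIV :: 'a set)" and J: "J \<subseteq> W" "indep J (L r)"
  shows "\<exists>I\<subseteq>V. indep I Z \<and> card I = card J + (n D - r)"
proof -
  let ?S = "\<lambda>T. {p. \<exists>v\<in>blocks D n. p = case_prod v \<and>
     (\<forall>y. \<exists>x\<in>vecs (n D). F (v(D := x)) = (\<lambda>_. 0) \<and> (\<forall>t\<in>T. x t = y t))}"
  let ?E = "{T. T \<subseteq> {..<n D} \<and> card T = n D - r}"
  have "L r \<subseteq> (\<Union>T\<in>?E. ?S T)"
  proof
    fix p assume "p \<in> L r"
    then obtain v where v: "p = case_prod v" "v \<in> blocks D n" "rank_at v = r"
      unfolding rank_locus_def by blast
    from kernel_coords_at[OF v(2)] obtain T where T: "T \<subseteq> {..<n D}" "card T = n D - r"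
       "\<forall>y. \<exists>x\<in>vecs (n D). F (v(D := x)) = (\<lambda>_. 0) \<and> (\<forall>t\<in>T. x t = y t)"
      using v(3) by blast
    have "p \<in> ?S T" using v T(3) by blast
    moreover have "T \<in> ?E" using T by blast
    ultimately show "p \<in> (\<Union>T\<in>?E. ?S T)" by (rule UN_I[rotated])
  qed
  note cover = this
  have "finite ?E" by (rule finite_subset[of _ "Pow {..<n D}"]) auto
  from indep_Union[OF inf this J(2) cover]
  obtain T where T': "T \<in> ?E" and T3: "indep J (?S T)" by (elim bexE)
  note T = CollectD[OF T', THEN conjunct1] CollectD[OF T', THEN conjunct2] T3
  let ?I = "J \<union> last_coords T"
  have "indep ?I Z"
    unfolding indep_def
  proof (rule ballI, rule impI, rule allI)
    fix f p0 assume f: "f \<in> polyfun ?I" "\<forall>q\<in>Z. f q = 0"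
    \<comment> \<open>The last block is frozen at that of \<open>p0\<close>, which leaves a function
      of \<open>J\<close> alone; at \<open>p0\<close> itself nothing changes.\<close>
    let ?mix = "\<lambda>(p :: nat \<times> nat \<Rightarrow> 'a) ij. if fst ij = D then p0 ij else p ij"
    let ?f1 = "\<lambda>p. f (?mix p)"
    have "?f1 \<in> polyfun J"
    proof (rule polyfun_compose[OF f(1)])
      fix ij assume "ij \<in> ?I"
      thus "(\<lambda>p. ?mix p ij) \<in> polyfun J"
        by (cases "fst ij = D") (auto intro: polyfun.const polyfun.coord)
    qed
    moreover have "?f1 p = 0" if p: "p \<in> ?S T" for p
    proof -
      obtain v where v: "v \<in> blocks D n" "p = case_prod v"
        "\<forall>y. \<exists>x\<in>vecs (n D). F (v(D := x)) = (\<lambda>_. 0) \<and> (\<forall>t\<in>T. x t = y t)" using p by blast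
      obtain x where x: "x \<in> vecs (n D)" "F (v(D := x)) = (\<lambda>_. 0)" "\<forall>t\<in>T. x t = p0 (D, t)"
        using v(3)[rule_format, of "\<lambda>t. p0 (D, t)"] by blast
      have "v(D := x) \<in> blocks d n" by (rule blocks_upd[OF blocks_D[OF v(1)] _ x(1)]) (use d in simp)
      hence "case_prod (v(D := x)) \<in> Z" using x(2) unfolding mult_variety_def by blast
      hence "f (case_prod (v(D := x))) = 0" using f(2) by blast
      moreover have "f (?mix p) = f (case_prod (v(D := x)))"
      proof (rule polyfun_cong[OF f(1)])
        fix ij assume ij: "ij \<in> ?I"
        show "?mix p ij = case_prod (v(D := x)) ij"
        proof (cases "ij \<in> J")
          case True
          hence "fst ij \<noteq> D" using J(1) by (auto simp: coords_def)
          thus ?thesis by (cases ij) (simp add: v(2))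
        next
          case False
          thus ?thesis using ij x(3) by auto
        qed
      qed
      ultimately show ?thesis by simp
    qed
    ultimately have "?f1 p0 = 0" by (rule indepD[OF T(3)])
    moreover have "?mix p0 = p0" by (simp add: fun_eq_iff)
    ultimately show "f p0 = 0" by simp
  qed
  moreover have "?I \<subseteq> V" using J(1) T(1) unfolding coords_split by blast
  moreover have "card ?I = card J + (n D - r)"
  proof -
    have "finite J" "finite (last_coords T)" using J(1) T(1) finite_coords finite_subset by blast+
    moreover have "J \<inter> last_coords T = {}" using J(1) W_last by blast
    ultimately show ?thesis using T(2) by (simp add: card_Un_disjoint card_image inj_on_def)
  qed
  ultimately show ?thesis by blast
qed

text \<open>Empty loci contribute infinity and cannot spoil the minimum. For the others
  \<open>indep_Z_ge\<close> gives one inequality, and the locus supplied by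
  \<open>indep_Z_le\<close> attains equality; \<open>card V = card W + n D\<close> converts
  dimensions to codimensions.\<close>

lemma codim_formula:
  assumes inf: "infinite (UNIV :: 'a set)"
  shows "alg_codim V (zar_closure V Z) = (MIN r\<in>{0..min (n D) m}. enat r + alg_codim W (zar_closure W (L r)))"
proof -
  let ?t = "\<lambda>r. enat r + alg_codim W (zar_closure W (L r))"
  let ?z = "indep_dim V Z" and ?w = "\<lambda>r. indep_dim W (L r)"
  have finV: "finite V" and finW: "finite W" by (rule finite_coords)+
  \<comment> \<open>The zero tuple lies in \<open>Z\<close>, because \<open>F\<close> is linear in
    the last argument; hence the left side is finite.\<close>
  have Zne: "Z \<noteq> {}"
  proof -
    let ?u = "(\<lambda>_ _. 0) :: nat \<Rightarrow> nat \<Rightarrow> 'a"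
    have u: "?u \<in> blocks d n" by (simp add: blocks_def)
    have "F (?u(D := (\<lambda>_. 0))) k = 0" for k
      using expand[OF _ u, of D "\<lambda>_. 0" k] d by (simp add: vecs_def)
    moreover have "?u(D := (\<lambda>_. 0)) = ?u" by (simp add: fun_eq_iff)
    ultimately have "F ?u = (\<lambda>_. 0)" by (intro ext) (simp only:)
    thus ?thesis using u unfolding mult_variety_def by blast
  qed
  have t: "?t r = enat (r + (card W - ?w r))" if "L r \<noteq> {}" for r
    using that by (simp only: alg_codim_zar_closure[OF inf finW L_pts] if_False plus_enat_simps)
  have t_inf: "?t r = \<infinity>" if "L r = {}" for r
    using alg_codim_zar_closure[OF inf finW L_pts, of r] that by simp
  have lower: "?w r + (n D - r) \<le> ?z" if "L r \<noteq> {}" for r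
  proof -
    obtain J where "J \<subseteq> W" "indep J (L r)" "card J = ?w r" using indep_dim_attained[OF finW \<open>L r \<noteq> {}\<close>] by blast
    with indep_Z_ge[OF inf] indep_dim_ge[OF finV] show ?thesis by metis
  qed
  obtain J where J: "J \<subseteq> V" "indep J Z" "card J = ?z" using indep_dim_attained[OF finV Zne] by blast
  obtain r0 I where r0: "r0 \<le> min (n D) m" "I \<subseteq> W" "indep I (L r0)" "?z \<le> card I + (n D - r0)"
    using indep_Z_le[OF inf J(1,2)] J(3) by auto
  have L0: "L r0 \<noteq> {}" using r0(3) not_indep_no_points by metis
  have upper: "?z \<le> ?w r0 + (n D - r0)" using r0(4) indep_dim_ge[OF finW r0(2,3)] by simp
  have wW: "?w r \<le> card W" if "L r \<noteq> {}" for r by (rule indep_dim_le[OF finW that])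
  have lhs: "alg_codim V (zar_closure V Z) = enat (card V - ?z)"
    using Zne by (simp only: alg_codim_zar_closure[OF inf finV Z_pts] if_False)
  have "Min (?t ` {0..min (n D) m}) = enat (card V - ?z)"
  proof (rule Min_eqI)
    show "finite (?t ` {0..min (n D) m})" by simp
    fix y assume "y \<in> ?t ` {0..min (n D) m}"
    then obtain r where r: "r \<le> min (n D) m" "y = ?t r" by auto
    show "enat (card V - ?z) \<le> y"
    proof (cases "L r = {}")
      case True
      thus ?thesis using t_inf r(2) by simp
    next
      case False
      have "card V - ?z \<le> r + (card W - ?w r)"
        using lower[OF False] wW[OF False] min.cobounded1[THEN order_trans[OF r(1)]] card_coords by linarith
      thus ?thesis unfolding r(2) t[OF False] by simp
    qed
  next
    \<comment> \<open>Truncated subtraction is harmless here: \<open>r0 \<le> n D\<close>, and the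
      dimensions do not exceed the numbers of coordinates.\<close>
    have "card V - ?z = r0 + (card W - ?w r0)"
      using upper lower[OF L0] wW[OF L0] min.cobounded1[THEN order_trans[OF r0(1)]] card_coords by linarith
    hence "enat (card V - ?z) = ?t r0" unfolding t[OF L0] by (rule arg_cong)
    thus "enat (card V - ?z) \<in> ?t ` {0..min (n D) m}" using r0(1) by simp
  qed
  thus ?thesis using lhs by simp
qed

end

theorem theorem1p1:
  fixes d m :: nat and n :: "nat \<Rightarrow> nat"
    and F :: "(nat \<Rightarrow> nat \<Rightarrow> 'a::field) \<Rightarrow> nat \<Rightarrow> 'a"
  assumes "infinite (UNIV :: 'a set)"
    and "d \<ge> 2" and "\<forall>i<d. n i > 0" and "m > 0"
    and "multilinear d n m F"
  shows "alg_codim (coords d n) (zar_closure (coords d n) (mult_variety d n F)) =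
    (MIN r\<in>{0..min (n (d - 1)) m}.
        enat r + alg_codim (coords (d - 1) n) (zar_closure (coords (d - 1) n) (rank_locus d n F r)))"
proof -
  interpret multilinear_map d m n F
    by standard (use assms in auto)
  show ?thesis by (rule codim_formula[OF assms(1)])
qed

end
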